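(* Let $n\ge1$, $1\le r\le n$, and $0\le j_1<j_2<\dots<j_{n-1}\le 2n-3$ integers. The number of alternating sign triangles $T$ of order $n$ whose non-central $1$-columns are exactly those in positions $j_1,\dots,j_{n-1}$ and with $\rho(T)=r$ equals the coefficient of $X_1^{j_1}X_2^{j_2}\cdots X_{n-1}^{j_{n-1}}t^{r-1}$ in $$\prod_{i=1}^{n-1}(t+X_i)\prod_{1\le i<j\le n-1}(1+X_i+X_iX_j)(X_j-X_i).$$
   Context: An alternating sign triangle (AST) of order $n$ is a triangular array $(a_{i,j})_{1\le i\le n,\ i\le j\le 2n-i}$ (row $i$ has entries $a_{i,i},\dots,a_{i,2n-i}$; entries with the same $j$ form column $j$; there are $2n-1$ columns, the central one being column $n$) with entries in $\{0,1,-1\}$ such that: (1) the non-zero entries alternate in sign in each row and in each column; (2) every row sum is $1$; (3) the topmost non-zero entry of each column (if any) is $1$. A $1$-column is a column with sum $1$; it is a $10$-column if its bottom entry is $0$ and an $11$-column if its bottom entry is $1$. Positions of non-central columns are counted from the left starting with $0$, disregarding the central column (range $0,\dots,2n-3$). $\rho(T)$ is the number of $11$-columns left of the central column plus the number of $10$-columns right of the central column plus $1$. *)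

theory Defs
  imports "HOL-Library.Poly_Mapping" "HOL-Library.FuncSet"
begin

definition row_cols :: "nat \<Rightarrow> nat \<Rightarrow> nat set" where
  "row_cols n i = {i..2 * n - i}"

text \<open>The triangle has a cell in row \<open>i\<close> and column \<open>j\<close> iff \<open>1 \<le> i \<le> n\<close> and
  \<open>i \<le> j \<le> 2 * n - i\<close>, so column \<open>j\<close> (for \<open>1 \<le> j \<le> 2 * n - 1\<close>) consists of rows
  \<open>1, \<dots>, min j (2 * n - j)\<close>.\<close>

definition cells :: "nat \<Rightarrow> (nat \<times> nat) set" where
  "cells n = (SIGMA i:{1..n}. row_cols n i)"

definition bottom_row :: "nat \<Rightarrow> nat \<Rightarrow> nat" where
  "bottom_row n j = min j (2 * n - j)"

definition col_rows :: "nat \<Rightarrow> nat \<Rightarrow> nat set" where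
  "col_rows n j = {1..bottom_row n j}"

lemma mem_cells_iff_row_cols: "(i, j) \<in> cells n \<longleftrightarrow> i \<in> {1..n} \<and> j \<in> row_cols n i"
  by (auto simp: cells_def)

lemma mem_cells_iff_col_rows: "(i, j) \<in> cells n \<longleftrightarrow> j \<in> {1..2 * n - 1} \<and> i \<in> col_rows n j"
  by (auto simp: cells_def row_cols_def col_rows_def bottom_row_def)

text \<open>Consecutive non-zero values of \<open>f\<close> along the interval \<open>I\<close> have opposite signs; the
  values are meant to lie in \<open>{0, 1, -1}\<close>, so opposite sign means negative of each other.\<close>

definition nonzero_alternate :: "nat set \<Rightarrow> (nat \<Rightarrow> int) \<Rightarrow> bool" where
  "nonzero_alternate I f \<longleftrightarrow>
     (\<forall>k\<in>I. \<forall>l\<in>I. k < l \<and> f k \<noteq> 0 \<and> f l \<noteq> 0 \<and> (\<forall>m\<in>I. k < m \<and> m < l \<longrightarrow> f m = 0)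
        \<longrightarrow> f l = - f k)"

text \<open>Triangles are functions on \<open>cells n\<close>, extensional outside of it, so that distinct
  functions are distinct triangles.\<close>

definition alternating_sign_triangle :: "nat \<Rightarrow> (nat \<times> nat \<Rightarrow> int) \<Rightarrow> bool" where
  "alternating_sign_triangle n T \<longleftrightarrow>
     T \<in> cells n \<rightarrow>\<^sub>E {0, 1, -1} \<and>
     (\<forall>i\<in>{1..n}. nonzero_alternate (row_cols n i) (\<lambda>j. T (i, j))) \<and>
     (\<forall>j\<in>{1..2 * n - 1}. nonzero_alternate (col_rows n j) (\<lambda>i. T (i, j))) \<and>
     (\<forall>i\<in>{1..n}. (\<Sum>j\<in>row_cols n i. T (i, j)) = 1) \<and>
     (\<forall>j\<in>{1..2 * n - 1}. \<forall>i\<in>col_rows n j.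
        T (i, j) \<noteq> 0 \<and> (\<forall>k\<in>col_rows n j. k < i \<longrightarrow> T (k, j) = 0) \<longrightarrow> T (i, j) = 1)"

lemma finite_alternating_sign_triangles: "finite {T. alternating_sign_triangle n T}"
proof (rule finite_subset)
  show "{T. alternating_sign_triangle n T} \<subseteq> cells n \<rightarrow>\<^sub>E {0, 1, -1}"
    by (auto simp: alternating_sign_triangle_def)
  show "finite (cells n \<rightarrow>\<^sub>E {0, 1, - 1 :: int})"
    by (intro finite_PiE) (auto simp: cells_def row_cols_def)
qed

definition one_column :: "nat \<Rightarrow> (nat \<times> nat \<Rightarrow> int) \<Rightarrow> nat \<Rightarrow> bool" where
  "one_column n T j \<longleftrightarrow> (\<Sum>i\<in>col_rows n j. T (i, j)) = 1"

definition one_zero_column :: "nat \<Rightarrow> (nat \<times> nat \<Rightarrow> int) \<Rightarrow> nat \<Rightarrow> bool" where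
  "one_zero_column n T j \<longleftrightarrow> one_column n T j \<and> T (bottom_row n j, j) = 0"

definition one_one_column :: "nat \<Rightarrow> (nat \<times> nat \<Rightarrow> int) \<Rightarrow> nat \<Rightarrow> bool" where
  "one_one_column n T j \<longleftrightarrow> one_column n T j \<and> T (bottom_row n j, j) = 1"

definition noncentral_columns :: "nat \<Rightarrow> nat set" where
  "noncentral_columns n = {1..2 * n - 1} - {n}"

definition column_position :: "nat \<Rightarrow> nat \<Rightarrow> nat" where
  "column_position n j = (if j < n then j - 1 else j - 2)"

text \<open>Positions enumerate the non-central columns from left to right as \<open>0, \<dots>, 2 * n - 3\<close>
  (there are none if \<open>n = 1\<close>).\<close>

lemma bij_betw_column_position:
  "bij_betw (column_position n) (noncentral_columns n) {..<2 * n - 2}"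
proof (rule bij_betw_byWitness[where f' = "\<lambda>p. if p + 1 < n then p + 1 else p + 2"])
qed (auto simp: column_position_def noncentral_columns_def)

lemma strict_mono_on_column_position:
  "strict_mono_on (noncentral_columns n) (column_position n)"
  by (auto simp: strict_mono_on_def column_position_def noncentral_columns_def)

definition one_column_positions :: "nat \<Rightarrow> (nat \<times> nat \<Rightarrow> int) \<Rightarrow> nat set" where
  "one_column_positions n T =
     column_position n ` {j \<in> noncentral_columns n. one_column n T j}"

definition rho :: "nat \<Rightarrow> (nat \<times> nat \<Rightarrow> int) \<Rightarrow> nat" where
  "rho n T = card {j \<in> {1..<n}. one_one_column n T j}
           + card {j \<in> {n<..2 * n - 1}. one_zero_column n T j} + 1"

text \<open>A monomial is a finitely supported exponent function on the variables, and a polynomial is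
  a finitely supported function from monomials to coefficients, so \<open>lookup\<close> extracts coefficients
  and the product on \<open>poly_mapping\<close> is polynomial multiplication.\<close>

datatype indet = T_ind | X_ind nat

type_synonym monomial = "indet \<Rightarrow>\<^sub>0 nat"

type_synonym mpoly_int = "monomial \<Rightarrow>\<^sub>0 int"

definition poly_var :: "indet \<Rightarrow> mpoly_int" where
  "poly_var v = Poly_Mapping.single (Poly_Mapping.single v 1) 1"

abbreviation poly_t :: mpoly_int where "poly_t \<equiv> poly_var T_ind"

abbreviation poly_X :: "nat \<Rightarrow> mpoly_int" where "poly_X i \<equiv> poly_var (X_ind i)"

definition ast_poly :: "nat \<Rightarrow> mpoly_int" where
  "ast_poly n =
     (\<Prod>i\<in>{1..n - 1}. poly_t + poly_X i) *
     (\<Prod>(i, j)\<in>{(i, j). 1 \<le> i \<and> i < j \<and> j \<le> n - 1}.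
        (1 + poly_X i + poly_X i * poly_X j) * (poly_X j - poly_X i))"

lemma finite_ast_poly_index: "finite {(i, j). 1 \<le> i \<and> i < j \<and> j \<le> n - (1 :: nat)}"
  by (rule finite_subset[of _ "{1..n} \<times> {1..n}"]) auto

text \<open>\<open>ast_monomial n js k\<close> is \<open>X\<^sub>1\<^bsup>js 1\<^esup> \<cdots> X\<^bsub>n-1\<^esub>\<^bsup>js (n-1)\<^esup> t\<^bsup>k\<^esup>\<close>, written
  additively as monomials multiply by adding exponents.\<close>

definition ast_monomial :: "nat \<Rightarrow> (nat \<Rightarrow> nat) \<Rightarrow> nat \<Rightarrow> monomial" where
  "ast_monomial n js k =
     (\<Sum>i\<in>{1..n - 1}. Poly_Mapping.single (X_ind i) (js i)) + Poly_Mapping.single T_ind k"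

end

theory Submission
  imports Defs "HOL-Computational_Algebra.Polynomial"
begin

text \<open>The columns with partial sum \<open>1\<close> after each row form a monotone triangle in which the outer
  columns are frozen one pair at a time. The weighted number of ways to reach a given row is the
  constant term of \<open>\<Prod>\<^bsub>p<q\<^esub> (1 + Y\<^sub>q + Y\<^sub>p Y\<^sub>q) (1/Y\<^sub>q - 1/Y\<^sub>p)\<close> times one test polynomial for every
  column: a polynomial in \<open>U = 1/Y\<close> for the columns frozen on the left, a power of \<open>1 + Y\<close> for the
  columns in the middle, and a polynomial in \<open>Y\<close> for those frozen on the right. In this form
  adding a row amounts to eliminating one variable. For the last row, the substitution
  \<open>X = 1/Y\<close> turns the constant term into a coefficient of the polynomial of the theorem.

  Everything rests on one fact: with \<open>\<eta> = 1/Y\<close> for the variables on the right and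
  \<open>\<eta> = -(1 + 1/U)\<close> for those on the left, the kernel is the Vandermonde product in the \<open>\<eta>\<close> times a
  polynomial in the \<open>Y\<close> on the right and the \<open>U\<close> on the left. Hence symmetric polynomials in the
  \<open>1/\<eta>\<close> act on the constant term through their value at \<open>0\<close>, provided that the denominators
  \<open>1 + U\<close> are cleared.\<close>

section \<open>Laurent polynomials and constant terms\<close>

text \<open>Read \<open>Y\<close> as a forward difference and \<open>1 + Y\<close> as a unit shift:
  a power of \<open>1 + Y\<close> then stands for the position of a column, and without frozen
  columns the constant term is the operator formula for the number of monotone triangles with given
  bottom row. Freezing columns on both sides is the obstacle: the kernel is not antisymmetric, and
  the tests on the left and on the right have exponents of opposite sign. The points \<eta> are
  chosen such that each kernel factor is a difference of two points times a cofactor that keeps to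
  \<open>U\<close> on the left and to \<open>Y\<close> on the right. What kills a constant term is
  then a Laplace expansion of the Vandermonde product: in each of its terms one variable has all
  exponents strictly on its own side. A parameter \<open>s\<close> shifts all points at once;
  \<open>s = 1\<close> yields the translation of a row, and \<open>s = -1/Y\<close> for a middle
  variable eliminates that variable. The last row is a single cell and is split off; its factor
  \<open>t\<close> accounts for the exponent \<open>r - 1\<close> in place of
  \<open>r\<close>.\<close>

abbreviation lookup :: "('a \<Rightarrow>\<^sub>0 'b::zero) \<Rightarrow> 'a \<Rightarrow> 'b" where
  "lookup \<equiv> Poly_Mapping.lookup"

abbreviation keys :: "('a \<Rightarrow>\<^sub>0 'b::zero) \<Rightarrow> 'a set" where
  "keys \<equiv> Poly_Mapping.keys"

lemma poly_mapping_sum_single: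
  fixes p :: "'k \<Rightarrow>\<^sub>0 'a::comm_monoid_add"
  shows "p = (\<Sum>k\<in>keys p. Poly_Mapping.single k (lookup p k))"
proof (rule poly_mapping_eqI)
  fix j
  show "lookup p j = lookup (\<Sum>k\<in>keys p. Poly_Mapping.single k (lookup p k)) j"
    by (simp add: lookup_sum lookup_single when_def sum.delta in_keys_iff)
qed

lemma poly_mapping_single_induct [case_names single add]:
  fixes p :: "'k \<Rightarrow>\<^sub>0 'a::comm_monoid_add"
  assumes single: "\<And>k a. P (Poly_Mapping.single k a)"
    and add: "\<And>p q. P p \<Longrightarrow> P q \<Longrightarrow> P (p + q)"
  shows "P p"
proof -
  have "P (\<Sum>k\<in>A. Poly_Mapping.single k (lookup p k))" if "finite A" for A
    using that
  proof induction
    case empty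
    show ?case using single[of undefined 0] by simp
  next
    case (insert k A)
    then show ?case by (simp add: add single)
  qed
  from this[OF finite_keys] show ?thesis
    by (subst poly_mapping_sum_single)
qed

section \<open>Evaluation of finitely supported functions\<close>

definition pm_eval :: "('a \<Rightarrow> 'r) \<Rightarrow> ('k \<Rightarrow> 'r) \<Rightarrow> ('k \<Rightarrow>\<^sub>0 'a::zero) \<Rightarrow> 'r::comm_ring_1" where
  "pm_eval c \<theta> p = (\<Sum>k\<in>keys p. c (lookup p k) * \<theta> k)"

text \<open>Two instances are needed: renaming of Laurent variables, and the passage from the
  polynomials of the theorem to Laurent polynomials.\<close>

locale pm_hom =
  fixes c :: "'a::comm_ring_1 \<Rightarrow> 'r::comm_ring_1" and \<theta> :: "'k::comm_monoid_add \<Rightarrow> 'r"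
  assumes c_add: "c (a + b) = c a + c b" and c_mult: "c (a * b) = c a * c b" and c_one: "c 1 = 1"
    and th_add: "\<theta> (k + l) = \<theta> k * \<theta> l" and th_zero: "\<theta> 0 = 1"
begin

lemma c_zero: "c 0 = 0"
  using c_add[of 0 0] by simp

lemma eval_single: "pm_eval c \<theta> (Poly_Mapping.single k a) = c a * \<theta> k"
  by (simp add: pm_eval_def c_zero)

lemma eval_superset:
  assumes "finite A" "keys p \<subseteq> A"
  shows "pm_eval c \<theta> p = (\<Sum>k\<in>A. c (lookup p k) * \<theta> k)"
  unfolding pm_eval_def using assms
  by (intro sum.mono_neutral_left) (auto simp: in_keys_iff c_zero)

lemma eval_add: "pm_eval c \<theta> (p + q) = pm_eval c \<theta> p + pm_eval c \<theta> q"
proof -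
  let ?A = "keys p \<union> keys q"
  have "keys (p + q) \<subseteq> ?A" by (rule keys_add)
  then show ?thesis
    by (simp add: eval_superset[of ?A] lookup_add c_add distrib_right sum.distrib)
qed

lemma eval_mult: "pm_eval c \<theta> (p * q) = pm_eval c \<theta> p * pm_eval c \<theta> q"
proof (induction p rule: poly_mapping_single_induct)
  case (single k a)
  show ?case
    by (induction q rule: poly_mapping_single_induct)
      (simp_all add: eval_single mult_single c_mult th_add eval_add algebra_simps)
qed (simp add: eval_add algebra_simps)

lemma eval_one: "pm_eval c \<theta> 1 = 1"
  using eval_single[of 0 1] by (simp add: c_one th_zero)

lemma eval_uminus: "pm_eval c \<theta> (- p) = - pm_eval c \<theta> p"
proof -
  have "pm_eval c \<theta> (- p) + pm_eval c \<theta> p = pm_eval c \<theta> 0"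
    by (subst eval_add[symmetric]) simp
  then show ?thesis by (simp add: pm_eval_def eq_neg_iff_add_eq_0)
qed

lemma eval_diff: "pm_eval c \<theta> (p - q) = pm_eval c \<theta> p - pm_eval c \<theta> q"
  by (simp only: diff_conv_add_uminus eval_add eval_uminus)

lemma eval_prod_list:
  "pm_eval c \<theta> (\<Prod>x\<leftarrow>xs. f x) = (\<Prod>x\<leftarrow>xs. pm_eval c \<theta> (f x))"
  by (induction xs) (simp_all add: eval_one eval_mult)

lemma eval_prod: "pm_eval c \<theta> (\<Prod>x\<in>A. f x) = (\<Prod>x\<in>A. pm_eval c \<theta> (f x))"
  by (induction A rule: infinite_finite_induct) (simp_all add: eval_one eval_mult)

lemmas eval_hom = eval_add eval_mult eval_one eval_uminus eval_diff eval_prod_list eval_prod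

end

type_synonym 'a laurent = "(nat \<Rightarrow>\<^sub>0 int) \<Rightarrow>\<^sub>0 'a"

definition cst :: "'a::comm_ring_1 \<Rightarrow> 'a laurent" where
  "cst a = Poly_Mapping.single 0 a"

definition ct :: "'a::comm_ring_1 laurent \<Rightarrow> 'a" where
  "ct f = lookup f 0"

definition Y :: "nat \<Rightarrow> 'a::comm_ring_1 laurent" where
  "Y v = Poly_Mapping.single (Poly_Mapping.single v 1) 1"

definition U :: "nat \<Rightarrow> 'a::comm_ring_1 laurent" where
  "U v = Poly_Mapping.single (Poly_Mapping.single v (-1)) 1"

lemma Y_U [simp]: "Y v * U v = 1" "U v * Y v = 1"
  by (simp_all add: Y_def U_def mult_single flip: single_add)

lemma Y_U_left [simp]: "Y v * (U v * f) = f" "U v * (Y v * f) = f"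
  by (simp_all flip: mult.assoc)

lemma cst_hom: "cst (a + b) = cst a + cst b" "cst (a * b) = cst a * cst b" "cst 1 = 1" "cst 0 = 0"
  by (simp_all add: cst_def single_add mult_single)

lemma ct_hom [simp]: "ct (f + g) = ct f + ct g" "ct (f - g) = ct f - ct g" "ct (- f) = - ct f" "ct 0 = 0"
  by (simp_all add: ct_def lookup_add lookup_minus)

lemma ct_one [simp]: "ct 1 = 1"
  by (simp add: ct_def)

lemma ct_cst_mult: "ct (cst a * f) = a * ct f"
proof (induction f rule: poly_mapping_single_induct)
  case (single k b)
  show ?case by (simp add: cst_def ct_def mult_single lookup_single mult_when)
qed (simp add: algebra_simps)

subsection \<open>Exponent bounds\<close>

text \<open>The orientation \<open>\<epsilon>\<close> is \<open>1\<close> or \<open>-1\<close>.\<close>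

definition exp_ge :: "int \<Rightarrow> int \<Rightarrow> nat \<Rightarrow> 'a::comm_ring_1 laurent \<Rightarrow> bool" where
  "exp_ge c \<epsilon> v f \<longleftrightarrow> (\<forall>k\<in>keys f. c \<le> \<epsilon> * lookup k v)"

definition free :: "nat \<Rightarrow> 'a::comm_ring_1 laurent \<Rightarrow> bool" where
  "free v f \<longleftrightarrow> (\<forall>k\<in>keys f. lookup k v = 0)"

lemma exp_ge_add: "exp_ge c \<epsilon> v f \<Longrightarrow> exp_ge c \<epsilon> v g \<Longrightarrow> exp_ge c \<epsilon> v (f + g)"
  using keys_add[of f g] by (auto simp: exp_ge_def)

lemma exp_ge_uminus: "exp_ge c \<epsilon> v f \<Longrightarrow> exp_ge c \<epsilon> v (- f)"
  by (auto simp: exp_ge_def in_keys_iff)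

lemma exp_ge_diff: "exp_ge c \<epsilon> v f \<Longrightarrow> exp_ge c \<epsilon> v g \<Longrightarrow> exp_ge c \<epsilon> v (f - g)"
  by (simp only: diff_conv_add_uminus exp_ge_add exp_ge_uminus)

lemma exp_ge_mult:
  assumes "exp_ge c \<epsilon> v f" "exp_ge c' \<epsilon> v g"
  shows "exp_ge (c + c') \<epsilon> v (f * g)"
  using assms keys_mult[of f g]
  by (fastforce simp: exp_ge_def lookup_add distrib_left)

lemma exp_ge_mult0: "exp_ge 0 \<epsilon> v f \<Longrightarrow> exp_ge 0 \<epsilon> v g \<Longrightarrow> exp_ge 0 \<epsilon> v (f * g)"
  using exp_ge_mult[of 0 \<epsilon> v f 0 g] by simp

lemma exp_ge_1_mult: "exp_ge 1 \<epsilon> v f \<Longrightarrow> exp_ge 0 \<epsilon> v g \<Longrightarrow> exp_ge 1 \<epsilon> v (f * g)"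
  using exp_ge_mult[of 1 \<epsilon> v f 0 g] by simp

lemma exp_ge_mult_1: "exp_ge 0 \<epsilon> v f \<Longrightarrow> exp_ge 1 \<epsilon> v g \<Longrightarrow> exp_ge 1 \<epsilon> v (f * g)"
  using exp_ge_mult[of 0 \<epsilon> v f 1 g] by simp

lemma exp_ge_0_of_1: "exp_ge 1 \<epsilon> v f \<Longrightarrow> exp_ge 0 \<epsilon> v f"
  by (fastforce simp: exp_ge_def)

lemma exp_ge_0_of_free: "free v f \<Longrightarrow> exp_ge 0 \<epsilon> v f"
  by (auto simp: exp_ge_def free_def)

lemma free_add: "free v f \<Longrightarrow> free v g \<Longrightarrow> free v (f + g)"
  using keys_add[of f g] by (auto simp: free_def)

lemma free_uminus: "free v f \<Longrightarrow> free v (- f)"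
  by (auto simp: free_def in_keys_iff)

lemma free_diff: "free v f \<Longrightarrow> free v g \<Longrightarrow> free v (f - g)"
  by (simp only: diff_conv_add_uminus free_add free_uminus)

lemma free_mult: "free v f \<Longrightarrow> free v g \<Longrightarrow> free v (f * g)"
  using keys_mult[of f g] by (fastforce simp: free_def lookup_add)

lemma free_cst: "free v (cst a)"
  by (simp add: free_def cst_def)

lemma free_0: "free v 0"
  by (simp add: free_def)

lemma free_1: "free v 1"
  by (simp add: free_def)

lemma free_Y: "w \<noteq> v \<Longrightarrow> free v (Y w)"
  by (simp add: free_def Y_def lookup_single)

lemma free_U: "w \<noteq> v \<Longrightarrow> free v (U w)"
  by (simp add: free_def U_def lookup_single)

lemma exp_ge_Y: "exp_ge 1 1 v (Y v)"
  by (simp add: exp_ge_def Y_def lookup_single)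

lemma exp_ge_U: "exp_ge 1 (-1) v (U v)"
  by (simp add: exp_ge_def U_def lookup_single)

lemma free_prod_list: "(\<And>x. x \<in> set xs \<Longrightarrow> free v (f x)) \<Longrightarrow> free v (\<Prod>x\<leftarrow>xs. f x)"
  by (induction xs) (simp_all add: free_1 free_mult)

lemma exp_ge_1: "exp_ge 0 \<epsilon> v 1"
  by (rule exp_ge_0_of_free[OF free_1])

lemma exp_ge_prod_list:
  "(\<And>x. x \<in> set xs \<Longrightarrow> exp_ge 0 \<epsilon> v (f x)) \<Longrightarrow> exp_ge 0 \<epsilon> v (\<Prod>x\<leftarrow>xs. f x)"
  by (induction xs) (simp_all add: exp_ge_1 exp_ge_mult0)

lemmas free_intros = free_add free_uminus free_diff free_mult free_cst free_0 free_1 free_Y free_U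
  free_prod_list

lemmas exp_ge_intros = exp_ge_add exp_ge_uminus exp_ge_diff exp_ge_mult0 exp_ge_1
  exp_ge_0_of_1[OF exp_ge_Y] exp_ge_0_of_1[OF exp_ge_U] exp_ge_prod_list
  exp_ge_0_of_free[OF free_Y] exp_ge_0_of_free[OF free_U] exp_ge_0_of_free[OF free_cst]

lemma ct_exp_ge_1: "exp_ge 1 \<epsilon> v f \<Longrightarrow> ct f = 0"
  unfolding exp_ge_def ct_def by (metis in_keys_iff lookup_zero mult_zero_right not_one_le_zero)

subsection \<open>Renaming variables\<close>

text \<open>\<open>map_key\<close> composes on the inside, so exponents are pulled back along
  \<open>inv \<pi>\<close> for the variable \<open>v\<close> to become
  \<open>\<pi> v\<close>.\<close>

definition rename :: "(nat \<Rightarrow> nat) \<Rightarrow> 'a::comm_ring_1 laurent \<Rightarrow> 'a laurent" where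
  "rename \<pi> = pm_eval cst (\<lambda>k. Poly_Mapping.single (Poly_Mapping.map_key (inv \<pi>) k) 1)"

lemma pm_hom_rename:
  fixes \<pi> :: "nat \<Rightarrow> nat"
  assumes "bij \<pi>"
  shows "pm_hom (cst :: 'a \<Rightarrow> 'a::comm_ring_1 laurent)
    (\<lambda>k. Poly_Mapping.single (Poly_Mapping.map_key (inv \<pi>) k) 1)"
proof
  have inj: "inj (inv \<pi>)" using assms by (simp add: bij_imp_bij_inv bij_is_inj)
  fix k l :: "nat \<Rightarrow>\<^sub>0 int"
  show "(Poly_Mapping.single (Poly_Mapping.map_key (inv \<pi>) (k + l)) 1 :: 'a laurent) =
    Poly_Mapping.single (Poly_Mapping.map_key (inv \<pi>) k) 1 *
    Poly_Mapping.single (Poly_Mapping.map_key (inv \<pi>) l) 1"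
    by (simp add: map_key_plus[OF inj] mult_single)
  show "(Poly_Mapping.single (Poly_Mapping.map_key (inv \<pi>) 0) 1 :: 'a laurent) = 1"
    by (simp add: map_key_zero[OF inj])
qed (simp_all add: cst_hom)

lemmas rename_hom = pm_hom.eval_hom[OF pm_hom_rename, folded rename_def]

lemma rename_cst:
  assumes "bij \<pi>"
  shows "rename \<pi> (cst a) = cst a"
proof -
  have inj: "inj (inv \<pi>)" using assms by (simp add: bij_imp_bij_inv bij_is_inj)
  show ?thesis
    using pm_hom.eval_single[OF pm_hom_rename[OF assms], of 0 a]
    by (simp add: rename_def cst_def map_key_zero[OF inj])
qed

lemma rename_var:
  assumes "bij \<pi>"
  shows "rename \<pi> (Y v) = (Y (\<pi> v) :: 'a::comm_ring_1 laurent)"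
    and "rename \<pi> (U v) = (U (\<pi> v) :: 'a laurent)"
proof -
  have inj: "inj (inv \<pi>)" using assms by (simp add: bij_imp_bij_inv bij_is_inj)
  have "Poly_Mapping.map_key (inv \<pi>) (Poly_Mapping.single v e) = Poly_Mapping.single (\<pi> v) (e :: int)" for e
    using map_key_single[OF inj, of "\<pi> v" e] assms by (simp add: inv_f_f bij_is_inj)
  then show "rename \<pi> (Y v) = (Y (\<pi> v) :: 'a laurent)" "rename \<pi> (U v) = (U (\<pi> v) :: 'a laurent)"
    using pm_hom.eval_single[OF pm_hom_rename[OF assms], of _ "1 :: 'a"]
    by (simp_all add: rename_def Y_def U_def cst_hom)
qed

lemma ct_rename:
  assumes "bij \<pi>"
  shows "ct (rename \<pi> f) = ct f"
proof (induction f rule: poly_mapping_single_induct)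
  case (single k a)
  have inj: "inj (inv \<pi>)" using assms by (simp add: bij_imp_bij_inv bij_is_inj)
  have "Poly_Mapping.map_key (inv \<pi>) k = 0 \<longleftrightarrow> k = 0"
  proof
    assume "Poly_Mapping.map_key (inv \<pi>) k = 0"
    then have "lookup k (inv \<pi> (\<pi> v)) = 0" for v
      using map_key.rep_eq[of "inv \<pi>" k] inj by (metis comp_apply lookup_zero)
    then show "k = 0" using assms by (intro poly_mapping_eqI) (simp add: inv_f_f bij_is_inj)
  qed (simp add: map_key_zero[OF inj])
  then show ?case
    using pm_hom.eval_single[OF pm_hom_rename[OF assms], of k a] assms
    by (simp add: rename_def ct_cst_mult) (simp add: ct_def lookup_single when_def)
qed (simp add: rename_hom[OF assms])

section \<open>Laplace expansions of Vandermonde products\<close>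

fun vand :: "('i \<Rightarrow> 'r::comm_ring_1) \<Rightarrow> 'i list \<Rightarrow> 'r" where
  "vand z [] = 1"
| "vand z (v # vs) = (\<Prod>w\<leftarrow>vs. z w - z v) * vand z vs"

text \<open>\<open>lap z a b [v\<^sub>0, v\<^sub>1, \<dots>]\<close> is the sum of \<open>(-1)\<^bsup>i\<^esup> a v\<^sub>i \<Prod>\<^bsub>j \<noteq> i\<^esub> b v\<^sub>j\<close> times the Vandermonde
  product that omits \<open>v\<^sub>i\<close>.\<close>

fun lap :: "('i \<Rightarrow> 'r::comm_ring_1) \<Rightarrow> ('i \<Rightarrow> 'r) \<Rightarrow> ('i \<Rightarrow> 'r) \<Rightarrow> 'i list \<Rightarrow> 'r" where
  "lap z a b [] = 0"
| "lap z a b (v # vs) =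
     a v * (\<Prod>w\<leftarrow>vs. b w) * vand z vs - b v * lap z a (\<lambda>w. b w * (z w - z v)) vs"

lemma prod_list_map_mult:
  fixes f g :: "'i \<Rightarrow> 'r::comm_monoid_mult"
  shows "(\<Prod>v\<leftarrow>vs. f v * g v) = (\<Prod>v\<leftarrow>vs. f v) * (\<Prod>v\<leftarrow>vs. g v)"
  by (induction vs) (simp_all add: ac_simps)

text \<open>Each term of the expansion takes exactly one factor, \<open>a\<close> or
  \<open>b\<close>, at every entry of the list, so a product over the list is absorbed entry by
  entry.\<close>

lemma lap_mult:
  "(\<Prod>v\<leftarrow>vs. c v) * lap z a b vs = lap z (\<lambda>v. a v * c v) (\<lambda>v. b v * c v) vs"
proof (induction vs arbitrary: b)
  case (Cons v vs)
  have eq: "(\<lambda>w. b w * (z w - z v) * c w) = (\<lambda>w. b w * c w * (z w - z v))"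
    by (simp add: fun_eq_iff ac_simps)
  show ?case
    using Cons.IH[of "\<lambda>w. b w * (z w - z v)", unfolded eq, symmetric]
    by (simp add: prod_list_map_mult algebra_simps)
qed simp

lemma lap_diff: "lap z a b vs - lap z a' b vs = lap z (\<lambda>v. a v - a' v) b vs"
proof (induction vs arbitrary: b)
  case (Cons v vs)
  show ?case by (simp add: Cons.IH[symmetric] algebra_simps)
qed simp

lemma lap_scale: "s * lap z a b vs = lap z (\<lambda>v. s * a v) b vs"
proof (induction vs arbitrary: b)
  case (Cons v vs)
  show ?case by (simp add: Cons.IH[symmetric] algebra_simps)
qed simp

lemma vand_shift: "vand (\<lambda>v. z v + s) vs = vand z vs"
  by (induction vs) simp_all

lemma lap_shift: "lap (\<lambda>v. z v + s) a b vs = lap z a b vs"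
  by (induction vs arbitrary: b) (simp_all add: vand_shift)

text \<open>The induction step needs the difference between the expansions of the list with first
  entry removed at \<open>z\<close> and at the shifted points \<open>z - z v\<close>.\<close>

lemma vand_eq_lap: "vs \<noteq> [] \<Longrightarrow> lap z (\<lambda>_. 1) z vs = vand z vs"
proof (induction vs arbitrary: z)
  case (Cons v vs)
  show ?case
  proof (cases "vs = []")
    case False
    let ?y = "\<lambda>w. z w - z v"
    have "(\<Prod>w\<leftarrow>vs. ?y w) * vand z vs = lap z (\<lambda>w. ?y w) (\<lambda>w. z w * ?y w) vs"
      using Cons.IH[OF False, of z] lap_mult[of ?y vs z "\<lambda>_. 1" z] by simp
    \<comment> \<open>The induction hypothesis is used at the points shifted by
      \<open>- z v\<close>, which leaves the Vandermonde products alone; multiplying by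
      \<open>z\<close> then gives the same second weight as in the first expansion.\<close>
    moreover have "(\<Prod>w\<leftarrow>vs. z w) * vand z vs = lap z z (\<lambda>w. z w * ?y w) vs"
      using Cons.IH[OF False, of "\<lambda>w. z w + - z v"] lap_mult[of z vs z "\<lambda>_. 1" ?y]
      by (simp only: vand_shift lap_shift) (simp add: mult.commute)
    ultimately have "(\<Prod>w\<leftarrow>vs. ?y w) * vand z vs - (\<Prod>w\<leftarrow>vs. z w) * vand z vs
        = lap z (\<lambda>w. - z v * 1) (\<lambda>w. z w * ?y w) vs"
      by (simp add: lap_diff)
    also have "\<dots> = - z v * lap z (\<lambda>w. 1) (\<lambda>w. z w * ?y w) vs"
      by (rule lap_scale[symmetric])
    finally show ?thesis by (simp add: algebra_simps)
  qed simp
qed simp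

lemma free_vand: "(\<And>w. w \<in> set vs \<Longrightarrow> free v (z w)) \<Longrightarrow> free v (vand z vs)"
  by (induction vs) (auto intro!: free_intros)

text \<open>The term of the expansion that omits \<open>v\<close> depends on the variable \<open>v\<close> only through \<open>a v\<close>.\<close>

lemma ct_lap_eq_0:
  assumes "distinct vs"
    and "\<And>v. v \<in> set vs \<Longrightarrow> exp_ge 1 (\<epsilon> v) v (F * a v)"
    and "\<And>v w. v \<in> set vs \<Longrightarrow> w \<in> set vs \<Longrightarrow> v \<noteq> w \<Longrightarrow> free v (b w)"
    and "\<And>v w. v \<in> set vs \<Longrightarrow> w \<in> set vs \<Longrightarrow> v \<noteq> w \<Longrightarrow> free v (z w)"
  shows "ct (F * lap z a b vs) = 0"
  using assms
proof (induction vs arbitrary: F b)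
  case (Cons v vs)
  have fb: "free v (b w)" "free w (b v)" and fz: "free v (z w)" "free w (z v)" if "w \<in> set vs" for w
    using Cons.prems(3,4)[of v w] Cons.prems(3,4)[of w v] that Cons.prems(1) by auto
  have "free v ((\<Prod>w\<leftarrow>vs. b w) * vand z vs)"
    by (intro free_mult free_prod_list free_vand fb fz)
  then have "exp_ge 1 (\<epsilon> v) v ((F * a v) * ((\<Prod>w\<leftarrow>vs. b w) * vand z vs))"
    using Cons.prems(2)[of v] by (auto intro: exp_ge_1_mult[OF _ exp_ge_0_of_free])
  then have "ct ((F * a v) * ((\<Prod>w\<leftarrow>vs. b w) * vand z vs)) = 0"
    by (rule ct_exp_ge_1)
  moreover have "ct ((F * b v) * lap z a (\<lambda>w. b w * (z w - z v)) vs) = 0"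
  proof (rule Cons.IH)
    fix w assume w: "w \<in> set vs"
    have "exp_ge 1 (\<epsilon> w) w ((F * a w) * b v)"
      using Cons.prems(2)[of w] w fb[OF w] by (auto intro: exp_ge_1_mult[OF _ exp_ge_0_of_free])
    then show "exp_ge 1 (\<epsilon> w) w (F * b v * a w)"
      by (simp add: ac_simps)
    fix x assume x: "x \<in> set vs" "w \<noteq> x"
    show "free w (b x * (z x - z v))"
      using Cons.prems(3,4)[of w x] w x fz[OF w] by (intro free_mult free_diff) simp_all
    show "free w (z x)"
      using Cons.prems(4)[of w x] w x by simp
  qed (use Cons.prems in simp)
  ultimately show ?case
    by (simp add: algebra_simps)
qed simp

section \<open>The kernel\<close>

lemma sorted_wrt_allI: "(\<And>v w. v \<in> set vs \<Longrightarrow> w \<in> set vs \<Longrightarrow> P v w) \<Longrightarrow> sorted_wrt P vs"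
  by (induction vs) auto

definition K :: "nat \<Rightarrow> nat \<Rightarrow> 'a::comm_ring_1 laurent" where
  "K v w = (1 + Y w + Y v * Y w) * (U w - U v)"

fun G :: "nat list \<Rightarrow> 'a::comm_ring_1 laurent" where
  "G [] = 1"
| "G (v # vs) = (\<Prod>w\<leftarrow>vs. K v w) * G vs"

lemma G_insert: "G (as @ x # bs) = G (as @ bs) * (\<Prod>a\<leftarrow>as. K a x) * (\<Prod>b\<leftarrow>bs. K x b)"
  by (induction as) (simp_all add: ac_simps)

lemma free_K: "v \<noteq> x \<Longrightarrow> w \<noteq> x \<Longrightarrow> free x (K v w)"
  unfolding K_def by (intro free_intros) auto

lemma free_G: "x \<notin> set vs \<Longrightarrow> free x (G vs)"
  by (induction vs) (auto intro!: free_intros free_K)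

text \<open>The variables satisfying \<open>\<tau>\<close> are those on the left. The points \<open>pt v\<close> are the \<open>\<eta>\<close> of the
  introduction, and \<open>num v / den v\<close> is \<open>1/\<eta>\<close>.\<close>

context
  fixes \<tau> :: "nat \<Rightarrow> bool"
begin

definition ori :: "nat \<Rightarrow> int" where
  "ori v = (if \<tau> v then -1 else 1)"

definition pt :: "nat \<Rightarrow> 'a::comm_ring_1 laurent" where
  "pt v = (if \<tau> v then - (1 + Y v) else U v)"

definition den :: "nat \<Rightarrow> 'a::comm_ring_1 laurent" where
  "den v = (if \<tau> v then 1 + U v else 1)"

definition num :: "nat \<Rightarrow> 'a::comm_ring_1 laurent" where
  "num v = (if \<tau> v then - U v else Y v)"

text \<open>The cofactor of \<open>pt w - pt v\<close> in \<open>K v w\<close>. Left variables come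
  first in the lists, so for \<open>v\<close> on the right \<open>w\<close> is on the right as well.
  All cases contain only \<open>U\<close> of left and \<open>Y\<close> of right variables.\<close>

definition Hc :: "nat \<Rightarrow> nat \<Rightarrow> 'a::comm_ring_1 laurent" where
  "Hc v w = (if \<not> \<tau> v then 1 + Y w + Y v * Y w
     else if \<tau> w then 1 + U v + U v * U w else 1 - Y w * U v)"

fun HH :: "nat list \<Rightarrow> 'a::comm_ring_1 laurent" where
  "HH [] = 1"
| "HH (v # vs) = (\<Prod>w\<leftarrow>vs. Hc v w) * HH vs"

lemma pt_mult_num: "pt v * num v = den v"
  by (simp add: pt_def num_def den_def algebra_simps)

text \<open>For the first identity pull \<open>y * y'\<close> out of the first factor and
  \<open>u * u'\<close> out of the second; for the second one pull out \<open>y'\<close> and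
  \<open>u'\<close>.\<close>

lemma K_factor_aux:
  fixes y u y' u' :: "'r::comm_ring_1"
  assumes 1: "y * u = 1" and 2: "y' * u' = 1"
  shows "(1 + y' + y * y') * (u' - u) = (y - y') * (1 + u + u * u')"
    and "(1 + y' + y * y') * (u' - u) = (u' + 1 + y) * (1 - y' * u)"
proof -
  have a: "y * y' * u' = y" "y * y' * u = y'" using 1 2 by (metis mult.assoc mult.commute mult.right_neutral)+
  have b: "y * (u * u') = u'" "y' * (u * u') = u"
    using 1 2 by (metis mult.assoc mult.commute mult.right_neutral)+
  show "(1 + y' + y * y') * (u' - u) = (y - y') * (1 + u + u * u')"
    using 1 2 a b by (simp add: algebra_simps)
  have c: "u' * (y' * u) = u" "y * (y' * u) = y'"
    using 1 2 by (metis mult.assoc mult.commute mult.right_neutral)+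
  show "(1 + y' + y * y') * (u' - u) = (u' + 1 + y) * (1 - y' * u)"
    using 1 2 a c by (simp add: algebra_simps)
qed

lemma K_factor:
  assumes "\<tau> w \<longrightarrow> \<tau> v"
  shows "K v w = (pt w - pt v) * Hc v w"
  using assms K_factor_aux[OF Y_U(1)[of v] Y_U(1)[of w]]
  by (auto simp: K_def pt_def Hc_def mult.commute algebra_simps)

lemma G_factor:
  assumes "sorted_wrt (\<lambda>v w. \<tau> w \<longrightarrow> \<tau> v) vs"
  shows "G vs = vand pt vs * HH vs"
  using assms
proof (induction vs)
  case (Cons v vs)
  have "(\<Prod>w\<leftarrow>vs. K v w) = (\<Prod>w\<leftarrow>vs. (pt w - pt v) * Hc v w :: 'a laurent)"
    using Cons.prems by (intro arg_cong[where f = prod_list] map_cong) (auto simp: K_factor)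
  with Cons show ?case by (simp add: prod_list_map_mult ac_simps)
qed simp

lemma exp_ge_Y_ori: "\<not> \<tau> v \<Longrightarrow> exp_ge 0 (ori w) w (Y v)"
  by (cases "v = w") (auto simp: ori_def intro: exp_ge_intros)

lemma exp_ge_U_ori: "\<tau> v \<Longrightarrow> exp_ge 0 (ori w) w (U v)"
  by (cases "v = w") (auto simp: ori_def intro: exp_ge_intros)

lemma exp_ge_Hc:
  assumes "\<tau> w \<longrightarrow> \<tau> v"
  shows "exp_ge 0 (ori x) x (Hc v w)"
  unfolding Hc_def using assms by (auto intro!: exp_ge_intros(1-6) exp_ge_Y_ori exp_ge_U_ori)

lemma exp_ge_HH:
  "sorted_wrt (\<lambda>v w. \<tau> w \<longrightarrow> \<tau> v) vs \<Longrightarrow> exp_ge 0 (ori x) x (HH vs)"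
  by (induction vs) (auto intro!: exp_ge_mult0 exp_ge_1 exp_ge_prod_list exp_ge_Hc)

lemma exp_ge_num: "exp_ge 1 (ori v) v (num v)"
  by (auto simp: ori_def num_def exp_ge_Y exp_ge_U intro: exp_ge_uminus)

lemma free_pt: "v \<noteq> w \<Longrightarrow> free v (pt w)"
  unfolding pt_def by (auto intro!: free_intros)

lemma free_den: "v \<noteq> w \<Longrightarrow> free v (den w)"
  unfolding den_def by (auto intro!: free_intros)

text \<open>In the omitted variable, \<open>F\<close>, \<open>HH\<close> and \<open>s\<close> have
  no exponents on the wrong side, while those of \<open>num\<close> lie strictly on its own side.
  The parameter \<open>s\<close> may involve variables outside the list, which is what elimination
  needs.\<close>

lemma ct_G_lap_eq_0:
  assumes vs: "distinct vs" "sorted_wrt (\<lambda>v w. \<tau> w \<longrightarrow> \<tau> v) vs"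
    and F: "\<And>v. v \<in> set vs \<Longrightarrow> exp_ge 0 (ori v) v F"
    and s: "\<And>v. v \<in> set vs \<Longrightarrow> free v s"
    and b: "\<And>v w. v \<in> set vs \<Longrightarrow> w \<in> set vs \<Longrightarrow> v \<noteq> w \<Longrightarrow> free v (b w)"
  shows "ct (F * HH vs * lap pt (\<lambda>v. s * num v) b vs) = 0"
proof (rule ct_lap_eq_0[where \<epsilon> = ori])
  fix v assume "v \<in> set vs"
  then show "exp_ge 1 (ori v) v (F * HH vs * (s * num v))"
    using F s vs(2)
    by (intro exp_ge_mult_1[OF exp_ge_mult0 exp_ge_mult_1] exp_ge_HH exp_ge_num exp_ge_0_of_free[of v s])
qed (use vs b in \<open>auto intro: free_pt\<close>)

text \<open>Multiplied by all \<open>num\<close>, the omitted variable keeps \<open>num\<close>,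
  whereas every other one gets \<open>pt * num = den\<close>, which is free of the omitted
  variable.\<close>

lemma ct_G_num:
  assumes "vs \<noteq> []" "distinct vs" "sorted_wrt (\<lambda>v w. \<tau> w \<longrightarrow> \<tau> v) vs"
    and "\<And>v. v \<in> set vs \<Longrightarrow> exp_ge 0 (ori v) v F"
  shows "ct (F * G vs * (\<Prod>v\<leftarrow>vs. num v)) = 0"
proof -
  have "(\<Prod>v\<leftarrow>vs. num v) * vand pt vs = (lap pt (\<lambda>v. 1 * num v) den vs :: 'a laurent)"
    using lap_mult[of "num :: nat \<Rightarrow> 'a laurent" vs pt "\<lambda>_. 1" pt] vand_eq_lap[OF assms(1), of "pt :: nat \<Rightarrow> 'a laurent"]
    by (simp add: pt_mult_num)
  then have "F * G vs * (\<Prod>v\<leftarrow>vs. num v) = F * HH vs * lap pt (\<lambda>v. 1 * num v) den vs"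
    by (simp add: G_factor[OF assms(3)] ac_simps)
  also have "ct \<dots> = 0"
    using assms by (intro ct_G_lap_eq_0) (auto intro: free_1 free_den)
  finally show ?thesis .
qed

text \<open>The same Vandermonde product is expanded at the points \<open>pt\<close> for one side
  and at \<open>pt + s\<close> for the other. Because of \<open>pt * num = den\<close> both
  expansions get the second weight \<open>den * (pt + s)\<close>, so they can be subtracted, and
  only \<open>s * num\<close> remains for the omitted variable.\<close>

lemma ct_G_symmetric:
  assumes vs: "distinct vs" "sorted_wrt (\<lambda>v w. \<tau> w \<longrightarrow> \<tau> v) vs"
    and F: "\<And>v. v \<in> set vs \<Longrightarrow> exp_ge 0 (ori v) v F"
    and s: "\<And>v. v \<in> set vs \<Longrightarrow> free v s"
  shows "ct (F * G vs * (\<Prod>v\<leftarrow>vs. den v + s * num v)) = ct (F * G vs * (\<Prod>v\<leftarrow>vs. den v))"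
proof (cases "vs = []")
  case False
  let ?b = "\<lambda>v. den v * (pt v + s)"
  have b: "pt v * (den v + s * num v) = ?b v" for v
    by (simp add: algebra_simps flip: pt_mult_num)
  have 1: "(\<Prod>v\<leftarrow>vs. den v + s * num v) * vand pt vs = lap pt (\<lambda>v. den v + s * num v) ?b vs"
    using lap_mult[of "\<lambda>v. den v + s * num v" vs pt "\<lambda>_. 1" pt] vand_eq_lap[OF False, of "pt :: nat \<Rightarrow> 'a laurent"]
    by (simp add: b)
  have 2: "(\<Prod>v\<leftarrow>vs. den v) * vand pt vs = lap pt den ?b vs"
    using lap_mult[of "den :: nat \<Rightarrow> 'a laurent" vs pt "\<lambda>_. 1" "\<lambda>v. pt v + s"] vand_eq_lap[OF False, of "\<lambda>v. pt v + s"]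
    by (simp add: vand_shift lap_shift mult.commute)
  have "F * G vs * (\<Prod>v\<leftarrow>vs. den v + s * num v) - F * G vs * (\<Prod>v\<leftarrow>vs. den v)
      = F * HH vs * ((\<Prod>v\<leftarrow>vs. den v + s * num v) * vand pt vs - (\<Prod>v\<leftarrow>vs. den v) * vand pt vs)"
    by (simp add: G_factor[OF vs(2)] algebra_simps)
  also have "\<dots> = F * HH vs * lap pt (\<lambda>v. s * num v) ?b vs"
    by (simp add: 1 2 lap_diff)
  also have "ct \<dots> = 0"
    using assms by (intro ct_G_lap_eq_0) (auto intro!: free_intros free_pt free_den)
  finally show ?thesis by simp
qed simp

end

text \<open>A one-parameter family of relations: the right-hand side does not contain
  \<open>s\<close>. On the left, \<open>den + s * num\<close> is
  \<open>1 + U - s * U\<close>.\<close>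

lemma ct_G_shift:
  assumes dist: "distinct (L @ R)"
    and FL: "\<And>v. v \<in> set L \<Longrightarrow> exp_ge 0 (-1) v F" and FR: "\<And>v. v \<in> set R \<Longrightarrow> exp_ge 0 1 v F"
    and s: "\<And>v. v \<in> set (L @ R) \<Longrightarrow> free v s"
  shows "ct (F * G (L @ R) * ((\<Prod>v\<leftarrow>L. 1 + (1 - s) * U v) * (\<Prod>v\<leftarrow>R. 1 + s * Y v)))
       = ct (F * G (L @ R) * (\<Prod>v\<leftarrow>L. 1 + U v))"
proof -
  let ?t = "\<lambda>v. v \<in> set L"
  have sw: "sorted_wrt (\<lambda>v w. ?t w \<longrightarrow> ?t v) (L @ R)"
    using dist by (auto simp: sorted_wrt_append intro!: sorted_wrt_allI)
  have L: "(\<Prod>v\<leftarrow>L. den ?t v + s * num ?t v) = (\<Prod>v\<leftarrow>L. 1 + (1 - s) * U v)"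
    "(\<Prod>v\<leftarrow>L. den ?t v) = (\<Prod>v\<leftarrow>L. 1 + U v)"
    by (intro arg_cong[where f = prod_list] map_cong; simp add: den_def num_def algebra_simps)+
  have R: "(\<Prod>v\<leftarrow>R. den ?t v + s * num ?t v) = (\<Prod>v\<leftarrow>R. 1 + s * Y v)"
    "(\<Prod>v\<leftarrow>R. den ?t v) = (\<Prod>v\<leftarrow>R. 1)"
    using dist by (intro arg_cong[where f = prod_list] map_cong; auto simp: den_def num_def)+
  have F: "exp_ge 0 (ori ?t v) v F" if "v \<in> set (L @ R)" for v
    using that FL FR by (auto simp: ori_def)
  show ?thesis
    using ct_G_symmetric[OF dist sw F s] by (simp add: L R map_replicate_const)
qed

lemma ct_G_vanish:
  assumes dist: "distinct (L @ R)" and ne: "L @ R \<noteq> []"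
    and FL: "\<And>v. v \<in> set L \<Longrightarrow> exp_ge 0 (-1) v F" and FR: "\<And>v. v \<in> set R \<Longrightarrow> exp_ge 0 1 v F"
  shows "ct (F * G (L @ R) * ((\<Prod>v\<leftarrow>L. U v) * (\<Prod>v\<leftarrow>R. Y v))) = 0"
proof -
  let ?t = "\<lambda>v. v \<in> set L"
  \<comment> \<open>On the left \<open>num\<close> is \<open>- U\<close>; its signs are moved into
    \<open>F\<close>, where they are harmless.\<close>
  let ?F = "F * (\<Prod>v\<leftarrow>L. - 1)"
  have sw: "sorted_wrt (\<lambda>v w. ?t w \<longrightarrow> ?t v) (L @ R)"
    using dist by (auto simp: sorted_wrt_append intro!: sorted_wrt_allI)
  have L: "(\<Prod>v\<leftarrow>L. num ?t v) = (\<Prod>v\<leftarrow>L. - 1 * U v)"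
    by (intro arg_cong[where f = prod_list] map_cong) (simp_all add: num_def)
  have R: "(\<Prod>v\<leftarrow>R. num ?t v) = (\<Prod>v\<leftarrow>R. Y v)"
    using dist by (intro arg_cong[where f = prod_list] map_cong) (auto simp: num_def)
  have sq: "(\<Prod>v\<leftarrow>L. - 1) * (\<Prod>v\<leftarrow>L. - 1) = (1 :: 'a laurent)"
    by (induction L) simp_all
  have F: "exp_ge 0 (ori ?t v) v ?F" if "v \<in> set (L @ R)" for v
    using that FL FR by (auto simp: ori_def intro!: exp_ge_mult0 exp_ge_prod_list exp_ge_uminus exp_ge_1)
  have "F * G (L @ R) * ((\<Prod>v\<leftarrow>L. U v) * (\<Prod>v\<leftarrow>R. Y v)) =
     F * G (L @ R) * ((\<Prod>v\<leftarrow>L. U v) * (\<Prod>v\<leftarrow>R. Y v)) * ((\<Prod>v\<leftarrow>L. - 1) * (\<Prod>v\<leftarrow>L. - 1))"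
    unfolding sq by simp
  also have "\<dots> = ?F * G (L @ R) * (\<Prod>v\<leftarrow>L @ R. num ?t v)"
    unfolding map_append prod_list.append L R prod_list_map_mult by (simp only: ac_simps)
  also have "ct \<dots> = 0"
    using ct_G_num[OF ne dist sw F] .
  finally show ?thesis .
qed

section \<open>The functional on lists of test polynomials\<close>

definition ev :: "'a::comm_ring_1 poly \<Rightarrow> 'a laurent \<Rightarrow> 'a laurent" where
  "ev p x = poly (map_poly cst p) x"

lemma ev_pCons: "ev (pCons a p) x = cst a + x * ev p x"
  by (simp add: ev_def map_poly_pCons cst_hom)

lemma ev_0: "ev 0 x = 0"
  by (simp add: ev_def)

lemma ev_const: "ev [:a:] x = cst a"
  by (simp add: ev_pCons ev_0)

lemma ev_1: "ev 1 x = 1"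
  by (simp add: one_pCons ev_const cst_hom)

lemma ev_add: "ev (p + q) x = ev p x + ev q x"
  by (induction p q rule: poly_induct2) (simp_all add: ev_pCons ev_0 cst_hom algebra_simps)

lemma ev_smult: "ev (smult c p) x = cst c * ev p x"
  by (induction p) (simp_all add: ev_pCons ev_0 cst_hom algebra_simps)

lemma ev_mult: "ev (p * q) x = ev p x * ev q x"
  by (induction p) (simp_all add: ev_pCons ev_0 ev_add ev_smult cst_hom algebra_simps)

lemma ev_power: "ev (p ^ k) x = ev p x ^ k"
  by (induction k) (simp_all add: ev_1 ev_mult)

lemma exp_ge_ev: "exp_ge 0 \<epsilon> v x \<Longrightarrow> exp_ge 0 \<epsilon> v (ev p x)"
  by (induction p) (auto simp: ev_0 ev_pCons intro!: exp_ge_intros exp_ge_0_of_free[OF free_0])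

lemma free_ev: "free v x \<Longrightarrow> free v (ev p x)"
  by (induction p) (auto simp: ev_0 ev_pCons intro!: free_intros)

lemma rename_ev:
  assumes "bij \<pi>"
  shows "rename \<pi> (ev p x) = ev p (rename \<pi> x)"
  by (induction p) (simp_all add: ev_pCons ev_0 rename_hom[OF assms] rename_cst[OF assms]
      rename_cst[OF assms, of 0, unfolded cst_hom])

definition tst :: "(nat \<Rightarrow> 'a::comm_ring_1 laurent) \<Rightarrow> nat list \<Rightarrow> 'a poly list \<Rightarrow> 'a laurent" where
  "tst f vs hs = prod_list (map2 (\<lambda>v h. ev h (f v)) vs hs)"

lemma tst_Nil [simp]: "tst f [] [] = 1"
  by (simp add: tst_def)

lemma tst_Cons [simp]: "tst f (v # vs) (h # hs) = ev h (f v) * tst f vs hs"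
  by (simp add: tst_def)

lemma tst_append:
  "length vs = length hs \<Longrightarrow> tst f (vs @ vs') (hs @ hs') = tst f vs hs * tst f vs' hs'"
  by (simp add: tst_def)

lemma tst_map_mult:
  "length vs = length hs \<Longrightarrow> tst f vs (map ((*) p) hs) = (\<Prod>v\<leftarrow>vs. ev p (f v)) * tst f vs hs"
  by (induction vs hs rule: list_induct2) (simp_all add: ev_mult ac_simps)

lemma tst_map_pCons:
  "length vs = length hs \<Longrightarrow> tst f vs (map (pCons 0) hs) = (\<Prod>v\<leftarrow>vs. f v) * tst f vs hs"
  by (induction vs hs rule: list_induct2) (simp_all add: ev_pCons cst_hom ac_simps)

lemma exp_ge_tst:
  assumes "length vs = length hs" "\<And>w. w \<in> set vs \<Longrightarrow> exp_ge 0 \<epsilon> v (f w)"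
  shows "exp_ge 0 \<epsilon> v (tst f vs hs)"
  using assms by (induction vs hs rule: list_induct2) (auto intro!: exp_ge_mult0 exp_ge_ev exp_ge_1)

lemma free_tst:
  assumes "length vs = length hs" "\<And>w. w \<in> set vs \<Longrightarrow> free v (f w)"
  shows "free v (tst f vs hs)"
  using assms by (induction vs hs rule: list_induct2) (auto intro!: free_mult free_ev free_1)

lemma rename_tst:
  assumes "bij \<pi>" "length vs = length hs" "\<And>v. rename \<pi> (f v) = f (\<pi> v)"
  shows "rename \<pi> (tst f vs hs) = tst f (map \<pi> vs) hs"
  using assms(2) by (induction vs hs rule: list_induct2)
    (simp_all add: rename_hom[OF assms(1)] rename_ev[OF assms(1)] assms(3))

lemma exp_ge_Y0: "exp_ge 0 1 w (Y v)"
  by (simp add: exp_ge_def Y_def lookup_single when_def)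

lemma exp_ge_U0: "exp_ge 0 (-1) w (U v)"
  by (simp add: exp_ge_def U_def lookup_single when_def)

lemma exp_ge_tst_Y: "length vs = length hs \<Longrightarrow> exp_ge 0 1 v (tst Y vs hs)"
  by (rule exp_ge_tst[OF _ exp_ge_Y0])

lemma exp_ge_tst_U: "length vs = length hs \<Longrightarrow> exp_ge 0 (-1) v (tst U vs hs)"
  by (rule exp_ge_tst[OF _ exp_ge_U0])

lemma rename_G:
  assumes "bij \<pi>"
  shows "rename \<pi> (G vs) = G (map \<pi> vs)"
  by (induction vs) (simp_all add: rename_hom[OF assms] rename_var[OF assms] K_def comp_def)

definition Psi :: "nat list \<Rightarrow> nat list \<Rightarrow> 'a::comm_ring_1 poly list \<Rightarrow> 'a poly list \<Rightarrow> 'a" where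
  "Psi L R hL hR = ct (G (L @ R) * (tst U L hL * tst Y R hR))"

definition Phi :: "'a::comm_ring_1 poly list \<Rightarrow> 'a poly list \<Rightarrow> 'a" where
  "Phi hL hR = Psi [0..<length hL] [length hL..<length hL + length hR] hL hR"

lemma bij_map_list:
  fixes vs vs' :: "nat list"
  assumes "length vs = length vs'" "distinct vs" "distinct vs'"
  shows "\<exists>\<pi>. bij \<pi> \<and> map \<pi> vs = vs'"
  using assms
proof (induction vs vs' rule: list_induct2)
  case Nil
  have "bij (id :: nat \<Rightarrow> nat)" by (rule bij_id)
  then show ?case by (metis list.simps(8))
next
  case (Cons v vs v' vs')
  then obtain \<pi> where \<pi>: "bij \<pi>" "map \<pi> vs = vs'" by auto
  \<comment> \<open>\<open>\<pi>\<close> need not map \<open>v\<close> to \<open>v'\<close>. The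
    transposition of \<open>\<pi> v\<close> and \<open>v'\<close> repairs this and fixes the images
    of the other entries.\<close>
  define \<sigma> where "\<sigma> = id(\<pi> v := v', v' := \<pi> v)"
  have "bij \<sigma>"
    by (rule involuntory_imp_bij) (simp add: \<sigma>_def)
  then have bij: "bij (\<sigma> \<circ> \<pi>)"
    by (rule bij_comp[OF \<pi>(1)])
  have "\<sigma> (\<pi> w) = \<pi> w" if "w \<in> set vs" for w
  proof -
    have "\<pi> w \<noteq> \<pi> v"
      using that Cons.prems(1) \<pi>(1) by (auto dest: bij_is_inj injD)
    moreover have "\<pi> w \<noteq> v'"
      using that Cons.prems(2) \<pi>(2) by auto
    ultimately show ?thesis by (simp add: \<sigma>_def)
  qed
  then have "map (\<sigma> \<circ> \<pi>) vs = vs'"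
    unfolding \<pi>(2)[symmetric] by (intro map_cong) simp_all
  moreover have "(\<sigma> \<circ> \<pi>) v = v'"
    by (simp add: \<sigma>_def)
  ultimately have "map (\<sigma> \<circ> \<pi>) (v # vs) = v' # vs'"
    by (simp only: list.map)
  with bij show ?case by (intro exI[of _ "\<sigma> \<circ> \<pi>"] conjI)
qed

text \<open>The constant term does not depend on the names of the variables. Hence each proof below
  may choose variables grouped as it needs them.\<close>

lemma Phi_eq_Psi:
  assumes "distinct (L @ R)" "length L = length hL" "length R = length hR"
  shows "Phi hL hR = Psi L R hL hR"
proof -
  let ?L = "[0..<length hL]" and ?R = "[length hL..<length hL + length hR]"
  obtain \<pi> where \<pi>: "bij \<pi>" "map \<pi> (?L @ ?R) = L @ R"
    using bij_map_list[of "?L @ ?R" "L @ R"] assms by auto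
  then have LR: "map \<pi> ?L = L" "map \<pi> ?R = R"
    using assms by (simp_all add: append_eq_append_conv)
  have "ct (G (?L @ ?R) * (tst U ?L hL * tst Y ?R hR))
      = ct (rename \<pi> (G (?L @ ?R) * (tst U ?L hL * tst Y ?R hR)))"
    by (simp only: ct_rename[OF \<pi>(1)])
  also have "\<dots> = ct (G (L @ R) * (tst U L hL * tst Y R hR))"
    by (simp add: rename_hom[OF \<pi>(1)] rename_G[OF \<pi>(1)] rename_tst[OF \<pi>(1)] rename_var[OF \<pi>(1)] LR
        del: upt_conv_Cons)
  finally show ?thesis by (simp add: Phi_def Psi_def)
qed

lemma ex_distinct_vars:
  fixes a b c :: nat
  shows "\<exists>A B (r :: nat) C. distinct (A @ B @ r # C) \<and> length A = a \<and> length B = b \<and> length C = c"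
  by (intro exI[of _ "[0..<a]"] exI[of _ "[a..<a + b]"] exI[of _ "a + b"]
      exI[of _ "[a + b + 1..<a + b + c + 1]"]) auto

lemma ex_distinct_vars2:
  fixes a b c :: nat
  shows "\<exists>A B (r :: nat) s C. distinct (A @ B @ r # s # C) \<and> length A = a \<and> length B = b \<and> length C = c"
  by (intro exI[of _ "[0..<a]"] exI[of _ "[a..<a + b]"] exI[of _ "a + b"] exI[of _ "a + b + 1"]
      exI[of _ "[a + b + 2..<a + b + c + 2]"]) auto

section \<open>Boundary rule, multilinearity and translation\<close>

lemma Phi_Nil: "Phi [] [] = 1"
  by (simp add: Phi_def Psi_def)

text \<open>A constant test contains neither \<open>U\<close> nor \<open>Y\<close>, and the kernel
  sees only the concatenation \<open>L @ R\<close>: such a column may be counted on either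
  side.\<close>

lemma Phi_boundary: "Phi (hL @ [[:c:]]) hR = Phi hL ([:c:] # hR)"
proof -
  obtain L M v and R :: "nat list" where M: "distinct (L @ M @ v # R)" "length L = length hL" "length M = 0"
    "length R = length hR"
    using ex_distinct_vars[of "length hL" 0 "length hR"] by blast
  then have v: "distinct (L @ v # R)" "length L = length hL" "length R = length hR"
    by simp_all
  have "Phi (hL @ [[:c:]]) hR = Psi (L @ [v]) R (hL @ [[:c:]]) hR"
    using v by (intro Phi_eq_Psi) auto
  moreover have "Phi hL ([:c:] # hR) = Psi L (v # R) hL ([:c:] # hR)"
    using v by (intro Phi_eq_Psi) auto
  ultimately show ?thesis
    using v by (simp add: Psi_def tst_append ev_const ac_simps)
qed

lemma Phi_add_right: "Phi hL (A @ (p + q) # B) = Phi hL (A @ p # B) + Phi hL (A @ q # B)"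
proof -
  obtain L R1 r and R2 :: "nat list" where v: "distinct (L @ R1 @ r # R2)" "length L = length hL"
    "length R1 = length A" "length R2 = length B"
    using ex_distinct_vars[of "length hL" "length A" "length B"] by blast
  have "Phi hL (A @ h # B) = Psi L (R1 @ r # R2) hL (A @ h # B)" for h
    using v by (intro Phi_eq_Psi) auto
  then show ?thesis
    by (simp add: Psi_def v tst_append ev_add algebra_simps)
qed

lemma Phi_smult_right: "Phi hL (A @ smult c p # B) = c * Phi hL (A @ p # B)"
proof -
  obtain L R1 r and R2 :: "nat list" where v: "distinct (L @ R1 @ r # R2)" "length L = length hL"
    "length R1 = length A" "length R2 = length B"
    using ex_distinct_vars[of "length hL" "length A" "length B"] by blast
  have "Phi hL (A @ h # B) = Psi L (R1 @ r # R2) hL (A @ h # B)" for h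
    using v by (intro Phi_eq_Psi) auto
  then show ?thesis
    by (simp add: Psi_def v tst_append ev_smult ac_simps flip: ct_cst_mult)
qed


lemma Phi_add_left: "Phi (A @ (p + q) # B) hR = Phi (A @ p # B) hR + Phi (A @ q # B) hR"
proof -
  obtain L1 L2 r and R :: "nat list" where v: "distinct (L1 @ L2 @ r # R)" "length L1 = length A"
    "length L2 = length B" "length R = length hR"
    using ex_distinct_vars[of "length A" "length B" "length hR"] by blast
  have "Phi (A @ h # B) hR = Psi (L1 @ r # L2) R (A @ h # B) hR" for h
    using v by (intro Phi_eq_Psi) auto
  then show ?thesis
    by (simp add: Psi_def v tst_append ev_add algebra_simps)
qed

lemma Phi_smult_left: "Phi (A @ smult c p # B) hR = c * Phi (A @ p # B) hR"
proof -
  obtain L1 L2 r and R :: "nat list" where v: "distinct (L1 @ L2 @ r # R)" "length L1 = length A"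
    "length L2 = length B" "length R = length hR"
    using ex_distinct_vars[of "length A" "length B" "length hR"] by blast
  have "Phi (A @ h # B) hR = Psi (L1 @ r # L2) R (A @ h # B) hR" for h
    using v by (intro Phi_eq_Psi) auto
  then show ?thesis
    by (simp add: Psi_def v tst_append ev_smult ac_simps flip: ct_cst_mult)
qed

abbreviation zz :: "'a::comm_ring_1 poly" where
  "zz \<equiv> [:1, 1:]"

lemma ev_zz: "ev zz x = 1 + x"
  by (simp add: ev_pCons ev_0 cst_hom)

text \<open>In terms of monotone triangles: counts are invariant under translation of the bottom row,
  since \<open>1 + Y\<close> is the shift of a column by \<open>1\<close>.\<close>

lemma Phi_shift: "Phi (map ((*) zz) hL) hR = Phi hL (map ((*) zz) hR)"
proof -
  let ?L = "[0..<length hL]" and ?R = "[length hL..<length hL + length hR]"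
  let ?F = "tst U ?L hL * tst Y ?R hR"
  have "ct (?F * G (?L @ ?R) * ((\<Prod>v\<leftarrow>?L. 1 + (1 - 1) * U v) * (\<Prod>v\<leftarrow>?R. 1 + 1 * Y v)))
      = ct (?F * G (?L @ ?R) * (\<Prod>v\<leftarrow>?L. 1 + U v))"
    by (rule ct_G_shift)
      (auto intro!: exp_ge_mult0 exp_ge_tst_Y exp_ge_tst_U exp_ge_0_of_free[OF free_tst] free_intros)
  then show ?thesis
    by (simp add: Phi_def Psi_def tst_map_mult ev_zz map_replicate_const ac_simps)
qed

text \<open>This is the case of a row with no middle column, above which there is no row at
  all.\<close>

lemma Phi_vanish:
  assumes "hL @ hR \<noteq> []"
  shows "Phi (map (pCons 0) hL) (map (pCons 0) hR) = 0"
proof -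
  let ?L = "[0..<length hL]" and ?R = "[length hL..<length hL + length hR]"
  let ?F = "tst U ?L hL * tst Y ?R hR"
  have "ct (?F * G (?L @ ?R) * ((\<Prod>v\<leftarrow>?L. U v) * (\<Prod>v\<leftarrow>?R. Y v))) = 0"
    using assms by (intro ct_G_vanish)
      (auto intro!: exp_ge_mult0 exp_ge_tst_Y exp_ge_tst_U exp_ge_0_of_free[OF free_tst] free_intros)
  then show ?thesis
    by (simp add: Phi_def Psi_def tst_map_pCons ac_simps)
qed

section \<open>Elimination of a variable and the relation for adjacent columns\<close>

lemma exp_ge_power: "exp_ge 0 \<epsilon> v f \<Longrightarrow> exp_ge 0 \<epsilon> v (f ^ k)"
  by (induction k) (auto intro: exp_ge_1 exp_ge_mult0)

lemma ct_sign_mult: "ct ((-1) ^ k * f) = (-1) ^ k * ct f"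
  by (induction k arbitrary: f) simp_all

text \<open>Congruence modulo \<open>Y x\<close> among Laurent polynomials without negative powers
  of \<open>Y x\<close>.\<close>

definition eqv_at :: "nat \<Rightarrow> 'a::comm_ring_1 laurent \<Rightarrow> 'a laurent \<Rightarrow> bool" where
  "eqv_at x f g \<longleftrightarrow> exp_ge 0 1 x f \<and> exp_ge 0 1 x g \<and> exp_ge 1 1 x (f - g)"

lemma eqv_at_mult:
  assumes "eqv_at x f g" "eqv_at x f' g'"
  shows "eqv_at x (f * f') (g * g')"
proof -
  have "exp_ge 1 1 x ((f - g) * f')" "exp_ge 1 1 x (g * (f' - g'))"
    using assms by (simp_all add: eqv_at_def exp_ge_1_mult exp_ge_mult_1)
  moreover have "f * f' - g * g' = (f - g) * f' + g * (f' - g')"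
    by (simp add: algebra_simps)
  ultimately show ?thesis
    using assms by (simp add: eqv_at_def exp_ge_mult0 exp_ge_add)
qed

lemma eqv_at_refl: "exp_ge 0 1 x f \<Longrightarrow> eqv_at x f f"
  by (simp add: eqv_at_def exp_ge_def)

lemma eqv_at_uminus:
  assumes "eqv_at x f g"
  shows "eqv_at x (- f) (- g)"
proof -
  have eq: "- f - - g = - (f - g)" by simp
  show ?thesis
    using assms by (simp only: eqv_at_def eq exp_ge_uminus simp_thms)
qed

lemma eqv_at_prod_list:
  "(\<And>v. v \<in> set vs \<Longrightarrow> eqv_at x (f v) (g v)) \<Longrightarrow> eqv_at x (\<Prod>v\<leftarrow>vs. f v) (\<Prod>v\<leftarrow>vs. g v)"
  by (induction vs) (auto intro: eqv_at_refl exp_ge_1 eqv_at_mult)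

lemma eqv_at_power: "eqv_at x f g \<Longrightarrow> eqv_at x (f ^ k) (g ^ k)"
  by (induction k) (auto intro: eqv_at_refl exp_ge_1 eqv_at_mult)

lemma eqv_atI: "exp_ge 0 1 x g \<Longrightarrow> exp_ge 1 1 x h \<Longrightarrow> eqv_at x (g + h) g"
  by (auto simp: eqv_at_def intro: exp_ge_add exp_ge_0_of_1)

lemma ct_eqv_at: "eqv_at x f g \<Longrightarrow> ct f = ct g"
  using ct_exp_ge_1[of 1 x "f - g"] by (simp add: eqv_at_def)

lemma cancel_U: "U x * (a * Y x) = a" "U x * (a * (b * Y x)) = a * b" "U x * (a * (Y x * b)) = a * b"
  by (simp_all add: mult.left_commute[of a] mult.commute[of _ "Y x"])

text \<open>Modulo the relation of \<open>ct_G_shift\<close> with parameter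
  \<open>- U x\<close> for the middle variable \<open>x\<close>, the integrand becomes a polynomial in
  \<open>Y x\<close>, whose constant term in \<open>Y x\<close> is its value at \<open>0\<close>.\<close>

lemma Phi_eliminate:
  "Phi (map (pCons 0) hL) (map (pCons 0) g @ zz ^ k # map (pCons 0) hR)
     = (-1) ^ length g * Phi (map ((*) zz) hL) (g @ map ((*) zz) hR)"
proof -
  obtain L M x and R :: "nat list" where v: "distinct (L @ M @ x # R)" "length L = length hL"
    "length M = length g" "length R = length hR"
    using ex_distinct_vars[of "length hL" "length g" "length hR"] by blast
  define T where "T = tst U L hL * (tst Y M g * tst Y R hR)"
  let ?s = "- U x"
  define F where "F = T * (1 + Y x) ^ k * (\<Prod>v\<leftarrow>L. 1 + - (Y x * U v))
    * (\<Prod>v\<leftarrow>M. - (1 + (Y x + Y x * Y v))) * (\<Prod>v\<leftarrow>R. 1 + Y v + Y x * Y v)"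
  \<comment> \<open>The value of \<open>F\<close> at \<open>Y x = 0\<close>, written factor by
    factor so that the congruence can be proved factor by factor.\<close>
  define F0 where "F0 = T * 1 ^ k * (\<Prod>v\<leftarrow>L. 1) * (\<Prod>v\<leftarrow>M. - 1) * (\<Prod>v\<leftarrow>R. 1 + Y v)"
  have x: "x \<notin> set L" "x \<notin> set M" "x \<notin> set R"
    using v(1) by auto
  \<comment> \<open>In each product the first factor is the one of \<open>ct_G_shift\<close> and
    contains all negative powers of \<open>Y x\<close>; the second factor is a polynomial in
    \<open>Y x\<close>.\<close>
  have KL: "(\<Prod>v\<leftarrow>L. U v * K v x) = (\<Prod>v\<leftarrow>L. (1 + (1 - ?s) * U v) * (1 + - (Y x * U v)))"
    by (intro arg_cong[where f = prod_list] map_cong) (simp_all add: K_def algebra_simps)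
  have KM: "(\<Prod>v\<leftarrow>M. Y v * K v x) = (\<Prod>v\<leftarrow>M. (1 + ?s * Y v) * (- (1 + (Y x + Y x * Y v))))"
    by (intro arg_cong[where f = prod_list] map_cong) (simp_all add: K_def algebra_simps cancel_U)
  have KR: "(\<Prod>v\<leftarrow>R. Y v * K x v) = (\<Prod>v\<leftarrow>R. (1 + ?s * Y v) * (1 + Y v + Y x * Y v))"
    by (intro arg_cong[where f = prod_list] map_cong) (simp_all add: K_def algebra_simps cancel_U)
  have "Phi (map (pCons 0) hL) (map (pCons 0) g @ zz ^ k # map (pCons 0) hR)
      = Psi L (M @ x # R) (map (pCons 0) hL) (map (pCons 0) g @ zz ^ k # map (pCons 0) hR)"
    using v by (intro Phi_eq_Psi) auto
  also have "\<dots> = ct (T * (1 + Y x) ^ k * G (L @ M @ R) *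
     ((\<Prod>v\<leftarrow>L. U v * K v x) * (\<Prod>v\<leftarrow>M. Y v * K v x) * (\<Prod>v\<leftarrow>R. Y v * K x v)))"
    using v
    by (simp add: G_insert[of "L @ M" x R, simplified append_assoc] T_def Psi_def tst_append tst_map_pCons ev_power ev_zz prod_list_map_mult ac_simps)
  also have "\<dots> = ct (F * G (L @ (M @ R)) * ((\<Prod>v\<leftarrow>L. 1 + (1 - ?s) * U v) * (\<Prod>v\<leftarrow>M @ R. 1 + ?s * Y v)))"
    unfolding KL KM KR
    unfolding prod_list_map_mult F_def map_append prod_list.append by (simp only: ac_simps)
  also have "\<dots> = ct (F * G (L @ (M @ R)) * (\<Prod>v\<leftarrow>L. 1 + U v))"
  proof (rule ct_G_shift)
    show "distinct (L @ M @ R)" using v by auto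
    fix w assume "w \<in> set (L @ M @ R)"
    with x show "free w ?s" by (intro free_intros) auto
  next
    fix w assume w: "w \<in> set L"
    have "exp_ge 0 (-1) w T"
      using v w unfolding T_def
      by (intro exp_ge_mult0 exp_ge_tst_U exp_ge_0_of_free[OF free_tst[of _ _ w Y]] free_Y) auto
    moreover have "exp_ge 0 (-1) w (Y u)" if "u \<in> set (M @ x # R)" for u
      using v w that by (auto intro!: exp_ge_0_of_free[OF free_Y])
    ultimately show "exp_ge 0 (-1) w F" unfolding F_def
      by (intro exp_ge_mult0 exp_ge_power exp_ge_prod_list
          exp_ge_add exp_ge_uminus exp_ge_1 exp_ge_U0) auto
  next
    fix w assume w: "w \<in> set (M @ R)"
    have "exp_ge 0 1 w T"
      using v w unfolding T_def
      by (intro exp_ge_mult0 exp_ge_tst_Y exp_ge_0_of_free[OF free_tst[of _ _ w U]] free_U) auto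
    moreover have "exp_ge 0 1 w (U u)" if "u \<in> set L" for u
      using v w that by (auto intro!: exp_ge_0_of_free[OF free_U])
    ultimately show "exp_ge 0 1 w F" unfolding F_def
      by (intro exp_ge_mult0 exp_ge_power exp_ge_prod_list
          exp_ge_add exp_ge_uminus exp_ge_1 exp_ge_Y0) auto
  qed
  also have "\<dots> = ct (F0 * G (L @ (M @ R)) * (\<Prod>v\<leftarrow>L. 1 + U v))"
  proof (rule ct_eqv_at)
    have T: "exp_ge 0 1 x T"
      using v x unfolding T_def
      by (intro exp_ge_mult0 exp_ge_tst_Y exp_ge_0_of_free[OF free_tst[of _ _ x U]] free_U) auto
    have U: "exp_ge 0 1 x (U u)" if "u \<in> set L" for u
      using x that by (auto intro!: exp_ge_0_of_free[OF free_U])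
    have "eqv_at x F F0"
      unfolding F_def F0_def
      by (intro eqv_at_mult eqv_at_power eqv_at_prod_list eqv_atI eqv_at_uminus eqv_at_refl[OF T]
          exp_ge_1_mult exp_ge_add exp_ge_uminus exp_ge_1 exp_ge_Y exp_ge_Y0 U)
    moreover have "exp_ge 0 1 x (G (L @ (M @ R)))"
      using x by (intro exp_ge_0_of_free[OF free_G]) auto
    moreover have "exp_ge 0 1 x (\<Prod>v\<leftarrow>L. 1 + U v)"
      by (intro exp_ge_prod_list exp_ge_add exp_ge_1 U)
    ultimately show "eqv_at x (F * G (L @ (M @ R)) * (\<Prod>v\<leftarrow>L. 1 + U v))
        (F0 * G (L @ (M @ R)) * (\<Prod>v\<leftarrow>L. 1 + U v))"
      by (intro eqv_at_mult eqv_at_refl)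
  qed
  also have "\<dots> = ct ((-1) ^ length g * (G (L @ (M @ R)) * (tst U L (map ((*) zz) hL)
      * tst Y (M @ R) (g @ map ((*) zz) hR))))"
    using v by (simp add: F0_def T_def tst_append tst_map_mult ev_zz map_replicate_const ac_simps)
  also have "\<dots> = (-1) ^ length g * Psi L (M @ R) (map ((*) zz) hL) (g @ map ((*) zz) hR)"
    by (simp add: ct_sign_mult Psi_def)
  also have "Psi L (M @ R) (map ((*) zz) hL) (g @ map ((*) zz) hR)
      = Phi (map ((*) zz) hL) (g @ map ((*) zz) hR)"
    using v by (intro Phi_eq_Psi[symmetric]) auto
  finally show ?thesis .
qed


text \<open>Swapping \<open>p\<close> and \<open>q\<close> changes the sign of the integrand, because
  \<open>1 - (1 + Y q) + (1 + Y p) * (1 + Y q)\<close> is the first factor of \<open>K q p\<close>.\<close>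

lemma Phi_adjacent:
  fixes A B hL :: "'a::{idom, ring_char_0} poly list"
  shows "Phi hL (A @ zz ^ k # zz ^ k # B) + Phi hL (A @ zz ^ Suc k # zz ^ Suc k # B)
    = Phi hL (A @ zz ^ k # zz ^ Suc k # B)"
proof -
  obtain L M p q and R :: "nat list" where v: "distinct (L @ M @ p # q # R)" "length L = length hL"
    "length M = length A" "length R = length B"
    using ex_distinct_vars2[of "length hL" "length A" "length B"] by blast
  let ?V = "L @ M @ p # q # R"
  define T where "T = tst U L hL * (tst Y M A * tst Y R B)"
  define I where "I p q = G (L @ M @ p # q # R) * T * ((1 + Y p) * (1 + Y q)) ^ k * (1 + Y p + Y q * Y p)"
    for p q
  define \<sigma> where "\<sigma> = id(p := q, q := p)"
  have \<sigma>: "bij \<sigma>"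
    by (rule involuntory_imp_bij) (simp add: \<sigma>_def)
  have p: "p \<notin> set (L @ M @ R)" "q \<notin> set (L @ M @ R)" "p \<noteq> q"
    using v(1) by auto
  have \<sigma>_map: "map \<sigma> L = L" "map \<sigma> M = M" "map \<sigma> R = R"
    using p by (auto simp: \<sigma>_def intro!: map_idI)
  have \<sigma>_pq: "\<sigma> p = q" "\<sigma> q = p"
    by (simp_all add: \<sigma>_def)
  have ren_T: "rename \<sigma> T = T"
    using v unfolding T_def
    by (simp add: rename_hom[OF \<sigma>] rename_tst[OF \<sigma>] rename_var[OF \<sigma>] \<sigma>_map)
  have ren_pow: "rename \<sigma> (f ^ k) = rename \<sigma> f ^ k" for f :: "'a laurent"
    by (induction k) (simp_all add: rename_hom[OF \<sigma>])
  have ren: "rename \<sigma> (I p q) = I q p"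
    unfolding I_def
    by (simp add: rename_hom[OF \<sigma>] rename_G[OF \<sigma>] rename_var[OF \<sigma>] \<sigma>_map \<sigma>_pq ren_T ren_pow)
  \<comment> \<open>Apart from the factor \<open>K p q\<close>, the adjacent variables
    \<open>p\<close> and \<open>q\<close> enter the kernel symmetrically.\<close>
  define G0 :: "'a laurent" where "G0 = G (L @ M @ R) * ((\<Prod>a\<leftarrow>L @ M. K a p * K a q) * (\<Prod>b\<leftarrow>R. K p b * K q b))"
  have G_pq: "G (L @ M @ p # q # R) = G0 * K p q" "G (L @ M @ q # p # R) = G0 * K q p"
    by (simp_all add: G0_def prod_list_map_mult ac_simps G_insert[of "L @ M" p, simplified append_assoc]
        G_insert[of "L @ M" q, simplified append_assoc])
  have "K p q * (1 + Y p + Y q * Y p) + K q p * (1 + Y q + Y p * Y q) = (0 :: 'a laurent)"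
    by (simp add: K_def algebra_simps cancel_U)
  moreover have "a * k1 * t * r * m1 + a * k2 * t * r * m2 = a * t * r * (k1 * m1 + k2 * m2)"
    for a k1 k2 t r m1 m2 :: "'a laurent"
    by (simp add: algebra_simps)
  ultimately have "I p q + I q p = 0"
    unfolding I_def G_pq mult.commute[of "1 + Y q" "1 + Y p"] by (simp only: mult_zero_right)
  then have "ct (I p q) + ct (I q p) = 0"
    by (simp only: ct_hom flip: ct_hom(1))
  moreover have "ct (I q p) = ct (I p q)"
    using ct_rename[OF \<sigma>, of "I p q"] by (simp only: ren)
  \<comment> \<open>Antisymmetry shows only that twice the constant term is 0; characteristic 0
    removes the 2.\<close>
  ultimately have "2 * ct (I p q) = 0"
    by simp
  then have zero: "ct (I p q) = 0"
    by simp
  have Psi: "Phi hL (A @ zz ^ i # zz ^ j # B) = Psi L (M @ p # q # R) hL (A @ zz ^ i # zz ^ j # B)" for i j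
    using v by (intro Phi_eq_Psi) auto
  have t: "tst Y (M @ p # q # R) (A @ zz ^ i # zz ^ j # B)
      = tst Y M A * ((1 + Y p) ^ i * ((1 + Y q) ^ j * tst Y R B))" for i j
    using v by (simp add: tst_append ev_power ev_zz)
  have gen: "g * (u * (m * (a ^ k * (b ^ k * r)))) + g * (u * (m * (a ^ Suc k * (b ^ Suc k * r))))
      - g * (u * (m * (a ^ k * (b ^ Suc k * r)))) = g * (u * (m * r)) * (a * b) ^ k * (1 + a * b - b)"
    for g u m a b r :: "'a laurent"
    by (simp add: power_mult_distrib algebra_simps)
  have "Phi hL (A @ zz ^ k # zz ^ k # B) + Phi hL (A @ zz ^ Suc k # zz ^ Suc k # B)
      - Phi hL (A @ zz ^ k # zz ^ Suc k # B)
    = ct (G ?V * T * ((1 + Y p) * (1 + Y q)) ^ k * (1 + (1 + Y p) * (1 + Y q) - (1 + Y q)))"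
    unfolding Psi Psi_def t ct_hom(1,2)[symmetric] gen T_def ..
  also have "1 + (1 + Y p) * (1 + Y q) - (1 + Y q) = 1 + Y p + Y q * (Y p :: 'a laurent)"
    by (simp add: algebra_simps)
  finally show ?thesis
    using zero unfolding I_def by (simp only: diff_eq_eq add_0)
qed

section \<open>Interlacing sequences\<close>

text \<open>The rows above \<open>ks\<close> in a monotone triangle. There is none above the empty
  row, since every row adds one entry, but the empty row lies above a single entry.\<close>

fun interlacing :: "nat list \<Rightarrow> nat list set" where
  "interlacing [] = {}"
| "interlacing [k] = {[]}"
| "interlacing (k # k' # ks) =
     {l # ls | l ls. k \<le> l \<and> l \<le> k' \<and> ls \<in> interlacing (k' # ks) \<and> (ls \<noteq> [] \<longrightarrow> l < hd ls)}"

lemma finite_interlacing: "finite (interlacing ks)"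
proof (induction ks rule: interlacing.induct)
  case (3 k k' ks)
  have "interlacing (k # k' # ks) \<subseteq> (\<lambda>(l, ls). l # ls) ` ({k..k'} \<times> interlacing (k' # ks))"
    by auto
  then show ?case
    by (rule finite_subset) (use 3 in simp)
qed simp_all

lemma hd_interlacing: "ls \<in> interlacing (k # ks) \<Longrightarrow> ls \<noteq> [] \<Longrightarrow> k \<le> hd ls"
  by (cases ks) auto

lemma interlacing_Suc:
  assumes "k < k'"
  shows "interlacing (k # k' # ks)
    = interlacing (Suc k # k' # ks) \<union> Cons k ` interlacing (k' # ks)"
proof (intro equalityI subsetI)
  fix xs assume "xs \<in> interlacing (k # k' # ks)"
  then obtain l ls where xs: "xs = l # ls" "k \<le> l" "l \<le> k'" "ls \<in> interlacing (k' # ks)"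
    "ls \<noteq> [] \<longrightarrow> l < hd ls" by auto
  then show "xs \<in> interlacing (Suc k # k' # ks) \<union> Cons k ` interlacing (k' # ks)"
    by (cases "l = k") auto
next
  fix xs assume "xs \<in> interlacing (Suc k # k' # ks) \<union> Cons k ` interlacing (k' # ks)"
  then show "xs \<in> interlacing (k # k' # ks)"
    using assms hd_interlacing[of _ k' ks] by fastforce
qed

text \<open>The discrete derivative of the sum in its first entry; \<open>Phi_step_right\<close> is
  the counterpart for \<open>Phi\<close>.\<close>

lemma sum_interlacing_Suc:
  assumes "k < k'"
  shows "(\<Sum>ls\<in>interlacing (k # k' # ks). f ls)
    = (\<Sum>ls\<in>interlacing (Suc k # k' # ks). f ls) + (\<Sum>ls\<in>interlacing (k' # ks). f (k # ls))"
proof -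
  have "interlacing (Suc k # k' # ks) \<inter> Cons k ` interlacing (k' # ks) = {}"
    by auto
  then have "(\<Sum>ls\<in>interlacing (k # k' # ks). f ls) = (\<Sum>ls\<in>interlacing (Suc k # k' # ks). f ls)
      + (\<Sum>ls\<in>Cons k ` interlacing (k' # ks). f ls)"
    unfolding interlacing_Suc[OF assms]
    by (intro sum.union_disjoint finite_imageI finite_interlacing)
  also have "(\<Sum>ls\<in>Cons k ` interlacing (k' # ks). f ls) = (\<Sum>ls\<in>interlacing (k' # ks). f (k # ls))"
    by (simp add: sum.reindex)
  finally show ?thesis .
qed

text \<open>The repeated entry leaves only \<open>k\<close> as first entry of the row above, and
  strictness pushes the next entry beyond \<open>k\<close>. Such a list is not a row of a triangle;
  it arises where the raised first entry meets the second one.\<close>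

lemma interlacing_same:
  assumes "sorted_wrt (<) (k # ks)"
  shows "interlacing (k # k # ks) = Cons k ` interlacing (Suc k # ks)"
proof (cases ks)
  case (Cons k' ks')
  then have "interlacing (Suc k # ks) = {ls \<in> interlacing (k # ks). k < hd ls}"
    by auto
  moreover have "ls \<noteq> []" if "ls \<in> interlacing (k # ks)" for ls
    using that Cons by auto
  ultimately show ?thesis by auto
qed auto

lemma zz_power_Suc: "zz ^ Suc k = zz ^ k + pCons 0 (zz ^ k)"
  by simp

lemma Phi_step_right:
  fixes B hL :: "'a::{idom, ring_char_0} poly list"
  shows "Phi hL (A @ zz ^ k # B) = Phi hL (A @ zz ^ Suc k # B) - Phi hL (A @ pCons 0 (zz ^ k) # B)"
  unfolding zz_power_Suc Phi_add_right by simp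

text \<open>Both sides are compared while the first entry \<open>k\<close> is raised until it equals the second one,
  where \<open>Phi_adjacent\<close> applies. The differences contain \<open>pCons 0 (zz ^ k)\<close>, so the induction
  hypothesis for one entry less computes them.\<close>

lemma Phi_interlacing:
  fixes hL hR g :: "'a::{idom, ring_char_0} poly list"
  assumes "sorted_wrt (<) ks" "ks \<noteq> [] \<longrightarrow> k \<le> hd ks"
  shows "Phi (map (pCons 0) hL) (map (pCons 0) g @ zz ^ k # map (\<lambda>k. zz ^ k) ks @ map (pCons 0) hR)
    = (-1) ^ length g * (\<Sum>ls\<in>interlacing (k # ks).
        Phi (map ((*) zz) hL) (g @ map (\<lambda>l. zz ^ l) ls @ map ((*) zz) hR))"
  using assms
proof (induction ks arbitrary: k g)
  case Nil
  show ?case by (simp add: Phi_eliminate del: mult_pCons_left)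
next
  case (Cons k' ks)
  let ?L = "map (pCons 0) hL" and ?B = "map (\<lambda>k. zz ^ k) ks @ map (pCons 0) hR"
  let ?S = "\<lambda>ls. Phi (map ((*) zz) hL) (g @ map (\<lambda>l. zz ^ l) ls @ map ((*) zz) hR)"
  \<comment> \<open>The entry that carries the difference joins \<open>g\<close>; the longer
    \<open>g\<close> accounts for the sign.\<close>
  have IH: "Phi ?L (map (pCons 0) g @ pCons 0 (zz ^ j) # zz ^ i # ?B)
      = - ((-1) ^ length g) * (\<Sum>ls\<in>interlacing (i # ks). ?S (j # ls))"
    if "ks \<noteq> [] \<longrightarrow> i \<le> hd ks" for i j
    using Cons.IH[of i "g @ [zz ^ j]"] Cons.prems(1) that by (simp del: mult_pCons_left)
  have hd: "ks \<noteq> [] \<longrightarrow> k' < hd ks"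
    using Cons.prems(1) by (cases ks) auto
  have "k \<le> k'" using Cons.prems(2) by simp
  then have "Phi ?L (map (pCons 0) g @ zz ^ k # zz ^ k' # ?B)
    = (-1) ^ length g * (\<Sum>ls\<in>interlacing (k # k' # ks). ?S ls)"
  proof (induction k rule: inc_induct)
    case base
    have "Phi ?L (map (pCons 0) g @ zz ^ k' # zz ^ k' # ?B)
      = Phi ?L (map (pCons 0) g @ zz ^ k' # zz ^ Suc k' # ?B)
      - Phi ?L (map (pCons 0) g @ zz ^ Suc k' # zz ^ Suc k' # ?B)"
      using Phi_adjacent[of ?L "map (pCons 0) g" k' ?B] by (simp only: eq_diff_eq)
    also have "\<dots> = - Phi ?L (map (pCons 0) g @ pCons 0 (zz ^ k') # zz ^ Suc k' # ?B)"
      using Phi_step_right[of ?L "map (pCons 0) g" k' "zz ^ Suc k' # ?B"] by (simp only: diff_diff_eq2) simp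
    also have "\<dots> = (-1) ^ length g * (\<Sum>ls\<in>interlacing (Suc k' # ks). ?S (k' # ls))"
      using hd by (subst IH) auto
    also have "(\<Sum>ls\<in>interlacing (Suc k' # ks). ?S (k' # ls)) = (\<Sum>ls\<in>interlacing (k' # k' # ks). ?S ls)"
      using interlacing_same[OF Cons.prems(1)] by (simp add: sum.reindex)
    finally show ?case .
  next
    case (step k)
    have IH': "Phi ?L (map (pCons 0) g @ pCons 0 (zz ^ k) # zz ^ k' # ?B)
      = - ((-1) ^ length g) * (\<Sum>ls\<in>interlacing (k' # ks). ?S (k # ls))"
      using hd by (intro IH) auto
    show ?case
      unfolding sum_interlacing_Suc[OF step(2)]
        Phi_step_right[of ?L "map (pCons 0) g" k "zz ^ k' # ?B"] step.IH IH'
      by (simp only: mult_minus_left diff_minus_eq_add distrib_left)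
  qed
  then show ?case by (simp only: list.map append_Cons)
qed


text \<open>\<open>Phi_interlacing\<close> leaves a factor \<open>zz\<close> in every test on the
  left. Translation removes it and puts one more into all other tests: seen from the left end of the
  previous row, middle positions are larger by one and the right end by two. The first two entries
  may coincide, because a just completed left column may get the same position as the first middle
  column.\<close>

lemma Phi_transfer:
  fixes hL hR :: "'a::{idom, ring_char_0} poly list"
  assumes "sorted_wrt (<) (tl ks)" "tl ks \<noteq> [] \<longrightarrow> hd ks \<le> hd (tl ks)" "hL @ hR \<noteq> [] \<or> ks \<noteq> []"
  shows "Phi (map (pCons 0) hL) (map (\<lambda>k. zz ^ k) ks @ map (pCons 0) hR)
    = (\<Sum>ls\<in>interlacing ks. Phi hL (map (\<lambda>l. zz ^ Suc l) ls @ map (\<lambda>h. zz * (zz * h)) hR))"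
proof (cases ks)
  case Nil
  then show ?thesis using assms Phi_vanish[of hL hR] by simp
next
  case (Cons k ks')
  have "Phi (map (pCons 0) hL) (map (\<lambda>k. zz ^ k) ks @ map (pCons 0) hR)
     = (\<Sum>ls\<in>interlacing ks. Phi (map ((*) zz) hL) (map (\<lambda>l. zz ^ l) ls @ map ((*) zz) hR))"
    using Phi_interlacing[of ks' k hL "[]" hR] assms Cons by (simp del: mult_pCons_left)
  also have "\<dots> = (\<Sum>ls\<in>interlacing ks. Phi hL (map (\<lambda>l. zz ^ Suc l) ls @ map (\<lambda>h. zz * (zz * h)) hR))"
    by (simp add: Phi_shift comp_def del: mult_pCons_left)
  finally show ?thesis .
qed

lemma interlacing_shift:
  "interlacing (map (\<lambda>k. k + d) ks) = map (\<lambda>k. k + d) ` interlacing ks"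
proof (induction ks rule: interlacing.induct)
  case (3 k k' ks)
  show ?case
  proof (intro equalityI subsetI)
    fix xs assume "xs \<in> interlacing (map (\<lambda>k. k + d) (k # k' # ks))"
    then obtain l ls where xs: "xs = l # map (\<lambda>k. k + d) ls" "k + d \<le> l" "l \<le> k' + d"
      "ls \<in> interlacing (k' # ks)" "ls \<noteq> [] \<longrightarrow> l < hd (map (\<lambda>k. k + d) ls)"
      using 3 by auto
    then have "xs = map (\<lambda>k. k + d) ((l - d) # ls)" "ls \<noteq> [] \<longrightarrow> l - d < hd ls"
      by (auto simp: hd_map)
    with xs show "xs \<in> map (\<lambda>k. k + d) ` interlacing (k # k' # ks)"
      by (intro image_eqI[of _ _ "(l - d) # ls"]) auto
  next
    fix xs assume "xs \<in> map (\<lambda>k. k + d) ` interlacing (k # k' # ks)"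
    then show "xs \<in> interlacing (map (\<lambda>k. k + d) (k # k' # ks))"
      using 3 by (auto simp: hd_map)
  qed
qed simp_all

lemma sum_interlacing_shift:
  "(\<Sum>ls\<in>interlacing (map (\<lambda>k. k + d) ks). f ls) = (\<Sum>ls\<in>interlacing ks. f (map (\<lambda>k. k + d) ls))"
  unfolding interlacing_shift by (subst sum.reindex) (auto simp: inj_on_def o_def)

lemma interlacing_ge: "ls \<in> interlacing (k # ks) \<Longrightarrow> l \<in> set ls \<Longrightarrow> sorted (k # ks) \<Longrightarrow> k \<le> l"
proof (induction ks arbitrary: k ls)
  case (Cons k' ks)
  then show ?case by (fastforce dest: Cons.IH)
qed simp

lemma sorted_interlacing: "ls \<in> interlacing ks \<Longrightarrow> sorted_wrt (<) ls"
proof (induction ks arbitrary: ls rule: interlacing.induct)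
  case (3 k k' ks)
  then obtain l ls' where ls: "ls = l # ls'" "ls' \<noteq> [] \<longrightarrow> l < hd ls'" "sorted_wrt (<) ls'"
    by auto
  then show ?case by (cases ls') auto
qed simp_all

text \<open>Only the last entry can reach \<open>e\<close>, all others being bounded by entries of
  \<open>ks\<close>. For empty \<open>ks\<close> both sides are empty, in accordance with
  \<open>interlacing [] = {}\<close>.\<close>

lemma interlacing_snoc:
  assumes "sorted_wrt (<) (ks @ [e])"
  shows "{ls \<in> interlacing (ks @ [e]). e \<in> set ls} = (\<lambda>ls. ls @ [e]) ` interlacing ks"
  using assms
proof (induction ks rule: interlacing.induct)
  case (3 k k' ks)
  have IH: "{ls \<in> interlacing (k' # ks @ [e]). e \<in> set ls} = (\<lambda>ls. ls @ [e]) ` interlacing (k' # ks)"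
    using 3 by simp
  have ke: "k' < e" using 3 by simp
  show ?case
  proof (intro equalityI subsetI)
    fix xs assume "xs \<in> {ls \<in> interlacing ((k # k' # ks) @ [e]). e \<in> set ls}"
    then obtain l ls where xs: "xs = l # ls" "k \<le> l" "l \<le> k'" "ls \<in> interlacing (k' # ks @ [e])"
      "ls \<noteq> [] \<longrightarrow> l < hd ls" "e \<in> set ls"
      using ke by auto
    then obtain ls' where ls': "ls = ls' @ [e]" "ls' \<in> interlacing (k' # ks)"
      using IH by blast
    then show "xs \<in> (\<lambda>ls. ls @ [e]) ` interlacing (k # k' # ks)"
      using xs by (intro image_eqI[of _ _ "l # ls'"]) (auto simp: hd_append split: if_splits)
  next
    fix xs assume "xs \<in> (\<lambda>ls. ls @ [e]) ` interlacing (k # k' # ks)"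
    then obtain l ls where xs: "xs = (l # ls) @ [e]" "k \<le> l" "l \<le> k'" "ls \<in> interlacing (k' # ks)"
      "ls \<noteq> [] \<longrightarrow> l < hd ls"
      by auto
    then have "ls @ [e] \<in> interlacing (k' # ks @ [e])" using IH by blast
    then show "xs \<in> {ls \<in> interlacing ((k # k' # ks) @ [e]). e \<in> set ls}"
      using xs ke by (auto simp: hd_append)
  qed
qed auto

section \<open>The transfer step with weights\<close>

lemma map_pred_Suc:
  fixes ks :: "nat list"
  assumes "0 \<notin> set ks"
  shows "ks = map (\<lambda>k. k + 1) (map (\<lambda>k. k - 1) ks)"
proof -
  have "k - 1 + 1 = k" if "k \<in> set ks" for k
    using assms that by (cases k) auto
  then show ?thesis
    unfolding map_map by (intro map_idI[symmetric]) simp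
qed

text \<open>Positions are now counted from the left end of the row just added; the next row starts
  one column further right, hence \<open>k - 1\<close>. Without 0 in the list this is a true
  predecessor.\<close>

lemma Phi_transfer_pred:
  fixes hL hR :: "'a::{idom, ring_char_0} poly list"
  assumes "sorted_wrt (<) (tl ks)" "tl ks \<noteq> [] \<longrightarrow> hd ks \<le> hd (tl ks)" "hL @ hR \<noteq> [] \<or> ks \<noteq> []"
    "0 \<notin> set ks"
  shows "Phi (map (pCons 0) hL) (map (\<lambda>k. zz ^ (k - 1)) ks @ map (pCons 0) hR)
    = (\<Sum>ls\<in>interlacing ks. Phi hL (map (\<lambda>l. zz ^ l) ls @ map (\<lambda>h. zz * (zz * h)) hR))"
proof -
  let ?ks = "map (\<lambda>k. k - 1) ks"
  have nz: "k \<noteq> 0" if "k \<in> set (tl ks)" for k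
    using assms(4) that by (metis list.set_sel(2) tl_Nil)
  have "sorted_wrt (\<lambda>x y. x - 1 < y - 1) (tl ks)"
  proof (rule sorted_wrt_mono_rel[OF _ assms(1)])
    fix x y assume "x \<in> set (tl ks)" "y \<in> set (tl ks)" "x < y"
    with nz[of x] show "x - 1 < y - 1" by simp
  qed
  then have sw: "sorted_wrt (<) (tl ?ks)"
    by (simp only: map_tl[symmetric] sorted_wrt_map)
  have hd: "tl ?ks \<noteq> [] \<longrightarrow> hd ?ks \<le> hd (tl ?ks)"
  proof
    assume "tl ?ks \<noteq> []"
    then have "tl ks \<noteq> []" "ks \<noteq> []" by (auto simp: map_tl[symmetric])
    then show "hd ?ks \<le> hd (tl ?ks)"
      using assms(2) unfolding map_tl[symmetric] by (simp add: hd_map diff_le_mono)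
  qed
  have "Phi (map (pCons 0) hL) (map (\<lambda>k. zz ^ k) ?ks @ map (pCons 0) hR)
    = (\<Sum>ls\<in>interlacing ?ks. Phi hL (map (\<lambda>l. zz ^ Suc l) ls @ map (\<lambda>h. zz * (zz * h)) hR))"
    using assms(3) by (intro Phi_transfer sw hd) auto
  also have "\<dots> = (\<Sum>ls\<in>interlacing (map (\<lambda>k. k + 1) ?ks).
      Phi hL (map (\<lambda>l. zz ^ l) ls @ map (\<lambda>h. zz * (zz * h)) hR))"
    unfolding sum_interlacing_shift by (simp only: map_map comp_def Suc_eq_plus1)
  finally show ?thesis
    unfolding map_pred_Suc[OF assms(4), symmetric] by (simp only: map_map comp_def)
qed

text \<open>Position 0 is the left end of the row: being in \<open>ks\<close> but not in
  \<open>ls\<close> means that the entry there is 1.\<close>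

definition left_weight :: "'a::comm_ring_1 \<Rightarrow> nat list \<Rightarrow> nat list \<Rightarrow> 'a" where
  "left_weight t ks ls = (if 0 \<in> set ks \<and> 0 \<notin> set ls then t else 1)"

text \<open>The term \<open>t\<close> of the test \<open>t + U\<close> is constant, so the column
  passes for a middle column of position 1 and the row above cannot contain 0. The term
  \<open>U\<close> treats it as frozen already; after the transfer its test is constant, and moved
  to the middle it becomes the entry 0 of the row above. By \<open>sum_interlacing_Suc\<close> the
  two sums together run over all rows above.\<close>

lemma Phi_transfer_left:
  fixes hL hR :: "'a::{idom, ring_char_0} poly list"
  assumes ks: "sorted_wrt (<) ks" and ne: "hL @ hR \<noteq> [] \<or> ks \<noteq> []"
  shows "Phi (map (pCons 0) hL @ (if 0 \<in> set ks then [[:t, 1:]] else []))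
      (map (\<lambda>k. zz ^ (k - 1)) (filter (\<lambda>k. k \<noteq> 0) ks) @ map (pCons 0) hR)
    = (\<Sum>ls\<in>interlacing ks. left_weight t ks ls *
        Phi hL (map (\<lambda>l. zz ^ l) ls @ map (\<lambda>h. zz * (zz * h)) hR))"
proof (cases "0 \<in> set ks")
  case False
  then have "filter (\<lambda>k. k \<noteq> 0) ks = ks" by (induction ks) auto
  moreover have "sorted_wrt (<) (tl ks)" "tl ks \<noteq> [] \<longrightarrow> hd ks \<le> hd (tl ks)"
    using ks by (cases ks; cases "tl ks"; auto)+
  ultimately show ?thesis
    using False Phi_transfer_pred[of ks hL hR] ne by (simp add: left_weight_def del: mult_pCons_left)
next
  case True
  then obtain ks' where k: "ks = 0 # ks'" "0 \<notin> set ks'" "sorted_wrt (<) ks'"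
    using ks by (cases ks) auto
  then have filter: "filter (\<lambda>k. k \<noteq> 0) ks = ks'"
    by (simp add: filter_id_conv) (metis gr0I)
  let ?S = "\<lambda>ls. Phi hL (map (\<lambda>l. zz ^ l) ls @ map (\<lambda>h. zz * (zz * h)) hR)"
  let ?R = "map (\<lambda>k. zz ^ (k - 1)) ks' @ map (pCons 0) hR"
  have "[:t, 1:] = smult t [:1:] + pCons 0 [:1 :: 'a:]" by simp
  then have "Phi (map (pCons 0) hL @ [[:t, 1:]]) ?R
    = t * Phi (map (pCons 0) hL @ [[:1:]]) ?R + Phi (map (pCons 0) (hL @ [[:1:]])) ?R"
    using Phi_add_left[of "map (pCons 0) hL" "smult t [:1:]" "pCons 0 [:1:]" "[]" ?R]
      Phi_smult_left[of "map (pCons 0) hL" t "[:1:]" "[]" ?R] by (simp only: map_append list.map)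
  also have "Phi (map (pCons 0) hL @ [[:1:]]) ?R = (\<Sum>ls\<in>interlacing (1 # ks'). ?S ls)"
  proof -
    have "Phi (map (pCons 0) hL @ [[:1:]]) ?R = Phi (map (pCons 0) hL) ([:1:] # ?R)"
      by (rule Phi_boundary)
    also have "[:1:] # ?R = map (\<lambda>k. zz ^ (k - 1)) (1 # ks') @ map (pCons 0) hR"
      by simp
    also have "Phi (map (pCons 0) hL) \<dots> = (\<Sum>ls\<in>interlacing (1 # ks'). ?S ls)"
    proof (rule Phi_transfer_pred)
      show "tl (1 # ks') \<noteq> [] \<longrightarrow> hd (1 # ks') \<le> hd (tl (1 # ks'))"
        using k(2) hd_in_set[of ks'] by (cases "hd ks'") auto
    qed (use k in auto)
    finally show ?thesis .
  qed
  also have "Phi (map (pCons 0) (hL @ [[:1:]])) ?R = (\<Sum>ls\<in>interlacing ks'. ?S (0 # ls))"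
  proof -
    have "Phi (map (pCons 0) (hL @ [[:1:]])) ?R = (\<Sum>ls\<in>interlacing ks'.
        Phi (hL @ [[:1:]]) (map (\<lambda>l. zz ^ l) ls @ map (\<lambda>h. zz * (zz * h)) hR))"
      using k by (intro Phi_transfer_pred) (cases ks'; cases "tl ks'"; auto)+
    also have "\<dots> = (\<Sum>ls\<in>interlacing ks'. ?S (0 # ls))"
      by (simp add: Phi_boundary one_pCons del: mult_pCons_left)
    finally show ?thesis .
  qed
  also have "t * (\<Sum>ls\<in>interlacing (1 # ks'). ?S ls) + (\<Sum>ls\<in>interlacing ks'. ?S (0 # ls))
    = (\<Sum>ls\<in>interlacing ks. left_weight t ks ls * ?S ls)"
  proof -
    have "left_weight t ks ls = t" if "ls \<in> interlacing (1 # ks')" for ls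
    proof -
      have "sorted (1 # ks')" using k by (auto simp: Suc_le_eq strict_sorted_imp_sorted intro!: gr0I)
      with that have "0 \<notin> set ls" using interlacing_ge by force
      with k show ?thesis by (simp add: left_weight_def)
    qed
    then have e1: "t * (\<Sum>ls\<in>interlacing (1 # ks'). ?S ls) = (\<Sum>ls\<in>interlacing (1 # ks'). left_weight t ks ls * ?S ls)"
      by (simp add: sum_distrib_left del: mult_pCons_left)
    have e2: "(\<Sum>ls\<in>interlacing ks'. ?S (0 # ls)) = (\<Sum>ls\<in>interlacing ks'. left_weight t ks (0 # ls) * ?S (0 # ls))"
      by (simp add: left_weight_def del: mult_pCons_left)
    show ?thesis
    proof (cases ks')
      case (Cons k' ks'')
      then have "0 < k'" using k by auto
      from sum_interlacing_Suc[OF this, where ks = ks'' and f = "\<lambda>ls. left_weight t ks ls * ?S ls"]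
      show ?thesis
        unfolding e1 e2 unfolding k(1) Cons One_nat_def by (rule sym)
    qed (simp add: k left_weight_def)
  qed
  finally show ?thesis
    using True by (simp only: filter if_True)
qed

text \<open>Split \<open>1 + t Y = (1 + Y) + (t - 1) Y\<close>. The first part makes the column an
  ordinary middle column at position \<open>e\<close>, so all rows above count once. The second part
  treats it as frozen already, which by \<open>interlacing_snoc\<close> selects the rows containing
  \<open>e\<close>; these get \<open>1 + (t - 1) = t\<close>.\<close>

lemma Phi_transfer_right:
  fixes hL hR :: "'a::{idom, ring_char_0} poly list"
  assumes ks: "sorted_wrt (<) (ks @ [e])" and e: "2 \<le> e"
  shows "Phi (map (pCons 0) hL @ (if 0 \<in> set ks then [[:t, 1:]] else []))
      (map (\<lambda>k. zz ^ (k - 1)) (filter (\<lambda>k. k \<noteq> 0) ks) @ (zz ^ (e - 2) * [:1, t:]) # map (pCons 0) hR)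
    = (\<Sum>ls\<in>interlacing (ks @ [e]). left_weight t ks ls * (if e \<in> set ls then t else 1) *
        Phi hL (map (\<lambda>l. zz ^ l) ls @ map (\<lambda>h. zz * (zz * h)) hR))"
proof -
  let ?L = "map (pCons 0) hL @ (if 0 \<in> set ks then [[:t, 1:]] else [])"
  let ?M = "map (\<lambda>k. zz ^ (k - 1)) (filter (\<lambda>k. k \<noteq> 0) ks)"
  let ?S = "\<lambda>ls. Phi hL (map (\<lambda>l. zz ^ l) ls @ map (\<lambda>h. zz * (zz * h)) hR)"
  have wt: "left_weight t (ks @ [e]) ls = left_weight t ks ls" for ls
    using e by (auto simp: left_weight_def)
  obtain d where d: "e = d + 2" using e by (metis le_add_diff_inverse2)
  have "zz ^ (e - 2) * [:1, t:] = zz ^ (e - 1) + smult (t - 1) (pCons 0 (zz ^ (e - 2)))"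
    unfolding d by (simp add: algebra_simps smult_diff_left)
  then have "Phi ?L (?M @ (zz ^ (e - 2) * [:1, t:]) # map (pCons 0) hR)
    = Phi ?L (?M @ zz ^ (e - 1) # map (pCons 0) hR)
    + (t - 1) * Phi ?L (?M @ pCons 0 (zz ^ (e - 2)) # map (pCons 0) hR)"
    by (simp only: Phi_add_right Phi_smult_right)
  also have "Phi ?L (?M @ zz ^ (e - 1) # map (pCons 0) hR)
    = (\<Sum>ls\<in>interlacing (ks @ [e]). left_weight t ks ls * ?S ls)"
    using Phi_transfer_left[OF ks, of hL hR t] e by (simp add: wt del: mult_pCons_left)
  also have "Phi ?L (?M @ pCons 0 (zz ^ (e - 2)) # map (pCons 0) hR)
    = (\<Sum>ls\<in>interlacing ks. left_weight t ks ls *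
        Phi hL (map (\<lambda>l. zz ^ l) ls @ map (\<lambda>h. zz * (zz * h)) (zz ^ (e - 2) # hR)))"
    using Phi_transfer_left[of ks hL "zz ^ (e - 2) # hR" t] ks
    by (simp add: sorted_wrt_append del: mult_pCons_left)
  also have "\<dots> = (\<Sum>ls\<in>interlacing ks. left_weight t ks (ls @ [e]) * ?S (ls @ [e]))"
    using e unfolding d by (simp add: left_weight_def del: mult_pCons_left)
  also have "\<dots> = (\<Sum>ls\<in>{ls \<in> interlacing (ks @ [e]). e \<in> set ls}. left_weight t ks ls * ?S ls)"
    unfolding interlacing_snoc[OF ks] by (subst sum.reindex) (auto simp: inj_on_def o_def)
  also have "\<dots> = (\<Sum>ls\<in>interlacing (ks @ [e]). if e \<in> set ls then left_weight t ks ls * ?S ls else 0)"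
    by (rule sum.inter_filter[OF finite_interlacing])
  also have "(\<Sum>ls\<in>interlacing (ks @ [e]). left_weight t ks ls * ?S ls) +
      (t - 1) * (\<Sum>ls\<in>interlacing (ks @ [e]). if e \<in> set ls then left_weight t ks ls * ?S ls else 0)
    = (\<Sum>ls\<in>interlacing (ks @ [e]). left_weight t ks ls * (if e \<in> set ls then t else 1) * ?S ls)"
    unfolding sum_distrib_left sum.distrib[symmetric]
    by (intro sum.cong) (auto simp: algebra_simps simp del: mult_pCons_left)
  finally show ?thesis .
qed

section \<open>Counting chains of column sets\<close>

text \<open>Let \<open>A\<close> and \<open>B\<close> be the columns with partial sum 1 before and
  after a row. The row has 1 on \<open>B - A\<close> and -1 on \<open>A - B\<close>, so the
  differences of counts are its prefix sums, which have to lie in {0, 1} and end with 1.\<close>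

definition interlaces :: "nat set \<Rightarrow> nat set \<Rightarrow> bool" where
  "interlaces A B \<longleftrightarrow> (\<forall>J. card (A \<inter> {..J}) \<le> card (B \<inter> {..J}) \<and> card (B \<inter> {..J}) \<le> card (A \<inter> {..J}) + 1)
     \<and> card B = card A + 1"

lemma cnt_eq_0: "sorted_wrt (<) (x # xs) \<Longrightarrow> J < x \<Longrightarrow> filter (\<lambda>y. y \<le> (J :: nat)) (x # xs) = []"
  by (auto simp: filter_empty_conv)

lemma interlacing_iff:
  assumes "sorted_wrt (<) ls" "sorted_wrt (<) ks"
  shows "ls \<in> interlacing ks \<longleftrightarrow>
    (\<forall>J. length (filter (\<lambda>x. x \<le> J) ls) \<le> length (filter (\<lambda>x. x \<le> J) ks) \<and>
         length (filter (\<lambda>x. x \<le> J) ks) \<le> length (filter (\<lambda>x. x \<le> J) ls) + 1) \<and>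
    length ks = length ls + 1"
  using assms
proof (induction ks arbitrary: ls rule: interlacing.induct)
  case (3 k k' ks)
  let ?c = "\<lambda>J xs. length (filter (\<lambda>x. x \<le> (J :: nat)) xs)"
  show ?case
  proof (cases ls)
    case (Cons l ls')
    have s: "sorted_wrt (<) (l # ls')" "sorted_wrt (<) (k' # ks)" "sorted_wrt (<) ls'" "k < k'"
      "sorted_wrt (<) (k # k' # ks)"
      using 3 Cons by auto
    have hd: "ls' \<noteq> [] \<longrightarrow> l < hd ls'" using s(1) by (cases ls') auto
    have z1: "?c J ls' = 0" if "J \<le> l" for J
      using s(1) that by (force simp: filter_empty_conv)
    have z2: "?c J (k' # ks) = 0" if "J < k'" for J
      using cnt_eq_0[OF s(2) that] by (simp only: list.size)
    have IH: "ls' \<in> interlacing (k' # ks) \<longleftrightarrow> (\<forall>J. ?c J ls' \<le> ?c J (k' # ks) \<and> ?c J (k' # ks) \<le> ?c J ls' + 1)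
        \<and> length (k' # ks) = length ls' + 1"
      by (rule 3(1)) (use s in auto)
    have c1: "?c J (l # ls') = (if l \<le> J then 1 else 0) + ?c J ls'" for J by simp
    have c2: "?c J (k # k' # ks) = (if k \<le> J then 1 else 0) + ?c J (k' # ks)" for J by simp
    have "ls \<in> interlacing (k # k' # ks) \<longleftrightarrow> k \<le> l \<and> l \<le> k' \<and> ls' \<in> interlacing (k' # ks)"
      using Cons hd by simp
    also have "\<dots> \<longleftrightarrow> (\<forall>J. ?c J (l # ls') \<le> ?c J (k # k' # ks) \<and> ?c J (k # k' # ks) \<le> ?c J (l # ls') + 1)
        \<and> length (k # k' # ks) = length (l # ls') + 1" (is "?P \<longleftrightarrow> ?Q")
    proof
      assume P: ?P
      then have "?c J (l # ls') \<le> ?c J (k # k' # ks) \<and> ?c J (k # k' # ks) \<le> ?c J (l # ls') + 1" for J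
        using z1[of J] z2[of J] IH unfolding c1 c2 by (cases "l \<le> J"; cases "k \<le> J"; auto)
      moreover have "length (k' # ks) = length ls' + 1" using P IH by blast
      ultimately show ?Q by simp
    next
      assume Q: ?Q
      then have QJ: "?c J (l # ls') \<le> ?c J (k # k' # ks)" "?c J (k # k' # ks) \<le> ?c J (l # ls') + 1" for J
        by blast+
      have kl: "k \<le> l"
        using QJ(1)[of l] z2[of l] s(4) unfolding c1 c2 by (cases "k \<le> l") auto
      have lk: "l \<le> k'"
      proof (rule ccontr)
        assume "\<not> l \<le> k'"
        with QJ(2)[of k'] z1[of k'] s(4) show False unfolding c1 c2 by simp
      qed
      have "?c J ls' \<le> ?c J (k' # ks) \<and> ?c J (k' # ks) \<le> ?c J ls' + 1" for J
        using QJ[of J] z1[of J] z2[of J] kl lk unfolding c1 c2 by (cases "l \<le> J"; cases "k \<le> J"; auto)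
      moreover have "length (k' # ks) = length ls' + 1" using Q by simp
      ultimately show ?P using kl lk IH by blast
    qed
    finally show ?thesis by (simp only: Cons)
  qed simp
qed auto

lemma interlaces_iff:
  assumes "finite A" "finite B"
  shows "interlaces A B \<longleftrightarrow> sorted_list_of_set A \<in> interlacing (sorted_list_of_set B)"
proof -
  have "length (filter (\<lambda>x. x \<le> J) (sorted_list_of_set X)) = card (X \<inter> {..J})" if "finite X" for X :: "nat set" and J
  proof -
    have "length (filter (\<lambda>x. x \<le> J) (sorted_list_of_set X))
        = card (set (filter (\<lambda>x. x \<le> J) (sorted_list_of_set X)))"
      by (intro distinct_card[symmetric] distinct_filter) simp
    also have "set (filter (\<lambda>x. x \<le> J) (sorted_list_of_set X)) = X \<inter> {..J}"
      using that by auto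
    finally show ?thesis .
  qed
  with assms show ?thesis
    by (simp add: interlacing_iff interlaces_def)
qed

lemma interlacing_bounds:
  "ls \<in> interlacing ks \<Longrightarrow> l \<in> set ls \<Longrightarrow> (\<exists>k\<in>set ks. k \<le> l) \<and> (\<exists>k\<in>set ks. l \<le> k)"
  by (induction ks arbitrary: ls rule: interlacing.induct) fastforce+

lemma sum_interlaces:
  assumes "B \<subseteq> {a..b}"
  shows "(\<Sum>A\<in>{A. A \<subseteq> {a..b} \<and> interlaces A B}. f A) = (\<Sum>ls\<in>interlacing (sorted_list_of_set B). f (set ls))"
proof (rule sum.reindex_bij_betw[symmetric], rule bij_betw_byWitness[where f' = sorted_list_of_set])
  have fin: "finite B" using assms finite_subset by blast
  have sl: "sorted_list_of_set (set ls) = ls" if "ls \<in> interlacing (sorted_list_of_set B)" for ls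
    using sorted_interlacing[OF that]
    by (simp add: strict_sorted_iff sorted_list_of_set.idem_if_sorted_distinct)
  then show "\<forall>ls\<in>interlacing (sorted_list_of_set B). sorted_list_of_set (set ls) = ls"
    by blast
  show "\<forall>A\<in>{A. A \<subseteq> {a..b} \<and> interlaces A B}. set (sorted_list_of_set A) = A"
    by (auto dest: finite_subset[OF _ finite_atLeastAtMost])
  show "set ` interlacing (sorted_list_of_set B) \<subseteq> {A. A \<subseteq> {a..b} \<and> interlaces A B}"
  proof safe
    fix ls x assume ls: "ls \<in> interlacing (sorted_list_of_set B)"
    then show "interlaces (set ls) B" by (simp add: interlaces_iff fin sl)
    assume "x \<in> set ls"
    with interlacing_bounds[OF ls this] fin assms show "x \<in> {a..b}" by fastforce
  qed
  show "sorted_list_of_set ` {A. A \<subseteq> {a..b} \<and> interlaces A B} \<subseteq> interlacing (sorted_list_of_set B)"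
    using interlaces_iff[OF finite_subset[OF _ finite_atLeastAtMost] fin] by auto
qed

text \<open>The left end of row \<open>i\<close> contributes \<open>t\<close> to the weight if it is the bottom of an
  \<open>11\<close>-column, the right end if it is the bottom of a \<open>10\<close>-column.\<close>

definition row_weight :: "'a::comm_ring_1 \<Rightarrow> nat \<Rightarrow> nat \<Rightarrow> nat set \<Rightarrow> nat set \<Rightarrow> 'a" where
  "row_weight t n i S' S =
     (if i \<in> S \<and> i \<notin> S' then t else 1) * (if 2 * n - i \<in> S \<and> 2 * n - i \<in> S' then t else 1)"

text \<open>\<open>S'\<close> and \<open>S\<close> are the columns with partial sum 1 before and
  after row \<open>i\<close>.\<close>

definition row_step :: "nat \<Rightarrow> nat \<Rightarrow> nat set \<Rightarrow> nat set \<Rightarrow> bool" where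
  "row_step n i S' S \<longleftrightarrow> S' \<subseteq> {1..2 * n - 1} \<and> S' - row_cols n i = S - row_cols n i \<and>
     interlaces (S' \<inter> row_cols n i) (S \<inter> row_cols n i)"

fun chain_count :: "'a::comm_ring_1 \<Rightarrow> nat \<Rightarrow> nat \<Rightarrow> nat set \<Rightarrow> 'a" where
  "chain_count t n 0 S = (if S = {} then 1 else 0)"
| "chain_count t n (Suc m) S =
     (\<Sum>S'\<in>{S'. row_step n (Suc m) S' S}. row_weight t n (Suc m) S' S * chain_count t n m S')"

text \<open>After \<open>m\<close> rows the columns up to \<open>m\<close> and those from \<open>2 * n - m\<close> on are complete. Middle
  columns are counted from the left end \<open>Suc m\<close> of the next row, so \<open>2 * (n - Suc m)\<close> is the position
  of its right end. In the factor \<open>t + U\<close> the term \<open>t\<close> belongs to \<open>11\<close>-columns and \<open>U\<close> to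
  \<open>10\<close>-columns, in the factor \<open>1 + t Y\<close> the term \<open>1\<close> belongs to \<open>11\<close>-columns.\<close>

definition left_test :: "'a::comm_ring_1 \<Rightarrow> nat \<Rightarrow> nat \<Rightarrow> 'a poly" where
  "left_test t m c = [:t, 1:] * monom 1 (m - c)"

definition right_test :: "'a::comm_ring_1 \<Rightarrow> nat \<Rightarrow> nat \<Rightarrow> nat \<Rightarrow> 'a poly" where
  "right_test t n m c = zz ^ (2 * (n - Suc m)) * ([:1, t:] * monom 1 (c - (2 * n - m)))"

text \<open>The constant term after \<open>m\<close> rows. A frozen column has gained one factor
  \<open>U\<close> or \<open>Y\<close> for every row since its completion, which is the origin of
  the exponents in \<open>left_test\<close> and \<open>right_test\<close>.\<close>

definition row_value :: "'a::comm_ring_1 \<Rightarrow> nat \<Rightarrow> nat \<Rightarrow> nat set \<Rightarrow> 'a" where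
  "row_value t n m S = Phi (map (left_test t m) (sorted_list_of_set (S \<inter> {..m})))
     (map (\<lambda>c. zz ^ (c - Suc m)) (sorted_list_of_set (S \<inter> {Suc m..2 * n - Suc m})) @
      map (right_test t n m) (sorted_list_of_set (S \<inter> {2 * n - m..})))"

lemma sorted_list_of_set_Un:
  fixes A B :: "nat set"
  assumes "finite A" "finite B" "\<And>a b. a \<in> A \<Longrightarrow> b \<in> B \<Longrightarrow> a < b"
  shows "sorted_list_of_set (A \<union> B) = sorted_list_of_set A @ sorted_list_of_set B"
proof -
  have "sorted_wrt (<) (sorted_list_of_set A @ sorted_list_of_set B)"
    using assms by (simp add: sorted_wrt_append)
  moreover have "set (sorted_list_of_set A @ sorted_list_of_set B) = A \<union> B"
    using assms by simp
  ultimately show ?thesis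
    by (metis strict_sorted_iff sorted_list_of_set.idem_if_sorted_distinct)
qed

lemma left_test_Suc: "c \<le> m \<Longrightarrow> left_test t (Suc m) c = pCons 0 (left_test t m c)"
  by (simp add: left_test_def Suc_diff_le monom_Suc)

lemma sorted_list_shift:
  fixes X :: "nat set"
  assumes "finite X" "X \<subseteq> {d..}"
  shows "sorted_list_of_set X = map (\<lambda>k. k + d) (map (\<lambda>c. c - d) (sorted_list_of_set X))"
    and "sorted_wrt (<) (map (\<lambda>c. c - d) (sorted_list_of_set X))"
proof -
  have "c - d + d = c" if "c \<in> set (sorted_list_of_set X)" for c
    using that assms by auto
  then show "sorted_list_of_set X = map (\<lambda>k. k + d) (map (\<lambda>c. c - d) (sorted_list_of_set X))"
    unfolding map_map by (intro map_idI[symmetric]) simp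
  have "sorted_wrt (\<lambda>x y. x - d < y - d) (sorted_list_of_set X)"
  proof (rule sorted_wrt_mono_rel[OF _ strict_sorted_list_of_set])
    fix x y assume "x \<in> set (sorted_list_of_set X)" "y \<in> set (sorted_list_of_set X)" "x < y"
    then show "x - d < y - d" using assms by (auto intro!: diff_less_mono)
  qed
  then show "sorted_wrt (<) (map (\<lambda>c. c - d) (sorted_list_of_set X))"
    by (simp add: sorted_wrt_map)
qed


lemma row_value_Suc:
  fixes t :: "'a::{idom, ring_char_0}"
  assumes m: "m + 2 \<le> n" and S: "S \<subseteq> {1..2 * n - 1}" "S \<noteq> {}"
  defines "I \<equiv> row_cols n (Suc m)"
  shows "row_value t n (Suc m) S = (\<Sum>A\<in>{A. A \<subseteq> I \<and> interlaces A (S \<inter> I)}.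
    row_weight t n (Suc m) ((S - I) \<union> A) S * row_value t n m ((S - I) \<union> A))"
proof -
  \<comment> \<open>The right end of row \<open>Suc m\<close>, and \<open>e\<close> below is its
    position in that row. It is at least 2, so \<open>e - 2\<close> is not truncated.\<close>
  define b where "b = 2 * n - Suc m"
  define e where "e = b - Suc m"
  have fin: "finite (S \<inter> X)" for X using S(1) finite_subset by blast
  have I: "I = {Suc m..b}" by (simp add: I_def row_cols_def b_def)
  have be: "b = Suc m + e" "2 \<le> e" "2 * (n - Suc m) = e" "2 * (n - Suc (Suc m)) = e - 2" "2 * n - m = Suc b"
    using m by (auto simp: b_def e_def)
  let ?sl = "sorted_list_of_set"
  define hL where "hL = map (left_test t m) (?sl (S \<inter> {..m}))"
  define hR where "hR = map (\<lambda>c. zz ^ (e - 2) * ([:1, t:] * monom 1 (c - Suc b))) (?sl (S \<inter> {Suc b..}))"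
  define ks where "ks = map (\<lambda>c. c - Suc m) (?sl (S \<inter> {Suc m..<b}))"
  define ks' where "ks' = map (\<lambda>c. c - Suc m) (?sl (S \<inter> {Suc m..b}))"
  have z0: "0 \<in> set ks \<longleftrightarrow> Suc m \<in> S"
    using fin be by (force simp: ks_def image_iff)
  have single: "?sl (S \<inter> {c}) = (if c \<in> S then [c] else [])" for c by simp
  have L: "map (left_test t (Suc m)) (?sl (S \<inter> {..Suc m}))
    = map (pCons 0) hL @ (if 0 \<in> set ks then [[:t, 1:]] else [])"
  proof -
    have "S \<inter> {..Suc m} = (S \<inter> {..m}) \<union> (S \<inter> {Suc m})" by auto
    then have "?sl (S \<inter> {..Suc m}) = ?sl (S \<inter> {..m}) @ ?sl (S \<inter> {Suc m})"
      by (simp only:) (intro sorted_list_of_set_Un fin, auto)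
    moreover have "map (left_test t (Suc m)) (?sl (S \<inter> {..m})) = map (pCons 0) hL"
      using fin by (simp add: hL_def left_test_Suc)
    ultimately show ?thesis
      by (simp add: single z0 left_test_def monom_0)
  qed
  have M: "map (\<lambda>c. zz ^ (c - Suc (Suc m))) (?sl (S \<inter> {Suc (Suc m)..2 * n - Suc (Suc m)}))
    = map (\<lambda>k. zz ^ (k - 1) :: 'a poly) (filter (\<lambda>k. k \<noteq> 0) ks)"
  proof -
    have "S \<inter> {Suc m..<b} = (S \<inter> {Suc m}) \<union> (S \<inter> {Suc (Suc m)..<b})"
      using be by auto
    then have "?sl (S \<inter> {Suc m..<b}) = ?sl (S \<inter> {Suc m}) @ ?sl (S \<inter> {Suc (Suc m)..<b})"
      by (simp only:) (intro sorted_list_of_set_Un fin, auto)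
    moreover have "filter (\<lambda>c. c - Suc m \<noteq> 0) (?sl (S \<inter> {Suc (Suc m)..<b})) = ?sl (S \<inter> {Suc (Suc m)..<b})"
      using fin by (intro filter_True) auto
    ultimately have "filter (\<lambda>k. k \<noteq> 0) ks = map (\<lambda>c. c - Suc m) (?sl (S \<inter> {Suc (Suc m)..<b}))"
      by (simp add: ks_def filter_map comp_def single)
    moreover have "{Suc (Suc m)..2 * n - Suc (Suc m)} = {Suc (Suc m)..<b}"
      using m by (auto simp: b_def)
    ultimately show ?thesis by simp
  qed
  have R: "map (right_test t n (Suc m)) (?sl (S \<inter> {2 * n - Suc m..}))
    = (if b \<in> S then [zz ^ (e - 2) * [:1, t:]] else []) @ map (pCons 0) hR"
  proof -
    have "S \<inter> {2 * n - Suc m..} = (S \<inter> {b}) \<union> (S \<inter> {Suc b..})" by (auto simp: b_def)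
    then have "?sl (S \<inter> {2 * n - Suc m..}) = ?sl (S \<inter> {b}) @ ?sl (S \<inter> {Suc b..})"
      by (simp only:) (intro sorted_list_of_set_Un fin, auto)
    moreover have "right_test t n (Suc m) c = pCons 0 (zz ^ (e - 2) * ([:1, t:] * monom 1 (c - Suc b)))"
      if "c \<in> set (?sl (S \<inter> {Suc b..}))" for c
    proof -
      have "c - b = Suc (c - Suc b)" using that fin by auto
      then show ?thesis
        by (simp add: right_test_def be(4) monom_Suc flip: b_def del: mult_pCons_left)
    qed
    moreover have "right_test t n (Suc m) b = zz ^ (e - 2) * [:1, t:]"
      by (simp add: right_test_def be(4) monom_0 flip: b_def)
    ultimately show ?thesis
      by (simp add: hR_def single del: mult_pCons_left)
  qed
  have ks': "ks' = ks @ (if b \<in> S then [e] else [])"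
  proof -
    have "S \<inter> {Suc m..b} = (S \<inter> {Suc m..<b}) \<union> (S \<inter> {b})" using be by auto
    then have "?sl (S \<inter> {Suc m..b}) = ?sl (S \<inter> {Suc m..<b}) @ ?sl (S \<inter> {b})"
      by (simp only:) (intro sorted_list_of_set_Un fin, auto)
    then show ?thesis by (simp add: ks_def ks'_def single e_def)
  qed
  have sorted_ks': "sorted_wrt (<) ks'"
    unfolding ks'_def by (intro sorted_list_shift fin) auto
  have A: "set (map (\<lambda>k. k + Suc m) ls) \<subseteq> {Suc m..b}"
    if "ls \<in> interlacing ks'" for ls
  proof -
    have "l + Suc m \<le> b" if l: "l \<in> set ls" for l
    proof -
      obtain k where "k \<in> set ks'" "l \<le> k"
        using interlacing_bounds[OF \<open>ls \<in> interlacing ks'\<close> l] by blast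
      moreover have "k \<le> e" if "k \<in> set ks'" for k
        using that fin by (auto simp: ks'_def e_def intro: diff_le_mono)
      ultimately show ?thesis using be(1) by fastforce
    qed
    then show ?thesis by auto
  qed
  have row_value_A: "row_value t n m ((S - I) \<union> A) = Phi hL (map (\<lambda>l. zz ^ l) ls @ map (\<lambda>h. zz * (zz * h)) hR)"
    and row_weight_A: "row_weight t n (Suc m) ((S - I) \<union> A) S
      = left_weight t ks ls * (if b \<in> S \<and> e \<in> set ls then t else 1)"
    if ls: "ls \<in> interlacing ks'" and A_def: "A = set (map (\<lambda>k. k + Suc m) ls)" for ls A
  proof -
    have AI: "A \<subseteq> {Suc m..b}" using A[OF ls] A_def by simp
    have "((S - I) \<union> A) \<inter> {..m} = S \<inter> {..m}" "((S - I) \<union> A) \<inter> {Suc m..2 * n - Suc m} = A"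
      "((S - I) \<union> A) \<inter> {2 * n - m..} = S \<inter> {Suc b..}"
      using AI be unfolding I b_def[symmetric] by auto
    moreover have "?sl A = map (\<lambda>k. k + Suc m) ls"
    proof -
      have "sorted_wrt (<) (map (\<lambda>k. k + Suc m) ls)"
        using sorted_interlacing[OF ls] by (simp add: sorted_wrt_map)
      then show ?thesis
        unfolding A_def by (simp only: strict_sorted_iff sorted_list_of_set.idem_if_sorted_distinct)
    qed
    \<comment> \<open>One row earlier the right end has a position larger by two, which is matched
      by the two factors \<open>zz\<close>.\<close>
    moreover have "map (right_test t n m) (?sl (S \<inter> {Suc b..})) = map (\<lambda>h. zz * (zz * h)) hR"
    proof -
      obtain d where d: "e = d + 2" using be(2) by (metis le_add_diff_inverse2)
      have "right_test t n m c = zz * (zz * (zz ^ (e - 2) * ([:1, t:] * monom 1 (c - Suc b))))" for c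
        unfolding right_test_def be(3,5) unfolding d by (simp only: diff_add_inverse2 power_add power2_eq_square ac_simps)
      then show ?thesis by (simp add: hR_def del: mult_pCons_left)
    qed
    ultimately show "row_value t n m ((S - I) \<union> A) = Phi hL (map (\<lambda>l. zz ^ l) ls @ map (\<lambda>h. zz * (zz * h)) hR)"
      by (simp add: row_value_def hL_def comp_def del: mult_pCons_left)
    have "Suc m \<in> (S - I) \<union> A \<longleftrightarrow> 0 \<in> set ls" "b \<in> (S - I) \<union> A \<longleftrightarrow> e \<in> set ls"
      using be by (auto simp: I A_def image_iff)
    then show "row_weight t n (Suc m) ((S - I) \<union> A) S
      = left_weight t ks ls * (if b \<in> S \<and> e \<in> set ls then t else 1)"
      unfolding row_weight_def left_weight_def b_def[symmetric] z0 by simp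
  qed
  have "row_value t n (Suc m) S = (\<Sum>ls\<in>interlacing ks'. left_weight t ks ls *
      (if b \<in> S \<and> e \<in> set ls then t else 1) * Phi hL (map (\<lambda>l. zz ^ l) ls @ map (\<lambda>h. zz * (zz * h)) hR))"
  proof (cases "b \<in> S")
    case True
    then show ?thesis
      using Phi_transfer_right[of ks e hL t hR] sorted_ks' be(2)
      unfolding row_value_def L M R ks' by (simp only: if_True simp_thms append.simps)
  next
    case False
    \<comment> \<open>The transfer fails if all lists are empty: \<open>Phi [] []\<close> is 1, but
      the sum over \<open>interlacing []\<close> is 0. This is excluded by
      \<open>S \<noteq> {}\<close>.\<close>
    have "c \<in> {..m} \<union> {Suc m..<b} \<union> {Suc b..}" if "c \<in> S" for c
      using that False by (cases "c = b") auto
    then have "S \<subseteq> {..m} \<union> {Suc m..<b} \<union> {Suc b..}" by blast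
    with S(2) have "S \<inter> {..m} \<noteq> {} \<or> S \<inter> {Suc m..<b} \<noteq> {} \<or> S \<inter> {Suc b..} \<noteq> {}" by blast
    then have "hL @ hR \<noteq> [] \<or> ks \<noteq> []"
      using fin by (auto simp: hL_def hR_def ks_def)
    with False show ?thesis
      using Phi_transfer_left[of ks hL hR t] sorted_ks'
      unfolding row_value_def L M R ks' by (simp only: if_False simp_thms append.simps append_Nil2 mult_1_right)
  qed
  also have "\<dots> = (\<Sum>ls\<in>interlacing ks'. row_weight t n (Suc m) ((S - I) \<union> set (map (\<lambda>k. k + Suc m) ls)) S
      * row_value t n m ((S - I) \<union> set (map (\<lambda>k. k + Suc m) ls)))"
    by (intro sum.cong refl) (simp only: row_value_A[OF _ refl] row_weight_A[OF _ refl])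
  also have "\<dots> = (\<Sum>ls\<in>interlacing (?sl (S \<inter> I)). row_weight t n (Suc m) ((S - I) \<union> set ls) S
      * row_value t n m ((S - I) \<union> set ls))"
  proof -
    have "?sl (S \<inter> I) = map (\<lambda>k. k + Suc m) ks'"
      unfolding I ks'_def by (intro sorted_list_shift fin) auto
    then show ?thesis by (simp only: sum_interlacing_shift)
  qed
  also have "\<dots> = (\<Sum>A\<in>{A. A \<subseteq> I \<and> interlaces A (S \<inter> I)}.
    row_weight t n (Suc m) ((S - I) \<union> A) S * row_value t n m ((S - I) \<union> A))"
    unfolding I by (rule sum_interlaces[symmetric]) auto
  finally show ?thesis .
qed

text \<open>Row sums 1 make each row add one column to the set, so the cardinality carries through
  the induction and keeps \<open>S\<close> nonempty for positive \<open>m\<close>. The last row,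
  where both ends coincide, is left out.\<close>

lemma chain_count_eq_row_value:
  fixes t :: "'a::{idom, ring_char_0}"
  assumes "m + 1 \<le> n" "S \<subseteq> {1..2 * n - 1}" "card S = m"
  shows "chain_count t n m S = row_value t n m S"
  using assms
proof (induction m arbitrary: S)
  case 0
  then have "S = {}" using finite_subset[of S "{1..2 * n - 1}"] by simp
  then show ?case by (simp add: row_value_def Phi_Nil)
next
  case (Suc m)
  let ?I = "row_cols n (Suc m)"
  have finS: "finite S" using Suc.prems(2) finite_subset by blast
  have I: "?I \<subseteq> {1..2 * n - 1}" "finite ?I" by (auto simp: row_cols_def)
  have bij: "bij_betw (\<lambda>A. (S - ?I) \<union> A) {A. A \<subseteq> ?I \<and> interlaces A (S \<inter> ?I)} {S'. row_step n (Suc m) S' S}"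
  proof (rule bij_betw_byWitness[where f' = "\<lambda>S'. S' \<inter> ?I"])
    show "(\<lambda>A. (S - ?I) \<union> A) ` {A. A \<subseteq> ?I \<and> interlaces A (S \<inter> ?I)} \<subseteq> {S'. row_step n (Suc m) S' S}"
    proof safe
      fix A assume A: "A \<subseteq> ?I" "interlaces A (S \<inter> ?I)"
      then have "(S - ?I \<union> A) \<inter> ?I = A" by blast
      with A show "row_step n (Suc m) (S - ?I \<union> A) S"
        using Suc.prems(2) I by (auto simp: row_step_def)
    qed
  qed (auto simp: row_step_def)
  have "chain_count t n (Suc m) S = (\<Sum>A\<in>{A. A \<subseteq> ?I \<and> interlaces A (S \<inter> ?I)}.
      row_weight t n (Suc m) ((S - ?I) \<union> A) S * chain_count t n m ((S - ?I) \<union> A))"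
    by (simp add: sum.reindex_bij_betw[OF bij, symmetric])
  also have "\<dots> = (\<Sum>A\<in>{A. A \<subseteq> ?I \<and> interlaces A (S \<inter> ?I)}.
      row_weight t n (Suc m) ((S - ?I) \<union> A) S * row_value t n m ((S - ?I) \<union> A))"
  proof (rule sum.cong[OF refl])
    fix A assume "A \<in> {A. A \<subseteq> ?I \<and> interlaces A (S \<inter> ?I)}"
    then have A: "A \<subseteq> ?I" "card (S \<inter> ?I) = card A + 1" by (auto simp: interlaces_def)
    have "card S = card (S - ?I) + card (S \<inter> ?I)"
      using card_Int_Diff[OF finS, of ?I] by simp
    moreover have "card (S - ?I \<union> A) = card (S - ?I) + card A"
      using A(1) finS I(2) by (intro card_Un_disjoint) (auto intro: finite_subset)
    ultimately have "card (S - ?I \<union> A) = m"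
      using A(2) Suc.prems(3) by simp
    then have "chain_count t n m (S - ?I \<union> A) = row_value t n m (S - ?I \<union> A)"
      using Suc.prems A(1) I(1) by (intro Suc.IH) auto
    then show "row_weight t n (Suc m) ((S - ?I) \<union> A) S * chain_count t n m ((S - ?I) \<union> A)
       = row_weight t n (Suc m) ((S - ?I) \<union> A) S * row_value t n m ((S - ?I) \<union> A)" by simp
  qed
  also have "\<dots> = row_value t n (Suc m) S"
    using Suc.prems by (intro row_value_Suc[symmetric]) auto
  finally show ?case .
qed

section \<open>Triangles and chains\<close>

text \<open>The last non-zero entry before \<open>J\<close> determines the sum: 1 after an entry 1
  and 0 after an entry -1. The induction carries this entry as a witness.\<close>

lemma prefix_sums_of_alternating:
  fixes f :: "nat \<Rightarrow> int"
  assumes val: "\<forall>k\<in>I. f k \<in> {0, 1, -1}" and alt: "nonzero_alternate I f"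
    and first: "\<forall>k\<in>I. f k \<noteq> 0 \<and> (\<forall>l\<in>I. l < k \<longrightarrow> f l = 0) \<longrightarrow> f k = 1"
  shows "(\<Sum>k\<in>I \<inter> {..<J}. f k) \<in> {0, 1}"
proof -
  have "(\<Sum>k\<in>I \<inter> {..<J}. f k) = 0 \<and> (\<forall>l\<in>I. l < J \<longrightarrow> f l = 0) \<or>
    (\<exists>k\<in>I. k < J \<and> f k \<noteq> 0 \<and> (\<forall>l\<in>I. k < l \<and> l < J \<longrightarrow> f l = 0) \<and>
       (\<Sum>k\<in>I \<inter> {..<J}. f k) = (if f k = 1 then 1 else 0))"
  proof (induction J)
    case (Suc J)
    have ins: "I \<inter> {..<Suc J} = (if J \<in> I then insert J (I \<inter> {..<J}) else I \<inter> {..<J})"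
      by (auto simp: less_Suc_eq)
    show ?case
    proof (cases "J \<in> I \<and> f J \<noteq> 0")
      case False
      then have sum: "(\<Sum>k\<in>I \<inter> {..<Suc J}. f k) = (\<Sum>k\<in>I \<inter> {..<J}. f k)"
        by (simp add: ins)
      have ex: "(\<forall>l\<in>I. P l \<and> l < Suc J \<longrightarrow> f l = 0) \<longleftrightarrow> (\<forall>l\<in>I. P l \<and> l < J \<longrightarrow> f l = 0)" for P
        using False by (auto simp: less_Suc_eq)
      show ?thesis
        using Suc.IH
      proof (elim disjE bexE conjE)
        assume "(\<Sum>k\<in>I \<inter> {..<J}. f k) = 0" "\<forall>l\<in>I. l < J \<longrightarrow> f l = 0"
        then show ?thesis using sum ex[of "\<lambda>_. True"] by simp
      next
        fix k assume "k \<in> I" "k < J" "f k \<noteq> 0" "\<forall>l\<in>I. k < l \<and> l < J \<longrightarrow> f l = 0"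
          "(\<Sum>k\<in>I \<inter> {..<J}. f k) = (if f k = 1 then 1 else 0)"
        then show ?thesis using sum ex[of "\<lambda>l. k < l"]
          by (intro disjI2 bexI[of _ k] conjI) simp_all
      qed
    next
      case True
      then have sum: "(\<Sum>k\<in>I \<inter> {..<Suc J}. f k) = f J + (\<Sum>k\<in>I \<inter> {..<J}. f k)"
        by (simp add: ins)
      have "(\<Sum>k\<in>I \<inter> {..<Suc J}. f k) = (if f J = 1 then 1 else 0)"
        using Suc.IH
      proof (elim disjE bexE conjE)
        assume "(\<Sum>k\<in>I \<inter> {..<J}. f k) = 0" "\<forall>l\<in>I. l < J \<longrightarrow> f l = 0"
        with first True sum show ?thesis by auto
      next
        fix k assume k: "k \<in> I" "k < J" "f k \<noteq> 0" "\<forall>l\<in>I. k < l \<and> l < J \<longrightarrow> f l = 0"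
          "(\<Sum>k\<in>I \<inter> {..<J}. f k) = (if f k = 1 then 1 else 0)"
        then have "f J = - f k"
          using alt True unfolding nonzero_alternate_def by blast
        moreover have "f k = 1 \<or> f k = - 1" using val k(1,3) by auto
        ultimately show ?thesis using k(5) sum by auto
      qed
      with True show ?thesis
        by (intro disjI2 bexI[of _ J] conjI) simp_all
    qed
  qed simp
  then show ?thesis by auto
qed

text \<open>Two successive non-zero entries of equal sign would change the prefix sum by 2, and a
  first non-zero entry -1 would make it negative.\<close>

lemma alternating_of_prefix_sums:
  fixes f :: "nat \<Rightarrow> int"
  assumes val: "\<forall>k\<in>I. f k \<in> {0, 1, -1}" and pre: "\<forall>J. (\<Sum>k\<in>I \<inter> {..<J}. f k) \<in> {0, 1}"
  shows "nonzero_alternate I f"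
    and "\<forall>k\<in>I. f k \<noteq> 0 \<and> (\<forall>l\<in>I. l < k \<longrightarrow> f l = 0) \<longrightarrow> f k = 1"
proof -
  have Suc: "(\<Sum>k\<in>I \<inter> {..<Suc J}. f k) = f J + (\<Sum>k\<in>I \<inter> {..<J}. f k)" if "J \<in> I" for J
  proof -
    have "I \<inter> {..<Suc J} = insert J (I \<inter> {..<J})" using that by auto
    then show ?thesis by simp
  qed
  have P: "(\<Sum>k\<in>I \<inter> {..<J}. f k) = 0 \<or> (\<Sum>k\<in>I \<inter> {..<J}. f k) = 1" for J
    using pre by simp
  show "nonzero_alternate I f"
    unfolding nonzero_alternate_def
  proof (intro ballI impI)
    fix k l assume k: "k \<in> I" "l \<in> I" "k < l \<and> f k \<noteq> 0 \<and> f l \<noteq> 0 \<and> (\<forall>m\<in>I. k < m \<and> m < l \<longrightarrow> f m = 0)"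
    then have "(\<Sum>m\<in>I \<inter> {..<l}. f m) = (\<Sum>m\<in>I \<inter> {..<Suc k}. f m)"
      by (intro sum.mono_neutral_right) auto
    moreover have "y = - x" if "p = 0 \<or> p = 1" "q = 0 \<or> q = 1" "x + p = q" "y + q = 0 \<or> y + q = 1"
      "x \<noteq> 0" "y \<noteq> 0" for p q x y :: int
      using that by presburger
    ultimately show "f l = - f k"
      using P[of k] P[of "Suc k"] Suc[OF k(1)] Suc[OF k(2)] P[of "Suc l"] k(3) by metis
  qed
  show "\<forall>k\<in>I. f k \<noteq> 0 \<and> (\<forall>l\<in>I. l < k \<longrightarrow> f l = 0) \<longrightarrow> f k = 1"
  proof (intro ballI impI)
    fix k assume k: "k \<in> I" "f k \<noteq> 0 \<and> (\<forall>l\<in>I. l < k \<longrightarrow> f l = 0)"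
    then have "(\<Sum>m\<in>I \<inter> {..<k}. f m) = 0" by (intro sum.neutral) auto
    then show "f k = 1" using Suc[OF k(1)] P[of "Suc k"] k(2) by simp
  qed
qed

text \<open>Rows carry no condition on their first non-zero entry. If it were -1, the negated row
  would have its total in {0, 1}, against the sum 1.\<close>

lemma alternating_sum_1_iff:
  fixes f :: "nat \<Rightarrow> int"
  assumes fin: "finite I" and val: "\<forall>k\<in>I. f k \<in> {0, 1, -1}"
  shows "nonzero_alternate I f \<and> (\<Sum>k\<in>I. f k) = 1 \<longleftrightarrow>
    (\<forall>J. (\<Sum>k\<in>I \<inter> {..<J}. f k) \<in> {0, 1}) \<and> (\<Sum>k\<in>I. f k) = 1"
proof -
  have "(\<Sum>k\<in>I \<inter> {..<J}. f k) \<in> {0, 1}" if alt: "nonzero_alternate I f" and sum: "(\<Sum>k\<in>I. f k) = 1" for J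
  proof (cases "\<forall>k\<in>I. f k \<noteq> 0 \<and> (\<forall>l\<in>I. l < k \<longrightarrow> f l = 0) \<longrightarrow> f k = 1")
    case True
    with val alt show ?thesis by (rule prefix_sums_of_alternating)
  next
    case False
    then obtain k where k: "k \<in> I" "f k \<noteq> 0" "f k \<noteq> 1" "\<forall>l\<in>I. l < k \<longrightarrow> f l = 0" by blast
    have fk: "f k = - 1" using bspec[OF val k(1)] k(2,3) by simp
    obtain N where N: "I \<subseteq> {..<N}" using fin finite_nat_iff_bounded by blast
    have "(\<Sum>k\<in>I \<inter> {..<N}. - f k) \<in> {0, 1}"
    proof (rule prefix_sums_of_alternating)
      show "\<forall>k\<in>I. - f k \<in> {0, 1, - 1}"
      proof
        fix j assume "j \<in> I"
        from bspec[OF val this] show "- f j \<in> {0, 1, - 1}" by auto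
      qed
      show "nonzero_alternate I (\<lambda>k. - f k)" using alt by (simp add: nonzero_alternate_def)
      show "\<forall>k\<in>I. - f k \<noteq> 0 \<and> (\<forall>l\<in>I. l < k \<longrightarrow> - f l = 0) \<longrightarrow> - f k = 1"
      proof (intro ballI impI)
        fix j assume j: "j \<in> I" "- f j \<noteq> 0 \<and> (\<forall>l\<in>I. l < j \<longrightarrow> - f l = 0)"
        then have "\<not> k < j" "\<not> j < k" using k by auto
        then show "- f j = 1" using fk by simp
      qed
    qed
    moreover have "I \<inter> {..<N} = I" using N by blast
    ultimately show ?thesis using sum by (simp add: sum_negf)
  qed
  moreover have "nonzero_alternate I f" if "\<forall>J. (\<Sum>k\<in>I \<inter> {..<J}. f k) \<in> {0, 1}"
    using alternating_of_prefix_sums(1)[OF val that] .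
  ultimately show ?thesis by blast
qed

lemma row_iff_interlaces:
  assumes fin: "finite I" and f: "\<And>j. j \<in> I \<Longrightarrow> f j = of_bool (j \<in> S) - of_bool (j \<in> S')"
  shows "nonzero_alternate I f \<and> (\<Sum>j\<in>I. f j) = (1 :: int) \<longleftrightarrow> interlaces (S' \<inter> I) (S \<inter> I)"
proof -
  have sum: "(\<Sum>j\<in>X. f j) = int (card (S \<inter> X)) - int (card (S' \<inter> X))" if "X \<subseteq> I" for X
  proof -
    have "finite X" using fin that finite_subset by blast
    moreover have "(\<Sum>j\<in>X. f j) = (\<Sum>j\<in>X. of_bool (j \<in> S) - of_bool (j \<in> S'))"
      using that by (intro sum.cong) (auto simp: f)
    moreover have "(\<Sum>j\<in>X. of_bool (j \<in> Q)) = int (card (Q \<inter> X))" if "finite X" for Q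
      using that by (simp add: Int_commute)
    ultimately show ?thesis
      by (simp only: sum_subtractf)
  qed
  have val: "\<forall>k\<in>I. f k \<in> {0, 1, -1}" by (auto simp: f)
  have pre: "(\<Sum>k\<in>I \<inter> {..<J}. f k) \<in> {0, 1} \<longleftrightarrow>
    card (S' \<inter> I \<inter> {..<J}) \<le> card (S \<inter> I \<inter> {..<J}) \<and> card (S \<inter> I \<inter> {..<J}) \<le> card (S' \<inter> I \<inter> {..<J}) + 1" for J
    using sum[of "I \<inter> {..<J}"] by (auto simp: Int_assoc)
  note preS = pre[of "Suc _", unfolded lessThan_Suc_atMost]
  \<comment> \<open>Only the empty prefix \<open>J = 0\<close> is lost in passing from
    \<open>{..<J}\<close> to \<open>{..J}\<close>, and its sum is 0.\<close>
  have "(\<forall>J. (\<Sum>k\<in>I \<inter> {..<J}. f k) \<in> {0, 1}) \<longleftrightarrow> (\<forall>J. (\<Sum>k\<in>I \<inter> {..<Suc J}. f k) \<in> {0, 1})"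
  proof (intro iffI allI)
    fix J assume *: "\<forall>J. (\<Sum>k\<in>I \<inter> {..<Suc J}. f k) \<in> {0, 1}"
    show "(\<Sum>k\<in>I \<inter> {..<J}. f k) \<in> {0, 1}"
    proof (cases J)
      case (Suc i)
      show ?thesis unfolding Suc using * by (rule spec)
    qed simp
  qed (erule spec)
  also have "\<dots> \<longleftrightarrow> (\<forall>J. card (S' \<inter> I \<inter> {..J}) \<le> card (S \<inter> I \<inter> {..J}) \<and>
      card (S \<inter> I \<inter> {..J}) \<le> card (S' \<inter> I \<inter> {..J}) + 1)"
    by (simp only: lessThan_Suc_atMost preS)
  finally have prefix: "(\<forall>J. (\<Sum>k\<in>I \<inter> {..<J}. f k) \<in> {0, 1}) \<longleftrightarrow> \<dots>" .
  have total: "(\<Sum>j\<in>I. f j) = 1 \<longleftrightarrow> card (S \<inter> I) = card (S' \<inter> I) + 1"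
    using sum[of I] by auto
  show ?thesis
    using alternating_sum_1_iff[OF fin val] unfolding interlaces_def prefix total .
qed

section \<open>The bijection between triangles and chains\<close>

definition col_set :: "nat \<Rightarrow> (nat \<times> nat \<Rightarrow> int) \<Rightarrow> nat \<Rightarrow> nat set" where
  "col_set n T i = {j \<in> {1..2 * n - 1}. (\<Sum>k\<in>col_rows n j \<inter> {..i}. T (k, j)) = 1}"

text \<open>Being constant after \<open>m\<close> makes a chain determined by its first
  \<open>m + 1\<close> sets. For \<open>m = n\<close> this agrees with \<open>col_set\<close>, where
  a column keeps its sum once its rows are exhausted.\<close>

definition chains :: "nat \<Rightarrow> nat \<Rightarrow> (nat \<Rightarrow> nat set) set" where
  "chains n m = {C. C 0 = {} \<and> (\<forall>i\<in>{1..m}. row_step n i (C (i - 1)) (C i)) \<and> (\<forall>i>m. C i = C m)}"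

definition triangle :: "nat \<Rightarrow> (nat \<Rightarrow> nat set) \<Rightarrow> nat \<times> nat \<Rightarrow> int" where
  "triangle n C = restrict (\<lambda>(i, j). of_bool (j \<in> C i) - of_bool (j \<in> C (i - 1))) (cells n)"

lemma row_cols_subset: "1 \<le> i \<Longrightarrow> row_cols n i \<subseteq> {1..2 * n - 1}"
  by (auto simp: row_cols_def)

lemma finite_row_cols: "finite (row_cols n i)"
  by (simp add: row_cols_def)

lemma chains_step:
  assumes "C \<in> chains n m" "Suc i \<le> m"
  shows "row_step n (Suc i) (C i) (C (Suc i))"
proof -
  have "\<forall>i\<in>{1..m}. row_step n i (C (i - 1)) (C i)"
    using assms(1) by (simp add: chains_def)
  from bspec[OF this, of "Suc i"] assms(2) show ?thesis by simp
qed

lemma row_step_subset: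
  assumes "row_step n i S' S" "1 \<le> i"
  shows "S \<subseteq> {1..2 * n - 1}"
proof
  fix j assume j: "j \<in> S"
  show "j \<in> {1..2 * n - 1}"
  proof (cases "j \<in> row_cols n i")
    case True
    with row_cols_subset[OF assms(2)] show ?thesis by (rule subsetD)
  next
    case False
    have "j \<in> S' - row_cols n i"
      using assms(1) j False by (simp add: row_step_def)
    moreover have "S' \<subseteq> {1..2 * n - 1}" using assms(1) by (simp add: row_step_def)
    ultimately show ?thesis by (simp add: subset_iff)
  qed
qed

lemma chains_subset:
  assumes "C \<in> chains n m"
  shows "C i \<subseteq> {1..2 * n - 1}"
proof -
  have le: "C i \<subseteq> {1..2 * n - 1}" if "i \<le> m" for i
  proof (cases i)
    case 0
    then show ?thesis using assms by (simp add: chains_def)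
  next
    case (Suc k)
    with row_step_subset[OF chains_step[OF assms]] that show ?thesis by simp
  qed
  show ?thesis
  proof (cases "i \<le> m")
    case False
    then have "C i = C m" using assms by (simp add: chains_def)
    then show ?thesis using le[of m] by simp
  qed (rule le)
qed

lemma chains_frozen:
  assumes "C \<in> chains n n" "j \<in> {1..2 * n - 1}" "bottom_row n j \<le> i"
  shows "j \<in> C i \<longleftrightarrow> j \<in> C (bottom_row n j)"
  using assms(3)
proof (induction i rule: dec_induct)
  case (step i)
  show ?case
  proof (cases "Suc i \<le> n")
    case True
    then have rs: "row_step n (Suc i) (C i) (C (Suc i))"
      using assms(1) by (intro chains_step)
    have "j \<notin> row_cols n (Suc i)"
      using step(1) assms(2) by (auto simp: row_cols_def bottom_row_def)
    then show ?thesis using rs step.IH by (auto simp: row_step_def)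
  next
    case False
    moreover have "\<forall>i>n. C i = C n" using assms(1) by (simp add: chains_def)
    ultimately have "C (Suc i) = C n" "C i = C n" by (cases "i = n"; simp)+
    then show ?thesis using step.IH by simp
  qed
qed simp

text \<open>The entries are successive differences of indicators, so the sum telescopes; the minimum
  appears because the column stops at its bottom row.\<close>

lemma col_sum_triangle:
  assumes C: "C 0 = {}" and j: "j \<in> {1..2 * n - 1}"
  shows "(\<Sum>k\<in>col_rows n j \<inter> {..i}. triangle n C (k, j)) = of_bool (j \<in> C (min i (bottom_row n j)))"
proof -
  have "col_rows n j \<inter> {..i} = {1..min i (bottom_row n j)}"
    by (auto simp: col_rows_def)
  moreover have "(\<Sum>k\<in>{1..b}. triangle n C (k, j)) = of_bool (j \<in> C b)" if "b \<le> bottom_row n j" for b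
    using that
  proof (induction b)
    case (Suc b)
    then have "(Suc b, j) \<in> cells n"
      using j by (simp add: mem_cells_iff_col_rows col_rows_def)
    then have "triangle n C (Suc b, j) = of_bool (j \<in> C (Suc b)) - of_bool (j \<in> C b)"
      by (simp add: triangle_def)
    with Suc show ?case by simp
  qed (simp add: C)
  ultimately show ?thesis by simp
qed

lemma col_set_triangle:
  assumes "C \<in> chains n n"
  shows "col_set n (triangle n C) = C"
proof
  fix i
  have "j \<in> C (min i (bottom_row n j)) \<longleftrightarrow> j \<in> C i" if "j \<in> {1..2 * n - 1}" for j
    using chains_frozen[OF assms that, of i] by (auto simp: min_def)
  moreover have "C 0 = {}" using assms by (simp add: chains_def)
  ultimately show "col_set n (triangle n C) i = C i"
    using chains_subset[OF assms, of i] by (auto simp: col_set_def col_sum_triangle)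
qed

lemma col_rows_iff: "i \<in> {1..n} \<Longrightarrow> j \<in> {1..2 * n - 1} \<Longrightarrow> i \<in> col_rows n j \<longleftrightarrow> j \<in> row_cols n i"
  using mem_cells_iff_row_cols[of i j n] mem_cells_iff_col_rows[of i j n] by blast

lemma triangle_in_row:
  "i \<in> {1..n} \<Longrightarrow> j \<in> row_cols n i \<Longrightarrow> triangle n C (i, j) = of_bool (j \<in> C i) - of_bool (j \<in> C (i - 1))"
  by (simp add: triangle_def mem_cells_iff_row_cols)

lemma alternating_sign_triangle_triangle:
  assumes C: "C \<in> chains n n"
  shows "alternating_sign_triangle n (triangle n C)"
proof -
  let ?T = "triangle n C"
  have "?T \<in> cells n \<rightarrow>\<^sub>E {0, 1, -1}"
    by (auto simp: triangle_def)
  moreover have "nonzero_alternate (row_cols n i) (\<lambda>j. ?T (i, j)) \<and> (\<Sum>j\<in>row_cols n i. ?T (i, j)) = 1"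
    if i: "i \<in> {1..n}" for i
  proof -
    have "row_step n i (C (i - 1)) (C i)" using C i by (auto simp: chains_def)
    then show ?thesis
      by (subst row_iff_interlaces[OF finite_row_cols triangle_in_row[OF i]]) (auto simp: row_step_def)
  qed
  moreover have "nonzero_alternate (col_rows n j) (\<lambda>i. ?T (i, j)) \<and> (\<forall>i\<in>col_rows n j.
        ?T (i, j) \<noteq> 0 \<and> (\<forall>k\<in>col_rows n j. k < i \<longrightarrow> ?T (k, j) = 0) \<longrightarrow> ?T (i, j) = 1)"
    if j: "j \<in> {1..2 * n - 1}" for j
  proof -
    have C0: "C 0 = {}" using C by (simp add: chains_def)
    have "(\<Sum>k\<in>col_rows n j \<inter> {..<J}. ?T (k, j)) \<in> {0, 1}" for J
    proof (cases J)
      case (Suc i)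
      show ?thesis unfolding Suc lessThan_Suc_atMost col_sum_triangle[where C = C, OF C0 j] by simp
    qed simp
    moreover have "\<forall>k\<in>col_rows n j. ?T (k, j) \<in> {0, 1, -1}"
      using j by (auto simp: triangle_def mem_cells_iff_col_rows)
    ultimately show ?thesis
      using alternating_of_prefix_sums[of "col_rows n j" "\<lambda>i. ?T (i, j)"] by blast
  qed
  ultimately show ?thesis
    unfolding alternating_sign_triangle_def by blast
qed


lemma col_set_chains:
  assumes T: "alternating_sign_triangle n T"
  shows "col_set n T \<in> chains n n" and "triangle n (col_set n T) = T"
proof -
  let ?C = "col_set n T"
  have cells: "T \<in> cells n \<rightarrow>\<^sub>E {0, 1, -1}"
    and rows: "\<forall>i\<in>{1..n}. nonzero_alternate (row_cols n i) (\<lambda>j. T (i, j))"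
    and cols: "\<forall>j\<in>{1..2 * n - 1}. nonzero_alternate (col_rows n j) (\<lambda>i. T (i, j))"
    and sums: "\<forall>i\<in>{1..n}. (\<Sum>j\<in>row_cols n i. T (i, j)) = 1"
    and first: "\<forall>j\<in>{1..2 * n - 1}. \<forall>i\<in>col_rows n j.
        T (i, j) \<noteq> 0 \<and> (\<forall>k\<in>col_rows n j. k < i \<longrightarrow> T (k, j) = 0) \<longrightarrow> T (i, j) = 1"
    using T unfolding alternating_sign_triangle_def by - (elim conjE, assumption)+
  have pre: "(\<Sum>k\<in>col_rows n j \<inter> {..i}. T (k, j)) = of_bool (j \<in> ?C i)" if j: "j \<in> {1..2 * n - 1}" for i j
  proof -
    have val: "\<forall>k\<in>col_rows n j. T (k, j) \<in> {0, 1, -1}"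
    proof
      fix k assume "k \<in> col_rows n j"
      with j have "(k, j) \<in> cells n" by (simp add: mem_cells_iff_col_rows)
      with cells show "T (k, j) \<in> {0, 1, -1}" by (rule PiE_mem)
    qed
    have "(\<Sum>k\<in>col_rows n j \<inter> {..i}. T (k, j)) \<in> {0, 1}"
      using prefix_sums_of_alternating[OF val bspec[OF cols j] bspec[OF first j], of "Suc i"]
      unfolding lessThan_Suc_atMost .
    then have "(\<Sum>k\<in>col_rows n j \<inter> {..i}. T (k, j)) = 0 \<or> (\<Sum>k\<in>col_rows n j \<inter> {..i}. T (k, j)) = 1"
      by simp
    then show ?thesis
      by (elim disjE) (use j in \<open>simp_all add: col_set_def\<close>)
  qed
  have entry: "T (i, j) = of_bool (j \<in> ?C i) - of_bool (j \<in> ?C (i - 1))"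
    if i: "i \<in> {1..n}" and j: "j \<in> row_cols n i" for i j
  proof -
    have j': "j \<in> {1..2 * n - 1}" using row_cols_subset[of i n] i j by auto
    then have "i \<in> col_rows n j" using i j by (simp only: col_rows_iff)
    moreover have "{..i} = insert i {..i - 1}" using i by auto
    ultimately have "col_rows n j \<inter> {..i} = insert i (col_rows n j \<inter> {..i - 1})" by simp
    moreover have "i \<notin> col_rows n j \<inter> {..i - 1}" "finite (col_rows n j \<inter> {..i - 1})" using i by auto
    ultimately have "(\<Sum>k\<in>col_rows n j \<inter> {..i}. T (k, j))
      = T (i, j) + (\<Sum>k\<in>col_rows n j \<inter> {..i - 1}. T (k, j))" by simp
    then show ?thesis unfolding pre[OF j'] by simp
  qed
  have step: "row_step n i (?C (i - 1)) (?C i)" if i: "i \<in> {1..n}" for i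
    unfolding row_step_def
  proof (intro conjI)
    show "?C (i - 1) \<subseteq> {1..2 * n - 1}" by (auto simp: col_set_def)
    have "nonzero_alternate (row_cols n i) (\<lambda>j. T (i, j)) \<and> (\<Sum>j\<in>row_cols n i. T (i, j)) = 1
        \<longleftrightarrow> interlaces (?C (i - 1) \<inter> row_cols n i) (?C i \<inter> row_cols n i)"
      by (rule row_iff_interlaces[OF finite_row_cols]) (rule entry[OF i])
    then show "interlaces (?C (i - 1) \<inter> row_cols n i) (?C i \<inter> row_cols n i)"
      using bspec[OF rows i] bspec[OF sums i] by (simp only: simp_thms)
    have frozen: "j \<in> ?C (i - 1) \<longleftrightarrow> j \<in> ?C i" if "j \<notin> row_cols n i" for j
    proof (cases "j \<in> {1..2 * n - 1}")
      case True
      then have "i \<notin> col_rows n j" using that col_rows_iff[OF i True] by simp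
      moreover have "{..i} = insert i {..i - 1}" using i by auto
      ultimately have "col_rows n j \<inter> {..i} = col_rows n j \<inter> {..i - 1}" by simp
      then show ?thesis by (simp add: col_set_def)
    qed (auto simp: col_set_def)
    show "?C (i - 1) - row_cols n i = ?C i - row_cols n i"
    proof (rule set_eqI)
      fix j show "j \<in> ?C (i - 1) - row_cols n i \<longleftrightarrow> j \<in> ?C i - row_cols n i"
        using frozen[of j] by (cases "j \<in> row_cols n i") (simp_all only: Diff_iff simp_thms)
    qed
  qed
  have zero: "?C 0 = {}" by (simp add: col_set_def col_rows_def)
  have const: "?C i = ?C n" if "n < i" for i
  proof -
    have "col_rows n j \<inter> {..i} = col_rows n j \<inter> {..n}" for j
      using that by (auto simp: col_rows_def bottom_row_def)
    then show ?thesis by (simp add: col_set_def)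
  qed
  show "?C \<in> chains n n"
    unfolding chains_def mem_Collect_eq by (intro conjI ballI allI impI zero step const)
  show "triangle n ?C = T"
  proof
    fix x :: "nat \<times> nat"
    obtain i j where x: "x = (i, j)" by force
    show "triangle n ?C x = T x"
    proof (cases "x \<in> cells n")
      case True
      then have ij: "i \<in> {1..n}" "j \<in> row_cols n i" by (simp_all add: x mem_cells_iff_row_cols)
      show ?thesis unfolding x triangle_in_row[OF ij] entry[OF ij] ..
    next
      case False
      then show ?thesis using PiE_arb[OF cells False] by (simp add: triangle_def)
    qed
  qed
qed

lemma one_column_iff:
  assumes "j \<in> {1..2 * n - 1}"
  shows "one_column n T j \<longleftrightarrow> j \<in> col_set n T n"
proof -
  have "col_rows n j \<inter> {..n} = col_rows n j" by (auto simp: col_rows_def bottom_row_def)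
  then show ?thesis using assms by (simp add: one_column_def col_set_def)
qed

text \<open>The last row is the central cell alone, and its sum 1 puts the entry 1 there.\<close>

lemma central_column:
  assumes C: "C \<in> chains n n" and n: "1 \<le> n"
  shows "n \<in> C n" "n \<notin> C (n - 1)"
proof -
  have "row_cols n n = {n}" using n by (auto simp: row_cols_def)
  moreover have "row_step n n (C (n - 1)) (C n)" using chains_step[OF C, of "n - 1"] n by simp
  ultimately have "card (C n \<inter> {n}) = card (C (n - 1) \<inter> {n}) + 1"
    by (simp add: row_step_def interlaces_def)
  then show "n \<in> C n" "n \<notin> C (n - 1)"
    by (cases "n \<in> C n"; cases "n \<in> C (n - 1)"; simp)+
qed

section \<open>Weights of chains and the statistic\<close>

definition chain_weight :: "'a::comm_ring_1 \<Rightarrow> nat \<Rightarrow> nat \<Rightarrow> (nat \<Rightarrow> nat set) \<Rightarrow> 'a" where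
  "chain_weight t n m C = (\<Prod>i\<in>{1..m}. row_weight t n i (C (i - 1)) (C i))"

text \<open>A left end has bottom entry 1 iff its column enters the chain in that row; the bottom
  entry of a right 1-column is 0 iff the column was in the chain before. In row \<open>n\<close>
  both ends are the central column, which enters there: a single factor \<open>t\<close>, the
  \<open>+ 1\<close> of \<open>rho\<close>.\<close>

lemma power_rho:
  assumes T: "alternating_sign_triangle n T" and n: "1 \<le> n"
  shows "chain_weight t n n (col_set n T) = t ^ rho n T"
proof -
  define C where "C = col_set n T"
  have C: "C \<in> chains n n" unfolding C_def by (rule col_set_chains[OF T])
  have T_row: "T (i, j) = of_bool (j \<in> C i) - of_bool (j \<in> C (i - 1))" if "i \<in> {1..n}" "j \<in> row_cols n i" for i j
    using triangle_in_row[OF that, of C] col_set_chains(2)[OF T] by (simp add: C_def)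
  have one: "one_column n T j \<longleftrightarrow> j \<in> C (bottom_row n j)" if "j \<in> {1..2 * n - 1}" for j
    using one_column_iff[OF that] chains_frozen[OF C that, of n] by (simp add: C_def bottom_row_def)
  define A where "A = {i \<in> {1..n}. i \<in> C i \<and> i \<notin> C (i - 1)}"
  define B where "B = {i \<in> {1..n}. 2 * n - i \<in> C i \<and> 2 * n - i \<in> C (i - 1)}"
  have weight: "(\<Prod>i\<in>{1..n}. if P i then t else 1) = t ^ card {i \<in> {1..n}. P i}" for P :: "nat \<Rightarrow> bool"
    by (simp add: prod.If_cases Int_def)
  have "chain_weight t n n C = t ^ card A * t ^ card B"
    unfolding chain_weight_def row_weight_def prod.distrib A_def B_def weight ..
  moreover have "card A = card {j \<in> {1..<n}. one_one_column n T j} + 1"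
  proof -
    have "one_one_column n T j \<longleftrightarrow> j \<in> C j \<and> j \<notin> C (j - 1)" if j: "j \<in> {1..<n}" for j
    proof -
      have "bottom_row n j = j" using j by (auto simp: bottom_row_def)
      moreover have "T (j, j) = of_bool (j \<in> C j) - of_bool (j \<in> C (j - 1))"
        using j by (intro T_row) (auto simp: row_cols_def)
      ultimately show ?thesis using one[of j] j by (auto simp: one_one_column_def)
    qed
    then have "{j \<in> {1..<n}. one_one_column n T j} = {j \<in> {1..<n}. j \<in> C j \<and> j \<notin> C (j - 1)}" by blast
    moreover have "A = insert n {j \<in> {1..<n}. j \<in> C j \<and> j \<notin> C (j - 1)}"
      using central_column[OF C n] n by (auto simp: A_def le_less)
    ultimately show ?thesis by simp
  qed
  moreover have "card B = card {j \<in> {n<..2 * n - 1}. one_zero_column n T j}"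
  proof (rule bij_betw_same_card)
    show "bij_betw (\<lambda>i. 2 * n - i) B {j \<in> {n<..2 * n - 1}. one_zero_column n T j}"
    proof (rule bij_betw_byWitness[where f' = "\<lambda>j. 2 * n - j"])
      have iff: "one_zero_column n T (2 * n - i) \<longleftrightarrow> 2 * n - i \<in> C i \<and> 2 * n - i \<in> C (i - 1)"
        if i: "i \<in> {1..<n}" for i
      proof -
        have "bottom_row n (2 * n - i) = i" using i by (auto simp: bottom_row_def)
        moreover have "T (i, 2 * n - i) = of_bool (2 * n - i \<in> C i) - of_bool (2 * n - i \<in> C (i - 1))"
          using i by (intro T_row) (auto simp: row_cols_def)
        moreover have "2 * n - i \<in> {1..2 * n - 1}" using i by auto
        ultimately show ?thesis using one[of "2 * n - i"] by (auto simp: one_zero_column_def)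
      qed
      have less: "i < n" if "i \<in> B" for i
      proof (rule ccontr)
        assume "\<not> i < n"
        with that have "i = n" by (simp add: B_def)
        with that central_column(2)[OF C n] show False by (simp add: B_def)
      qed
      show "\<forall>i\<in>B. 2 * n - (2 * n - i) = i" by (auto simp: B_def)
      show "\<forall>j\<in>{j \<in> {n<..2 * n - 1}. one_zero_column n T j}. 2 * n - (2 * n - j) = j" by auto
      show "(\<lambda>i. 2 * n - i) ` B \<subseteq> {j \<in> {n<..2 * n - 1}. one_zero_column n T j}"
      proof safe
        fix i assume i: "i \<in> B"
        then have "i \<in> {1..<n}" using less by (simp add: B_def)
        with iff[OF this] i show "2 * n - i \<in> {n<..2 * n - 1}" "one_zero_column n T (2 * n - i)"
          by (auto simp: B_def)
      qed
      show "(\<lambda>j. 2 * n - j) ` {j \<in> {n<..2 * n - 1}. one_zero_column n T j} \<subseteq> B"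
      proof safe
        fix j assume j: "j \<in> {n<..2 * n - 1}" "one_zero_column n T j"
        then have "2 * n - j \<in> {1..<n}" "2 * n - (2 * n - j) = j" by auto
        with iff[of "2 * n - j"] j show "2 * n - j \<in> B" by (auto simp: B_def)
      qed
    qed
  qed
  ultimately show ?thesis
    by (simp add: rho_def C_def power_add ac_simps)
qed

lemma chains_const:
  assumes "C \<in> chains n m"
  shows "C (min i m) = C i"
proof (cases "m < i")
  case True
  moreover have "\<forall>i>m. C i = C m" using assms by (simp add: chains_def)
  ultimately show ?thesis by (simp add: min_def)
qed simp

lemma chainsI:
  assumes "C 0 = {}" "\<And>i. i < m \<Longrightarrow> row_step n (Suc i) (C i) (C (Suc i))" "\<And>i. m < i \<Longrightarrow> C i = C m"
  shows "C \<in> chains n m"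
proof -
  have "row_step n i (C (i - 1)) (C i)" if "i \<in> {1..m}" for i
  proof -
    have "i - 1 < m" "Suc (i - 1) = i" using that by auto
    with assms(2)[of "i - 1"] show ?thesis by simp
  qed
  with assms(1,3) show ?thesis
    unfolding chains_def mem_Collect_eq by (intro conjI ballI allI impI)
qed

lemma chains_0: "C \<in> chains n m \<Longrightarrow> C 0 = {}"
  by (simp add: chains_def)

lemma chains_Suc_bij:
  "bij_betw (\<lambda>(S', C) i. if i \<le> m then C i else S)
     (SIGMA S':{S'. row_step n (Suc m) S' S}. {C \<in> chains n m. C m = S'})
     {C \<in> chains n (Suc m). C (Suc m) = S}"
proof (rule bij_betw_byWitness[where f' = "\<lambda>C. (C m, \<lambda>i. C (min i m))"])
  let ?ext = "\<lambda>(S', C) i. if i \<le> m then C i else S"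
  let ?X = "SIGMA S':{S'. row_step n (Suc m) S' S}. {C \<in> chains n m. C m = S'}"
  show "\<forall>x\<in>?X. (?ext x m, \<lambda>i. ?ext x (min i m)) = x"
  proof
    fix x assume "x \<in> ?X"
    then obtain C where "x = (C m, C)" "C \<in> chains n m" by auto
    then show "(?ext x m, \<lambda>i. ?ext x (min i m)) = x" by (simp add: chains_const)
  qed
  show "\<forall>C\<in>{C \<in> chains n (Suc m). C (Suc m) = S}. ?ext (C m, \<lambda>i. C (min i m)) = C"
  proof
    fix C assume C: "C \<in> {C \<in> chains n (Suc m). C (Suc m) = S}"
    show "?ext (C m, \<lambda>i. C (min i m)) = C"
    proof
      fix i
      have "C i = S" if "\<not> i \<le> m"
        using chains_const[of C n "Suc m" i] C that by (simp add: min_absorb2)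
      then show "?ext (C m, \<lambda>i. C (min i m)) i = C i" by (simp add: min_absorb1)
    qed
  qed
  show "?ext ` ?X \<subseteq> {C \<in> chains n (Suc m). C (Suc m) = S}"
  proof
    fix D assume "D \<in> ?ext ` ?X"
    then obtain C where D: "D = (\<lambda>i. if i \<le> m then C i else S)" and C: "C \<in> chains n m"
      and rs: "row_step n (Suc m) (C m) S" by auto
    have "D \<in> chains n (Suc m)"
    proof (rule chainsI)
      show "D 0 = {}" by (simp add: D chains_0[OF C])
      fix i assume i: "i < Suc m"
      show "row_step n (Suc i) (D i) (D (Suc i))"
      proof (cases "i = m")
        case False
        with i chains_step[OF C, of i] show ?thesis by (simp add: D)
      qed (use rs in \<open>simp add: D\<close>)
    qed (simp add: D)
    then show "D \<in> {C \<in> chains n (Suc m). C (Suc m) = S}" by (simp add: D)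
  qed
  show "(\<lambda>C. (C m, \<lambda>i. C (min i m))) ` {C \<in> chains n (Suc m). C (Suc m) = S} \<subseteq> ?X"
  proof
    fix x assume "x \<in> (\<lambda>C. (C m, \<lambda>i. C (min i m))) ` {C \<in> chains n (Suc m). C (Suc m) = S}"
    then obtain C where C: "C \<in> chains n (Suc m)" "S = C (Suc m)" and x: "x = (C m, \<lambda>i. C (min i m))"
      by auto
    have "(\<lambda>i. C (min i m)) \<in> chains n m"
    proof (rule chainsI)
      fix i assume "i < m"
      with chains_step[OF C(1), of i] show "row_step n (Suc i) (C (min i m)) (C (min (Suc i) m))"
        by (simp add: min_absorb1)
    qed (simp_all add: chains_0[OF C(1)] min_absorb2)
    moreover have "row_step n (Suc m) (C m) S"
      unfolding C(2) by (rule chains_step[OF C(1)]) simp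
    ultimately show "x \<in> ?X" by (simp add: x)
  qed
qed

lemma finite_row_step: "finite {S'. row_step n i S' S}"
  by (rule finite_subset[of _ "Pow {1..2 * n - 1}"]) (auto simp: row_step_def)

lemma chains_zero: "chains n 0 = {\<lambda>_. {}}"
proof -
  have "C = (\<lambda>_. {})" if "C \<in> chains n 0" for C
    using chains_const[OF that] chains_0[OF that] by (simp add: fun_eq_iff)
  moreover have "(\<lambda>_. {}) \<in> chains n 0" by (simp add: chains_def)
  ultimately show ?thesis by blast
qed

lemma finite_chains: "finite {C \<in> chains n m. C m = S}"
proof (induction m arbitrary: S)
  case 0
  have "{C \<in> chains n 0. C 0 = S} \<subseteq> {\<lambda>_. {}}"
    by (simp add: chains_zero subset_iff)
  then show ?case by (rule finite_subset) simp
next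
  case (Suc m)
  show ?case
    unfolding bij_betw_finite[OF chains_Suc_bij, symmetric]
    by (intro finite_SigmaI finite_row_step Suc.IH)
qed

lemma sum_chain_weight:
  "(\<Sum>C\<in>{C \<in> chains n m. C m = S}. chain_weight t n m C) = chain_count t n m S"
proof (induction m arbitrary: S)
  case 0
  have "{C \<in> chains n 0. C 0 = S} = (if S = {} then {\<lambda>_. {}} else {})"
    unfolding chains_zero by auto
  then show ?case by (simp add: chain_weight_def)
next
  case (Suc m)
  let ?X = "SIGMA S':{S'. row_step n (Suc m) S' S}. {C \<in> chains n m. C m = S'}"
  have "(\<Sum>C\<in>{C \<in> chains n (Suc m). C (Suc m) = S}. chain_weight t n (Suc m) C)
     = (\<Sum>(S', C)\<in>?X. chain_weight t n (Suc m) (\<lambda>i. if i \<le> m then C i else S))"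
    by (simp add: sum.reindex_bij_betw[OF chains_Suc_bij, symmetric] case_prod_unfold)
  also have "\<dots> = (\<Sum>(S', C)\<in>?X. row_weight t n (Suc m) S' S * chain_weight t n m C)"
  proof (intro sum.cong refl, clarify)
    fix C assume "C \<in> chains n m"
    have "(\<Prod>i = 1..m. row_weight t n i (if i - 1 \<le> m then C (i - 1) else S) (if i \<le> m then C i else S))
        = chain_weight t n m C"
      unfolding chain_weight_def by (intro prod.cong) auto
    then show "chain_weight t n (Suc m) (\<lambda>i. if i \<le> m then C i else S)
        = row_weight t n (Suc m) (C m) S * chain_weight t n m C"
      by (simp add: chain_weight_def mult.commute)
  qed
  also have "\<dots> = (\<Sum>S'\<in>{S'. row_step n (Suc m) S' S}. \<Sum>C\<in>{C \<in> chains n m. C m = S'}.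
      row_weight t n (Suc m) S' S * chain_weight t n m C)"
    by (rule sum.Sigma[symmetric]) (auto intro: finite_row_step finite_chains)
  also have "\<dots> = chain_count t n (Suc m) S"
    by (simp add: Suc.IH flip: sum_distrib_left)
  finally show ?case .
qed

lemma sum_power_rho:
  assumes "1 \<le> n"
  shows "(\<Sum>T\<in>{T. alternating_sign_triangle n T \<and> col_set n T n = S}. t ^ rho n T) = chain_count t n n S"
proof -
  have "bij_betw (col_set n) {T. alternating_sign_triangle n T \<and> col_set n T n = S} {C \<in> chains n n. C n = S}"
    by (rule bij_betw_byWitness[where f' = "triangle n"])
      (auto simp: col_set_chains col_set_triangle alternating_sign_triangle_triangle)
  then have "(\<Sum>T\<in>{T. alternating_sign_triangle n T \<and> col_set n T n = S}. chain_weight t n n (col_set n T))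
      = (\<Sum>C\<in>{C \<in> chains n n. C n = S}. chain_weight t n n C)"
    by (rule sum.reindex_bij_betw)
  also have "\<dots> = chain_count t n n S"
    by (rule sum_chain_weight)
  also have "(\<Sum>T\<in>{T. alternating_sign_triangle n T \<and> col_set n T n = S}. chain_weight t n n (col_set n T))
      = (\<Sum>T\<in>{T. alternating_sign_triangle n T \<and> col_set n T n = S}. t ^ rho n T)"
    by (intro sum.cong refl) (simp add: power_rho[OF _ assms])
  finally show ?thesis .
qed

text \<open>The last row has one cell, so \<open>S\<close> is the only predecessor; its two ends
  coincide in an entering column, which gives a single \<open>t\<close>.\<close>

lemma chain_count_last:
  assumes "S \<subseteq> {1..2 * Suc m - 1}" "Suc m \<notin> S"
  shows "chain_count t (Suc m) (Suc m) (insert (Suc m) S) = t * chain_count t (Suc m) m S"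
proof -
  let ?n = "Suc m"
  have I: "row_cols ?n ?n = {?n}" by (auto simp: row_cols_def)
  have "row_step ?n ?n S' (insert ?n S) \<longleftrightarrow> S' = S" for S'
  proof
    assume rs: "row_step ?n ?n S' (insert ?n S)"
    then have "card (S' \<inter> {?n}) = 0" by (simp add: row_step_def interlaces_def I)
    then have "?n \<notin> S'" by (cases "?n \<in> S'") auto
    moreover have "S' - {?n} = S" using rs assms(2) by (simp add: row_step_def I)
    ultimately show "S' = S" by simp
  next
    assume "S' = S"
    moreover have "card ({?n} \<inter> {..J}) \<le> 1" for J using card_mono[of "{?n}" "{?n} \<inter> {..J}"] by simp
    ultimately show "row_step ?n ?n S' (insert ?n S)"
      using assms by (auto simp: row_step_def I interlaces_def)
  qed
  then have "{S'. row_step ?n ?n S' (insert ?n S)} = {S}" by auto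
  then show ?thesis
    using assms(2) by (simp add: row_weight_def)
qed

section \<open>The generating function\<close>

fun pairs :: "('i \<Rightarrow> 'i \<Rightarrow> 'r::comm_ring_1) \<Rightarrow> 'i list \<Rightarrow> 'r" where
  "pairs f [] = 1"
| "pairs f (v # vs) = (\<Prod>w\<leftarrow>vs. f v w) * pairs f vs"

lemma G_eq_pairs: "G vs = pairs K vs"
  by (induction vs) simp_all

lemma pairs_mult: "pairs (\<lambda>v w. f v w * g v w) vs = pairs f vs * pairs g vs"
  by (induction vs) (simp_all add: prod_list_map_mult ac_simps)

lemma pairs_both: "pairs (\<lambda>v w. f v * f w) vs = (\<Prod>v\<leftarrow>vs. f v ^ (length vs - 1))"
proof (induction vs)
  case (Cons v vs)
  have "(\<Prod>w\<leftarrow>vs. f v * f w) = f v ^ length vs * (\<Prod>w\<leftarrow>vs. f w)"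
    by (simp add: prod_list_map_mult map_replicate_const)
  moreover have "(\<Prod>w\<leftarrow>vs. f w) * (\<Prod>w\<leftarrow>vs. f w ^ (length vs - 1)) = (\<Prod>w\<leftarrow>vs. f w ^ length vs)"
    by (cases vs) (simp_all add: prod_list_map_mult ac_simps)
  ultimately show ?case
    by (simp add: Cons.IH mult.assoc)
qed simp

lemma pairs_upt: "pairs f [a..<b] = (\<Prod>(i, j)\<in>{(i, j). a \<le> i \<and> i < j \<and> j < b}. f i j)"
proof (induction "b - a" arbitrary: a)
  case 0
  then have empty: "{(i, j). a \<le> i \<and> i < j \<and> j < b} = {}" by auto
  show ?case unfolding empty using 0 by simp
next
  case (Suc d)
  then have ab: "a < b" by simp
  let ?P = "{(i, j). Suc a \<le> i \<and> i < j \<and> j < b}"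
  have fin: "finite ?P" by (rule finite_subset[of _ "{..b} \<times> {..b}"]) auto
  have "{(i, j). a \<le> i \<and> i < j \<and> j < b} = Pair a ` {Suc a..<b} \<union> ?P" by force
  then have "(\<Prod>(i, j)\<in>{(i, j). a \<le> i \<and> i < j \<and> j < b}. f i j)
    = (\<Prod>(i, j)\<in>Pair a ` {Suc a..<b}. f i j) * (\<Prod>(i, j)\<in>?P. f i j)"
    using fin by (simp only:) (intro prod.union_disjoint, auto)
  also have "(\<Prod>(i, j)\<in>Pair a ` {Suc a..<b}. f i j) = (\<Prod>w\<leftarrow>[Suc a..<b]. f a w)"
    by (subst prod.reindex) (auto simp: inj_on_def prod.distinct_set_conv_list[symmetric])
  also have "(\<Prod>(i, j)\<in>?P. f i j) = pairs f [Suc a..<b]"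
    using Suc by (intro Suc.hyps(1)[symmetric]) auto
  finally show ?case using ab by (simp add: upt_conv_Cons)
qed

section \<open>The substitution \<open>X = U\<close>\<close>

definition KX :: "nat \<Rightarrow> nat \<Rightarrow> 'a::comm_ring_1 laurent" where
  "KX v w = (1 + U v + U v * U w) * (U w - U v)"

lemma K_eq_KX: "K v w = KX v w * (Y v * Y w)"
proof -
  have eq: "(1 + U v + U v * U w) * (Y v * Y w) = 1 + Y w + Y v * Y w"
    using cancel_U by (simp add: algebra_simps)
  show ?thesis unfolding K_def KX_def eq[symmetric] by (simp only: ac_simps)
qed

text \<open>The indeterminate \<open>t\<close> goes into the coefficient ring, and
  \<open>X_ind i\<close> becomes \<open>U i\<close>, hence the negated exponents.\<close>

definition monomial_laurent :: "monomial \<Rightarrow> int poly laurent" where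
  "monomial_laurent k = cst (monom 1 (lookup k T_ind)) *
     Poly_Mapping.single (Poly_Mapping.map (\<lambda>e. - int e) (Poly_Mapping.map_key X_ind k)) 1"

definition to_laurent :: "mpoly_int \<Rightarrow> int poly laurent" where
  "to_laurent = pm_eval of_int monomial_laurent"

lemma lookup_exponents:
  "lookup (Poly_Mapping.map (\<lambda>e. - int e) (Poly_Mapping.map_key X_ind k)) i = - int (lookup k (X_ind i))"
proof -
  have "inj X_ind" by (simp add: inj_def)
  then show ?thesis by (simp add: map.rep_eq map_key.rep_eq when_def)
qed

lemma pm_hom_to_laurent: "pm_hom (of_int :: int \<Rightarrow> int poly laurent) monomial_laurent"
proof
  fix k l :: monomial
  have "Poly_Mapping.map (\<lambda>e. - int e) (Poly_Mapping.map_key X_ind (k + l)) =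
    Poly_Mapping.map (\<lambda>e. - int e) (Poly_Mapping.map_key X_ind k) +
    Poly_Mapping.map (\<lambda>e. - int e) (Poly_Mapping.map_key X_ind l)"
    by (rule poly_mapping_eqI) (simp add: lookup_exponents lookup_add)
  then show "monomial_laurent (k + l) = monomial_laurent k * monomial_laurent l"
    by (simp add: monomial_laurent_def cst_def mult_single lookup_add mult_monom)
  have "Poly_Mapping.map (\<lambda>e. - int e) (Poly_Mapping.map_key X_ind 0) = 0"
    by (rule poly_mapping_eqI) (simp add: lookup_exponents)
  then show "monomial_laurent 0 = 1"
    by (simp add: monomial_laurent_def cst_def mult_single monom_0 flip: one_pCons)
qed simp_all

lemmas to_laurent_hom = pm_hom.eval_hom[OF pm_hom_to_laurent, folded to_laurent_def]

lemma to_laurent_var: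
  "to_laurent poly_t = cst [:0, 1:]" "to_laurent (poly_X i) = U i"
proof -
  have s: "to_laurent (poly_var v) = monomial_laurent (Poly_Mapping.single v 1)" for v
    using pm_hom.eval_single[OF pm_hom_to_laurent] by (simp add: to_laurent_def poly_var_def)
  have "Poly_Mapping.map (\<lambda>e. - int e) (Poly_Mapping.map_key X_ind (Poly_Mapping.single T_ind 1)) = 0"
    by (rule poly_mapping_eqI) (simp add: lookup_exponents lookup_single)
  then show "to_laurent poly_t = cst [:0, 1:]"
    by (simp add: s monomial_laurent_def monom_Suc monom_0 flip: single_one)
  have "Poly_Mapping.map (\<lambda>e. - int e) (Poly_Mapping.map_key X_ind (Poly_Mapping.single (X_ind i) 1))
      = Poly_Mapping.single i (- 1)"
    by (rule poly_mapping_eqI) (simp add: lookup_exponents lookup_single when_def)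
  then show "to_laurent (poly_X i) = U i"
    by (simp add: s monomial_laurent_def lookup_single monom_0 U_def cst_hom flip: one_pCons)
qed

text \<open>Multiplying by the powers of \<open>Y\<close> moves the wanted monomial in the
  \<open>U\<close> to exponent 0. The constant term is still a polynomial in \<open>t\<close>, from
  which \<open>coeff\<close> takes the remaining exponent.\<close>

lemma ct_to_laurent:
  "coeff (ct (to_laurent p * (\<Prod>i\<leftarrow>[1..<n]. Y i ^ js i))) k = lookup p (ast_monomial n js k)"
proof (induction p rule: poly_mapping_single_induct)
  case (single l a)
  define J :: "nat \<Rightarrow>\<^sub>0 int" where "J = (\<Sum>i\<leftarrow>[1..<n]. Poly_Mapping.single i (int (js i)))"
  have Ypow: "Y i ^ e = (Poly_Mapping.single (Poly_Mapping.single i (int e)) 1 :: int poly laurent)" for i e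
    by (induction e) (simp_all add: Y_def mult_single single_add[symmetric] algebra_simps)
  have "(\<Prod>i\<leftarrow>vs. Y i ^ js i) = (Poly_Mapping.single (\<Sum>i\<leftarrow>vs. Poly_Mapping.single i (int (js i))) 1 :: int poly laurent)" for vs
    by (induction vs) (simp_all add: Ypow mult_single)
  then have J: "(\<Prod>i\<leftarrow>[1..<n]. Y i ^ js i) = (Poly_Mapping.single J 1 :: int poly laurent)"
    by (simp add: J_def)
  have lookup_J: "lookup J i = (if i \<in> {1..n - 1} then int (js i) else 0)" for i
  proof -
    have "J = (\<Sum>i\<in>{1..n - 1}. Poly_Mapping.single i (int (js i)))"
      unfolding J_def by (subst sum.distinct_set_conv_list[symmetric]) (auto intro!: sum.cong)
    then show ?thesis by (simp add: lookup_sum lookup_single when_def)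
  qed
  let ?E = "Poly_Mapping.map (\<lambda>e. - int e) (Poly_Mapping.map_key X_ind l)"
  have lookup_M: "lookup (ast_monomial n js k) v = (case v of T_ind \<Rightarrow> k | X_ind i \<Rightarrow> if i \<in> {1..n - 1} then js i else 0)" for v
    by (simp add: ast_monomial_def lookup_add lookup_sum lookup_single when_def split: indet.split)
  have "l = ast_monomial n js k \<longleftrightarrow> lookup l T_ind = k \<and> ?E + J = 0"
  proof -
    have "?E + J = 0 \<longleftrightarrow> (\<forall>i. lookup l (X_ind i) = (if i \<in> {1..n - 1} then js i else 0))"
      by (simp add: poly_mapping_eq_iff fun_eq_iff lookup_add lookup_exponents lookup_J) auto
    moreover have "l = ast_monomial n js k \<longleftrightarrow> (\<forall>v. lookup l v = lookup (ast_monomial n js k) v)"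
      by (auto intro: poly_mapping_eqI)
    moreover have "(\<forall>v. P v) \<longleftrightarrow> P T_ind \<and> (\<forall>i. P (X_ind i))" for P
      by (metis indet.exhaust)
    ultimately show ?thesis by (simp add: lookup_M)
  qed
  moreover have "to_laurent (Poly_Mapping.single l a) * (\<Prod>i\<leftarrow>[1..<n]. Y i ^ js i)
     = cst (of_int a * monom 1 (lookup l T_ind)) * Poly_Mapping.single (?E + J) 1"
  proof -
    have "of_int a = cst (of_int a :: int poly)" by (simp add: cst_def)
    then show ?thesis
      unfolding J using pm_hom.eval_single[OF pm_hom_to_laurent, of l a]
      by (simp add: to_laurent_def monomial_laurent_def cst_hom mult.assoc mult_single)
  qed
  ultimately show ?case
    by (simp add: ct_cst_mult) (auto simp: ct_def lookup_single when_def of_int_poly)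
qed (simp add: to_laurent_hom lookup_add distrib_right)

lemma ev_monom: "ev (monom 1 e) x = x ^ e"
  by (induction e) (simp_all add: monom_0 monom_Suc ev_pCons ev_0 cst_hom)

lemma tst_map2:
  assumes "length vs = length cs"
    and "\<And>v c. v \<in> set vs \<Longrightarrow> c \<in> set cs \<Longrightarrow> ev (h c) (f v) * g v = F v c"
  shows "tst f vs (map h cs) * (\<Prod>v\<leftarrow>vs. g v) = prod_list (map2 F vs cs)"
  using assms
proof (induction vs cs rule: list_induct2)
  case (Cons v vs c cs)
  then have "ev (h c) (f v) * g v = F v c" "tst f vs (map h cs) * (\<Prod>v\<leftarrow>vs. g v) = prod_list (map2 F vs cs)"
    by simp_all
  then show ?case by (simp add: ac_simps flip: mult.assoc)
qed simp

lemma map2_fun_eq: "length vs = length cs \<Longrightarrow> map g cs = map js vs \<Longrightarrow>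
  map2 (\<lambda>v c. F v (g c)) vs cs = map (\<lambda>v. F v (js v)) vs"
  by (induction vs cs rule: list_induct2) simp_all

lemma U_Y_power: "U v ^ a * Y v ^ a = 1"
  by (simp flip: power_mult_distrib)

text \<open>For \<open>m = n - 1\<close> the factor \<open>Y v ^ (m - 1)\<close> is the share of
  \<open>v\<close> in the change of kernel, and the remaining exponent \<open>c - 1\<close> is the
  position of a column left of the centre.\<close>

lemma ev_left_test:
  assumes "1 \<le> c" "c \<le> m"
  shows "ev (left_test t m c) (U v) * Y v ^ (m - 1) = (cst t + U v) * Y v ^ (c - 1)"
proof -
  have "m - 1 = (m - c) + (c - 1)" using assms by simp
  then have "U v ^ (m - c) * Y v ^ (m - 1) = (U v ^ (m - c) * Y v ^ (m - c)) * (Y v ^ (c - 1) :: 'a laurent)"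
    by (simp only: power_add mult.assoc)
  then show ?thesis
    by (simp add: left_test_def ev_mult ev_monom ev_pCons ev_0 cst_hom U_Y_power mult.assoc del: mult_pCons_left)
qed

text \<open>The power of \<open>zz\<close> is trivial here, its exponent being
  \<open>2 * (n - Suc (n - 1)) = 0\<close>. Pulling \<open>Y\<close> out of \<open>1 + t Y\<close>
  gives the same factor \<open>t + U\<close> as on the left, and this extra \<open>Y\<close>
  completes the exponent to the position \<open>c - 2\<close>.\<close>

lemma ev_right_test:
  assumes "Suc n \<le> c" "2 \<le> n"
  shows "ev (right_test t n (n - 1) c) (Y v) * Y v ^ (n - 1 - 1) = (cst t + U v) * Y v ^ (c - 2)"
proof -
  have "c - 2 = Suc ((c - Suc n) + (n - 1 - 1))" using assms by simp
  then have "(cst t + U v) * Y v ^ (c - 2) = ((cst t + U v) * Y v) * (Y v ^ (c - Suc n) * Y v ^ (n - 1 - 1))"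
    by (simp only: power_Suc power_add mult.assoc)
  also have "(cst t + U v) * Y v = 1 + Y v * cst t"
    by (simp add: algebra_simps)
  finally show ?thesis
    using assms by (simp add: right_test_def ev_mult ev_monom ev_pCons ev_0 cst_hom mult.assoc Suc_diff_Suc del: mult_pCons_left)
qed

text \<open>Each kernel factor releases \<open>Y v * Y w\<close>, and every variable occurs in
  \<open>length vs - 1\<close> pairs.\<close>

lemma pairs_K: "pairs K vs = pairs KX vs * (\<Prod>v\<leftarrow>vs. Y v ^ (length vs - 1) :: 'a::comm_ring_1 laurent)"
proof -
  have "(K :: nat \<Rightarrow> nat \<Rightarrow> 'a laurent) = (\<lambda>v w. KX v w * (Y v * Y w))"
    by (intro ext) (rule K_eq_KX)
  then have "pairs K vs = pairs (\<lambda>v w. KX v w * (Y v * Y w) :: 'a laurent) vs"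
    by (rule arg_cong)
  then show ?thesis by (simp only: pairs_mult[of KX "\<lambda>v w. Y v * Y w"] pairs_both)
qed

lemma to_laurent_ast_poly:
  "to_laurent (ast_poly n) = (\<Prod>i\<leftarrow>[1..<n]. cst [:0, 1:] + U i) * pairs KX [1..<n]"
proof -
  have P: "{(i, j). 1 \<le> i \<and> i < j \<and> j \<le> n - 1} = {(i, j). 1 \<le> i \<and> i < j \<and> j < n}" by auto
  have "to_laurent (ast_poly n) = (\<Prod>i\<in>{1..n - 1}. cst [:0, 1:] + U i) *
     (\<Prod>(i, j)\<in>{(i, j). 1 \<le> i \<and> i < j \<and> j < n}. KX i j)"
    unfolding ast_poly_def P
    by (simp add: to_laurent_hom to_laurent_var case_prod_unfold KX_def)
  also have "(\<Prod>i\<in>{1..n - 1}. cst [:0, 1:] + U i) = (\<Prod>i\<leftarrow>[1..<n]. cst [:0, 1:] + U i :: int poly laurent)"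
    by (subst prod.distinct_set_conv_list[symmetric]) (auto intro!: prod.cong)
  finally show ?thesis by (simp only: pairs_upt)
qed

text \<open>The central column is not in \<open>S\<close>, so no middle column remains. Each
  variable, left or right, contributes \<open>t + U\<close>, the factor \<open>t + X\<close> of the
  polynomial, and the power of \<open>Y\<close> that extracts its exponent.\<close>

lemma row_value_last:
  assumes n: "1 \<le> n" and S: "S \<subseteq> noncentral_columns n"
    and js: "map (column_position n) (sorted_list_of_set S) = map js [1..<n]"
  shows "row_value [:0, 1:] n (n - 1) S = ct (to_laurent (ast_poly n) * (\<Prod>i\<leftarrow>[1..<n]. Y i ^ js i))"
proof -
  let ?t = "[:0, 1 :: int:]" and ?sl = sorted_list_of_set
  define cL where "cL = ?sl (S \<inter> {..n - 1})"
  define cR where "cR = ?sl (S \<inter> {Suc n..})"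
  have fin: "finite (S \<inter> X)" for X
    using S finite_subset[of S "{1..2 * n - 1}"] by (auto simp: noncentral_columns_def)
  have nS: "n \<notin> S" and S1: "S \<subseteq> {1..2 * n - 1}" using S by (auto simp: noncentral_columns_def)
  have "S = (S \<inter> {..n - 1}) \<union> (S \<inter> {Suc n..})"
  proof (intro equalityI subsetI)
    fix c assume "c \<in> S"
    with nS have "c < n \<or> n < c" by (metis linorder_neqE_nat)
    with \<open>c \<in> S\<close> show "c \<in> (S \<inter> {..n - 1}) \<union> (S \<inter> {Suc n..})" by auto
  qed auto
  then have sl: "?sl S = cL @ cR"
    unfolding cL_def cR_def using sorted_list_of_set_Un[OF fin fin, of "{..n - 1}" "{Suc n..}"] by fastforce
  define L where "L = [1..<1 + length cL]"
  define R where "R = [1 + length cL..<n]"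
  have len: "length (cL @ cR) = n - 1"
    using arg_cong[OF js, of length] by (simp add: sl)
  then have n': "n = (1 + length cL) + length cR" using n by simp
  have "L @ R = [1..<n]"
    using upt_add_eq_append[of 1 "1 + length cL" "length cR"] unfolding L_def R_def n'[symmetric] by simp
  moreover have "length L = length cL" by (simp only: L_def length_upt diff_add_inverse)
  moreover have "length R = length cR" using n' unfolding R_def length_upt by linarith
  ultimately have LR: "L @ R = [1..<n]" "length L = length cL" "length R = length cR" .
  have mid: "S \<inter> {Suc (n - 1)..2 * n - Suc (n - 1)} = {}" and right: "2 * n - (n - 1) = Suc n"
    using n nS by (auto dest: le_antisym)
  have "row_value ?t n (n - 1) S = Phi (map (left_test ?t (n - 1)) cL) (map (right_test ?t n (n - 1)) cR)"
    by (simp only: row_value_def mid right cL_def cR_def sorted_list_of_set_empty list.map append_Nil)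
  also have "\<dots> = Psi L R (map (left_test ?t (n - 1)) cL) (map (right_test ?t n (n - 1)) cR)"
    by (rule Phi_eq_Psi) (simp_all add: LR)
  also have "\<dots> = ct (pairs KX [1..<n] * ((tst U L (map (left_test ?t (n - 1)) cL) * (\<Prod>v\<leftarrow>L. Y v ^ (n - 1 - 1)))
      * (tst Y R (map (right_test ?t n (n - 1)) cR) * (\<Prod>v\<leftarrow>R. Y v ^ (n - 1 - 1)))))"
  proof -
    have prod: "(\<Prod>v\<leftarrow>[1..<n]. f v) = (\<Prod>v\<leftarrow>L. f v) * (\<Prod>v\<leftarrow>R. f v)" for f :: "nat \<Rightarrow> int poly laurent"
      by (simp only: LR(1)[symmetric] map_append prod_list.append)
    show ?thesis
      unfolding Psi_def LR(1) G_eq_pairs pairs_K length_upt prod by (simp only: ac_simps)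
  qed
  also have "tst U L (map (left_test ?t (n - 1)) cL) * (\<Prod>v\<leftarrow>L. Y v ^ (n - 1 - 1))
    = prod_list (map2 (\<lambda>v c. (cst ?t + U v) * Y v ^ column_position n c) L cL)"
  proof (rule tst_map2[OF LR(2)])
    fix v c assume "c \<in> set cL"
    then have c: "1 \<le> c" "c \<le> n - 1" using S1 fin by (auto simp: cL_def)
    then have "column_position n c = c - 1" by (simp add: column_position_def)
    with ev_left_test[OF c] show "ev (left_test ?t (n - 1) c) (U v) * Y v ^ (n - 1 - 1)
      = (cst ?t + U v) * Y v ^ column_position n c" by simp
  qed
  also have "tst Y R (map (right_test ?t n (n - 1)) cR) * (\<Prod>v\<leftarrow>R. Y v ^ (n - 1 - 1))
    = prod_list (map2 (\<lambda>v c. (cst ?t + U v) * Y v ^ column_position n c) R cR)"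
  proof (rule tst_map2[OF LR(3)])
    fix v c assume "c \<in> set cR"
    then have c: "Suc n \<le> c" "2 \<le> n" using S1 fin by (fastforce simp: cR_def)+
    then have "column_position n c = c - 2" by (simp add: column_position_def)
    with ev_right_test[OF c] show "ev (right_test ?t n (n - 1) c) (Y v) * Y v ^ (n - 1 - 1)
      = (cst ?t + U v) * Y v ^ column_position n c" by simp
  qed
  also have "prod_list (map2 (\<lambda>v c. (cst ?t + U v) * Y v ^ column_position n c) L cL) *
      prod_list (map2 (\<lambda>v c. (cst ?t + U v) * Y v ^ column_position n c) R cR)
    = prod_list (map2 (\<lambda>v c. (cst ?t + U v) * Y v ^ column_position n c) (L @ R) (cL @ cR))"
    using LR(2) by simp
  also have "map2 (\<lambda>v c. (cst ?t + U v) * Y v ^ column_position n c) (L @ R) (cL @ cR)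
    = map (\<lambda>v. (cst ?t + U v) * Y v ^ js v) [1..<n]"
    unfolding LR(1)
    using js len by (intro map2_fun_eq) (simp_all add: sl)
  finally show ?thesis
    by (simp add: to_laurent_ast_poly prod_list_map_mult ac_simps)
qed

theorem theorem5p1:
  fixes n r :: nat and js :: "nat \<Rightarrow> nat"
  assumes "n \<ge> 1" and "1 \<le> r" and "r \<le> n"
    and "strict_mono_on {1..n - 1} js"
    and "\<forall>i\<in>{1..n - 1}. js i \<le> 2 * n - 3"
  shows "int (card {T. alternating_sign_triangle n T
                      \<and> one_column_positions n T = js ` {1..n - 1}
                      \<and> rho n T = r})
         = Poly_Mapping.lookup (ast_poly n) (ast_monomial n js (r - 1))"
proof -
  let ?J = "js ` {1..n - 1}" and ?t = "[:0, 1 :: int:]"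
  define S where "S = {j \<in> noncentral_columns n. column_position n j \<in> ?J}"
  note bij = bij_betw_column_position[of n]
  have inj: "inj_on (column_position n) (noncentral_columns n)" using bij by (rule bij_betw_imp_inj_on)
  have S: "S \<subseteq> noncentral_columns n" by (auto simp: S_def)
  then have S1: "S \<subseteq> {1..2 * n - 1}" and nS: "n \<notin> S" by (auto simp: noncentral_columns_def)
  have finS: "finite S" using S1 finite_subset by blast
  \<comment> \<open>An index \<open>i\<close> exists only for \<open>2 \<le> n\<close>, so
    \<open>2 * n - 3\<close> is not truncated where it is used.\<close>
  have "?J \<subseteq> {..<2 * n - 2}" using assms(5) by fastforce
  then have J: "?J \<subseteq> column_position n ` noncentral_columns n"
    by (simp only: bij_betw_imp_surj_on[OF bij])
  have img: "column_position n ` S = ?J"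
  proof (intro equalityI subsetI)
    fix x assume x: "x \<in> ?J"
    with J have "x \<in> column_position n ` noncentral_columns n" by (rule subsetD)
    then obtain j where j: "j \<in> noncentral_columns n" "x = column_position n j" by (rule imageE)
    with x have "j \<in> S" by (simp add: S_def)
    with j(2) show "x \<in> column_position n ` S" by (rule image_eqI)
  qed (auto simp: S_def)
  have cardS: "card S = n - 1"
  proof -
    have "card S = card ?J"
      unfolding img[symmetric] by (rule card_image[symmetric, OF inj_on_subset[OF inj S]])
    also have "\<dots> = n - 1"
      using strict_mono_on_imp_inj_on[OF assms(4)] by (simp add: card_image)
    finally show ?thesis .
  qed
  have js: "map (column_position n) (sorted_list_of_set S) = map js [1..<n]"
  proof (rule strict_sorted_equal)
    have "sorted_wrt (\<lambda>x y. column_position n x < column_position n y) (sorted_list_of_set S)"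
    proof (rule sorted_wrt_mono_rel[OF _ strict_sorted_list_of_set])
      fix x y assume "x \<in> set (sorted_list_of_set S)" "y \<in> set (sorted_list_of_set S)" "x < y"
      then show "column_position n x < column_position n y"
        using strict_mono_on_column_position S finS by (auto simp: strict_mono_on_def)
    qed
    then show "sorted_wrt (<) (map (column_position n) (sorted_list_of_set S))"
      by (simp add: sorted_wrt_map)
    have "sorted_wrt (\<lambda>x y. js x < js y) [1..<n]"
    proof (rule sorted_wrt_mono_rel[OF _ sorted_wrt_upt])
      fix x y assume "x \<in> set [1..<n]" "y \<in> set [1..<n]" "x < y"
      then have "x \<in> {1..n - 1}" "y \<in> {1..n - 1}" "x < y" by auto
      then show "js x < js y" by (rule strict_mono_onD[OF assms(4)])
    qed
    then show "sorted_wrt (<) (map js [1..<n])"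
      by (simp add: sorted_wrt_map)
    have "set [1..<n] = {1..n - 1}" using assms(1) by auto
    then show "set (map (column_position n) (sorted_list_of_set S)) = set (map js [1..<n])"
      using finS img by (simp only: set_map set_sorted_list_of_set)
  qed
  \<comment> \<open>The central column is always a 1-column but has no position, hence
    \<open>insert n S\<close>.\<close>
  have iff: "one_column_positions n T = ?J \<longleftrightarrow> col_set n T n = insert n S"
    if T: "alternating_sign_triangle n T" for T
  proof -
    let ?O = "{j \<in> noncentral_columns n. one_column n T j}"
    have "one_column_positions n T = ?J \<longleftrightarrow> column_position n ` ?O = column_position n ` S"
      by (simp only: one_column_positions_def img)
    also have "\<dots> \<longleftrightarrow> ?O = S"
      by (rule inj_on_image_eq_iff[OF inj _ S]) simp
    also have "?O = col_set n T n - {n}"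
    proof (rule set_eqI)
      fix j
      have "j \<in> col_set n T n \<Longrightarrow> j \<in> {1..2 * n - 1}" by (simp add: col_set_def)
      then show "j \<in> ?O \<longleftrightarrow> j \<in> col_set n T n - {n}"
        using one_column_iff[of j n T] by (cases "j \<in> {1..2 * n - 1}") (auto simp: noncentral_columns_def)
    qed
    also have "col_set n T n - {n} = S \<longleftrightarrow> col_set n T n = insert n S"
      using central_column(1)[OF col_set_chains(1)[OF T] assms(1)] nS by (metis Diff_insert_absorb insert_Diff)
    finally show ?thesis .
  qed
  let ?X = "{T. alternating_sign_triangle n T \<and> col_set n T n = insert n S}"
  have finX: "finite ?X"
    by (rule finite_subset[OF _ finite_alternating_sign_triangles]) auto
  obtain m where m: "n = Suc m" using assms(1) by (cases n) auto
  have "(\<Sum>T\<in>?X. ?t ^ rho n T) = chain_count ?t n n (insert n S)"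
    by (rule sum_power_rho[OF assms(1)])
  also have "\<dots> = ?t * chain_count ?t n m S"
  proof -
    have "S \<subseteq> {1..2 * Suc m - 1}" "Suc m \<notin> S" using S1 nS by (simp_all add: m)
    then show ?thesis unfolding m by (rule chain_count_last)
  qed
  also have "chain_count ?t n m S = row_value ?t n m S"
    using cardS S1 by (intro chain_count_eq_row_value) (simp_all add: m)
  also have "\<dots> = ct (to_laurent (ast_poly n) * (\<Prod>i\<leftarrow>[1..<n]. Y i ^ js i))"
    using row_value_last[OF assms(1) S js] by (simp add: m)
  finally have gf: "(\<Sum>T\<in>?X. ?t ^ rho n T) = pCons 0 (ct (to_laurent (ast_poly n) * (\<Prod>i\<leftarrow>[1..<n]. Y i ^ js i)))"
    by simp
  have "coeff (?t ^ k) r = of_bool (k = r)" for k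
    using coeff_monom[of "1 :: int" k r] by (simp add: monom_altdef)
  then have "coeff (\<Sum>T\<in>?X. ?t ^ rho n T) r = (\<Sum>T\<in>?X. of_bool (rho n T = r))"
    by (simp only: coeff_sum)
  also have "\<dots> = int (card (?X \<inter> {T. rho n T = r}))"
    using finX by simp
  also have "?X \<inter> {T. rho n T = r} = {T. alternating_sign_triangle n T
      \<and> one_column_positions n T = ?J \<and> rho n T = r}"
    using iff by auto
  \<comment> \<open>The factor \<open>t\<close> of the last row turns the coefficient at
    \<open>r\<close> into the coefficient of the constant term at \<open>r - 1\<close>, a true
    predecessor by \<open>1 \<le> r\<close>.\<close>
  finally show ?thesis
    using assms(2) ct_to_laurent[where p = "ast_poly n" and n = n and js = js and k = "r - 1"]
    unfolding gf by (simp add: coeff_pCons split: nat.splits)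
qed

end
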